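(* Assume: (a) the marginal CDF $F$ of the nonconformity scores $V_t$ is continuous and $\Theta=\sum_{k\ge0}\theta_k<\infty$; (b) there are $e>0$ and $0<c_f\le C_f<\infty$ such that $F$ has a density $f$ with $c_f\le f(v)\le C_f$ for $|v-q|\le e$, and this density is continuous at $q$; and $\mathbb P(V_s=V_t)=0$ for all distinct integer times $s,t$. Then the series $$\sigma_{\rm cov}^2=\sum_{h\in\mathbb Z}\operatorname{Cov}\{\mathbf 1(V_0\le q),\mathbf 1(V_h\le q)\}$$ is absolutely convergent, and, as $n,m\to\infty$, $$\sqrt{\frac{nm}{n+m}}\,\{\widehat{\mathrm{Cov}}_{n,m}-(1-\alpha)\}\xrightarrow{d}N(0,\sigma_{\rm cov}^2).$$ The zero-variance (degenerate) Gaussian is allowed in this statement.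
   Context: Setup. $(\varepsilon_t)_{t\in\mathbb Z}$ are iid random innovations (possibly vector-valued). $Z_t=(X_t,Y_t)$, with $X_t\in\mathbb R^d$, $Y_t\in\mathbb R$, is a stationary process of the form $Z_t=G(\ldots,\varepsilon_{t-1},\varepsilon_t)$ with a measurable function $G$. The predictor $\widehat\mu:\mathbb R^d\to\mathbb R$ is a fixed (nonrandom) measurable function. The nonconformity scores are $V_t=|Y_t-\widehat\mu(X_t)|=H(\ldots,\varepsilon_{t-1},\varepsilon_t)$, with a measurable function $H$. $F(v)=\mathbb P(V_t\le v)$. Split conformal procedure and realized coverage. For fixed $0<\alpha<1$, $k_n=\lceil(n+1)(1-\alpha)\rceil$, and $\widehat q_n=V_{(k_n)}$ is the $k_n$-th order statistic of the calibration scores $V_1,\ldots,V_n$ (with $\widehat q_n=\infty$ if $k_n>n$). The prediction interval is $\widehat C_n(x)=[\widehat\mu(x)-\widehat q_n,\widehat\mu(x)+\widehat q_n]$. The realized coverage on the adjacent test set $\{n+1,\ldots,n+m\}$ is $$\widehat{\mathrm{Cov}}_{n,m}=\frac1m\sum_{t=n+1}^{n+m}\mathbf 1\{Y_t\in\widehat C_n(X_t)\}=\frac1m\sum_{t=n+1}^{n+m}\mathbf 1\{V_t\le\widehat q_n\}.$$ $q=F^{-1}(1-\alpha)=\inf\{v:F(v)\ge1-\alpha\}$. Functional dependence of threshold indicators. Let $\varepsilon_0'$ be an independent copy of $\varepsilon_0$, independent of all the innovations, and let $V_k^*$ be $V_k$ with $\varepsilon_0$ replaced by $\varepsilon_0'$,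 all other innovations unchanged. With $\|U\|_2=(\mathbb E|U|^2)^{1/2}$, $\theta_k=\sup_{v\in\mathbb R}\|\mathbf 1\{V_k\le v\}-\mathbf 1\{V_k^*\le v\}\|_2$ for $k\ge0$, and $\Theta=\sum_{k=0}^\infty\theta_k$. *)

theory Defs
  imports "HOL-Probability.Probability"
begin

definition covariance :: "'a measure \<Rightarrow> ('a \<Rightarrow> real) \<Rightarrow> ('a \<Rightarrow> real) \<Rightarrow> real" where
  "covariance M U W =
     (\<integral>\<omega>. (U \<omega> - (\<integral>\<omega>'. U \<omega>' \<partial>M)) * (W \<omega> - (\<integral>\<omega>'. W \<omega>' \<partial>M)) \<partial>M)"

definition norm_L2 :: "'a measure \<Rightarrow> ('a \<Rightarrow> real) \<Rightarrow> real" where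
  "norm_L2 M U = sqrt (\<integral>\<omega>. \<bar>U \<omega>\<bar>\<^sup>2 \<partial>M)"

(* Gaussian law parametrised by its variance; variance 0 gives the point mass at the mean.
   Meaningful only for v \<ge> 0. *)
definition normal_law :: "real \<Rightarrow> real \<Rightarrow> real measure" where
  "normal_law m v =
     (if v = 0 then return borel m else density lborel (normal_density m (sqrt v)))"

(* weak_conv_m with an arbitrary filter in place of sequentially, so that limits in several
   indices can be expressed. *)
definition weak_conv_along :: "('i \<Rightarrow> real measure) \<Rightarrow> real measure \<Rightarrow> 'i filter \<Rightarrow> bool" where
  "weak_conv_along \<mu> \<nu> A \<longleftrightarrow>
     (\<forall>x. isCont (cdf \<nu>) x \<longrightarrow> ((\<lambda>i. cdf (\<mu> i) x) \<longlongrightarrow> cdf \<nu> x) A)"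

lemma weak_conv_along_sequentially: "weak_conv_along \<mu> \<nu> sequentially \<longleftrightarrow> weak_conv_m \<mu> \<nu>"
  by (simp add: weak_conv_along_def weak_conv_m_def weak_conv_def)

(* f is a density, on the interval [a, b], of the distribution function F. *)
definition density_of_cdf_on :: "(real \<Rightarrow> real) \<Rightarrow> (real \<Rightarrow> real) \<Rightarrow> real \<Rightarrow> real \<Rightarrow> bool" where
  "density_of_cdf_on F f a b \<longleftrightarrow>
     set_integrable lborel {a..b} f \<and>
     (\<forall>x y. a \<le> x \<and> x \<le> y \<and> y \<le> b \<longrightarrow> F y - F x = (LBINT v:{x..y}. f v))"

definition quantile :: "(real \<Rightarrow> real) \<Rightarrow> real \<Rightarrow> real" where
  "quantile F p = Inf {v. F v \<ge> p}"

definition conformal_rank :: "real \<Rightarrow> nat \<Rightarrow> nat" where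
  "conformal_rank \<alpha> n = nat \<lceil>(real n + 1) * (1 - \<alpha>)\<rceil>"

(* Ranks are counted from 1, list positions from 0; conformal_rank \<alpha> n \<ge> 1 when \<alpha> < 1. *)
definition conformal_quantile :: "real \<Rightarrow> (int \<Rightarrow> 'a \<Rightarrow> real) \<Rightarrow> nat \<Rightarrow> 'a \<Rightarrow> ereal" where
  "conformal_quantile \<alpha> V n \<omega> =
     (if conformal_rank \<alpha> n > n then \<infinity>
      else ereal (sort (map (\<lambda>t. V t \<omega>) [1..int n]) ! (conformal_rank \<alpha> n - 1)))"

definition prediction_interval ::
    "real \<Rightarrow> ('x \<Rightarrow> real) \<Rightarrow> (int \<Rightarrow> 'a \<Rightarrow> real) \<Rightarrow> nat \<Rightarrow> 'a \<Rightarrow> 'x \<Rightarrow> real set" where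
  "prediction_interval \<alpha> \<mu> V n \<omega> x =
     {y. ereal (\<mu> x) - conformal_quantile \<alpha> V n \<omega> \<le> ereal y \<and>
         ereal y \<le> ereal (\<mu> x) + conformal_quantile \<alpha> V n \<omega>}"

definition realized_coverage ::
    "real \<Rightarrow> ('x \<Rightarrow> real) \<Rightarrow> (int \<Rightarrow> 'a \<Rightarrow> 'x) \<Rightarrow> (int \<Rightarrow> 'a \<Rightarrow> real) \<Rightarrow> (int \<Rightarrow> 'a \<Rightarrow> real) \<Rightarrow>
       nat \<Rightarrow> nat \<Rightarrow> 'a \<Rightarrow> real" where
  "realized_coverage \<alpha> \<mu> X Y V n m \<omega> =
     (1 / real m) *
     (\<Sum>t \<in> {int n + 1..int n + int m}.
        indicator (prediction_interval \<alpha> \<mu> V n \<omega> (X t \<omega>)) (Y t \<omega>))"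

(* The functional dependence coefficient at lag k, where V' is the process V recomputed with the
   innovation at time 0 replaced by an independent copy. The norms are at most 1 on a
   probability space, so the supremum is a genuine one. *)
definition threshold_dependence ::
    "'a measure \<Rightarrow> (int \<Rightarrow> 'a \<Rightarrow> real) \<Rightarrow> (int \<Rightarrow> 'a \<Rightarrow> real) \<Rightarrow> nat \<Rightarrow> real" where
  "threshold_dependence M V V' k =
     (SUP v. norm_L2 M (\<lambda>\<omega>. indicator {..v} (V (int k) \<omega>) - indicator {..v} (V' (int k) \<omega>)))"

definition coverage_autocov ::
    "'a measure \<Rightarrow> (int \<Rightarrow> 'a \<Rightarrow> real) \<Rightarrow> real \<Rightarrow> int \<Rightarrow> real" where
  "coverage_autocov M V q h =
     covariance M (\<lambda>\<omega>. indicator {..q} (V 0 \<omega>)) (\<lambda>\<omega>. indicator {..q} (V h \<omega>))"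

end

theory Submission
  imports Defs
begin

text \<open>Write \<open>p = 1 - \<alpha>\<close>, \<open>\<xi>\<^sub>t = 1{V\<^sub>t \<le> q} - p\<close> and \<open>r = sqrt (n m / (n + m))\<close>. The theorem combines a
linearization of the realized coverage with a normal limit for the linear term.

Linearization. The calibration quantile exceeds \<open>v\<close> exactly when fewer than \<open>k\<close> of the calibration
scores are at most \<open>v\<close>, so at scale \<open>1 / sqrt n\<close> around the level \<open>p\<close> its position is determined by
the centred counts of scores below thresholds near \<open>q\<close>. Centred counts at two thresholds \<open>v\<close> and
\<open>w\<close> differ, relative to \<open>sqrt n\<close>, by little in mean square when \<open>F v\<close> and \<open>F w\<close> are close. Counts
are monotone in the threshold, so it suffices to control them on a finite grid whose levels are
\<open>\<epsilon> / sqrt n\<close> apart; outside an event of small probability,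
\<open>r (Cov - p)\<close> is then within \<open>4 \<epsilon>\<close> of \<open>r\<close> times the difference between the mean of the \<open>\<xi>\<^sub>t\<close> over
the test set and their mean over the calibration set
(\<open>coverage_linearization\<close>, \<open>coverage_linearization_in_probability\<close>).

Dependence. All probabilistic estimates come from one inequality for functions \<open>A\<close>, \<open>B\<close> of
independent coordinates: the covariance of \<open>A\<close> and \<open>B\<close> is at most half the sum over the coordinates
\<open>j\<close> of the product of their influences, the influence being the root-mean-square change when coordinate
\<open>j\<close> is resampled (\<open>covariance_influence_bound\<close>). It is proved by replacing the coordinates
of \<open>B\<close> one at a time by independent copies and exploiting the symmetry between a coordinate and its
copy. For the indicator of a threshold, the influence of the innovation \<open>k\<close> steps back is at most the
dependence coefficient \<open>\<theta>\<^sub>k\<close>. The inequality yields the variance of partial sums, the summability of the autocovariances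
and, applied to complex exponentials, the asymptotic independence of adjacent blocks.

Normal limit. For adjacent blocks the exponential version of the inequality costs
\<open>u\<^sup>2\<close> times \<open>\<Theta> (\<tau>\<^sub>1 + ... + \<tau>\<^sub>b) / 2\<close>, where \<open>b\<close> is the length of the later block and \<open>\<tau>\<^sub>i\<close> the
tail sum of the \<open>\<theta>\<^sub>k\<close> with \<open>k \<ge> i\<close>; this is \<open>u\<^sup>2 o(b)\<close>, since tail sums vanish. Hence a sum of length \<open>n\<close>
may be cut into adjacent blocks of a fixed length \<open>b\<close>, and its characteristic function replaced by
a power of that of one block, with an error that is small for large \<open>b\<close>. A Taylor expansion and
the convergence of the block variance per unit length to \<open>\<sigma>\<^sup>2\<close> give the Gaussian limit
(\<open>char_S_normal_limit\<close>), uniformly in the scaling, which is what the two sample sizes of arbitrary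
ratio require. The same block estimate separates the calibration set from the
adjacent test set, and the two Gaussian factors have variances
that add up to \<open>\<sigma>\<^sup>2\<close> (\<open>char_two_samples_normal_limit\<close>). Levy's continuity theorem concludes.\<close>

section \<open>Square-integrable functions\<close>

lemma norm_L2_nonneg [simp]: "0 \<le> norm_L2 M U"
  by (simp add: norm_L2_def)

lemma norm_L2_power2: "(norm_L2 M U)\<^sup>2 = (\<integral>\<omega>. (U \<omega>)\<^sup>2 \<partial>M)"
  by (simp add: norm_L2_def)

lemma norm_L2_abs [simp]: "norm_L2 M (\<lambda>\<omega>. \<bar>U \<omega>\<bar>) = norm_L2 M U"
  by (simp add: norm_L2_def)

lemma norm_L2_cmult: "norm_L2 M (\<lambda>\<omega>. c * U \<omega>) = \<bar>c\<bar> * norm_L2 M U"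
  by (simp add: norm_L2_def power_mult_distrib real_sqrt_mult)

lemma (in finite_measure) integrable_if_bounded:
  fixes f :: "'a \<Rightarrow> 'b::{banach, second_countable_topology}"
  assumes "f \<in> borel_measurable M" "\<And>x. norm (f x) \<le> B"
  shows "integrable M f"
  using assms by (intro integrable_const_bound[where B = B]) auto

lemma norm_L2_Cauchy_Schwarz:
  assumes [measurable]: "U \<in> borel_measurable M" "W \<in> borel_measurable M"
    and U2: "integrable M (\<lambda>x. (U x)\<^sup>2)" and W2: "integrable M (\<lambda>x. (W x)\<^sup>2)"
  shows "integrable M (\<lambda>x. U x * W x)"
    and "(\<integral>x. \<bar>U x\<bar> * \<bar>W x\<bar> \<partial>M) \<le> norm_L2 M U * norm_L2 M W"
proof -
  have "\<bar>U x * W x\<bar> \<le> (U x)\<^sup>2 + (W x)\<^sup>2" for x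
  proof -
    have "2 * \<bar>U x\<bar> * \<bar>W x\<bar> \<le> \<bar>U x\<bar>\<^sup>2 + \<bar>W x\<bar>\<^sup>2" by (rule sum_squares_bound)
    moreover have "0 \<le> \<bar>U x\<bar> * \<bar>W x\<bar>" by simp
    ultimately show ?thesis unfolding abs_mult power2_abs by linarith
  qed
  then show int: "integrable M (\<lambda>x. U x * W x)"
    by (intro Bochner_Integration.integrable_bound[OF Bochner_Integration.integrable_add[OF U2 W2]])
       (auto intro!: AE_I2)
  have int': "integrable M (\<lambda>x. \<bar>U x\<bar> * \<bar>W x\<bar>)"
    using integrable_norm[OF int] by (simp add: abs_mult)
  have nn: "(\<integral>\<^sup>+x. ennreal \<bar>f x\<bar> ^ 2 \<partial>M) = ennreal (\<integral>x. (f x)\<^sup>2 \<partial>M)"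
    if "integrable M (\<lambda>x. (f x)\<^sup>2)" for f :: "'a \<Rightarrow> real"
    using nn_integral_eq_integral[OF that] by (simp add: ennreal_power)
  have "ennreal (\<integral>x. \<bar>U x\<bar> * \<bar>W x\<bar> \<partial>M) = (\<integral>\<^sup>+x. ennreal \<bar>U x\<bar> * ennreal \<bar>W x\<bar> \<partial>M)"
    by (subst nn_integral_eq_integral[OF int', symmetric]) (simp_all add: ennreal_mult')
  then have "ennreal ((\<integral>x. \<bar>U x\<bar> * \<bar>W x\<bar> \<partial>M)\<^sup>2) = (\<integral>\<^sup>+x. ennreal \<bar>U x\<bar> * ennreal \<bar>W x\<bar> \<partial>M)\<^sup>2"
    by (subst ennreal_power[symmetric]) simp_all
  also have "\<dots> \<le> (\<integral>\<^sup>+x. ennreal \<bar>U x\<bar> ^ 2 \<partial>M) * (\<integral>\<^sup>+x. ennreal \<bar>W x\<bar> ^ 2 \<partial>M)"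
    by (rule Cauchy_Schwarz_nn_integral) auto
  also have "\<dots> = ennreal ((norm_L2 M U * norm_L2 M W)\<^sup>2)"
    by (simp add: nn U2 W2 power_mult_distrib norm_L2_power2 ennreal_mult')
  finally have "(\<integral>x. \<bar>U x\<bar> * \<bar>W x\<bar> \<partial>M)\<^sup>2 \<le> (norm_L2 M U * norm_L2 M W)\<^sup>2"
    by (simp add: ennreal_le_iff)
  then show "(\<integral>x. \<bar>U x\<bar> * \<bar>W x\<bar> \<partial>M) \<le> norm_L2 M U * norm_L2 M W"
    by (rule power2_le_imp_le) simp
qed

lemma norm_L2_triangle:
  assumes [measurable]: "U \<in> borel_measurable M" "W \<in> borel_measurable M"
    and U2: "integrable M (\<lambda>x. (U x)\<^sup>2)" and W2: "integrable M (\<lambda>x. (W x)\<^sup>2)"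
  shows "norm_L2 M (\<lambda>x. U x + W x) \<le> norm_L2 M U + norm_L2 M W"
proof (rule power2_le_imp_le)
  note CS = norm_L2_Cauchy_Schwarz[OF assms]
  have "(norm_L2 M (\<lambda>x. U x + W x))\<^sup>2 = (\<integral>x. (U x)\<^sup>2 + (W x)\<^sup>2 + 2 * (U x * W x) \<partial>M)"
    by (simp add: norm_L2_power2 power2_sum mult.assoc)
  also have "\<dots> = (norm_L2 M U)\<^sup>2 + (norm_L2 M W)\<^sup>2 + 2 * (\<integral>x. U x * W x \<partial>M)"
    using CS U2 W2 by (simp add: norm_L2_power2)
  also have "(\<integral>x. U x * W x \<partial>M) \<le> (\<integral>x. \<bar>U x\<bar> * \<bar>W x\<bar> \<partial>M)"
    using CS(1) integrable_norm[OF CS(1)] by (intro integral_mono) (auto simp: abs_mult[symmetric])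
  finally show "(norm_L2 M (\<lambda>x. U x + W x))\<^sup>2 \<le> (norm_L2 M U + norm_L2 M W)\<^sup>2"
    using CS(2) by (simp add: power2_sum)
qed simp

lemma (in finite_measure) norm_L2_mono:
  assumes [measurable]: "U \<in> borel_measurable M" "W \<in> borel_measurable M"
    and W2: "integrable M (\<lambda>x. (W x)\<^sup>2)" and le: "\<And>x. x \<in> space M \<Longrightarrow> \<bar>U x\<bar> \<le> \<bar>W x\<bar>"
  shows "norm_L2 M U \<le> norm_L2 M W"
proof -
  have le2: "(U x)\<^sup>2 \<le> (W x)\<^sup>2" if "x \<in> space M" for x
    using le[OF that] by (simp add: abs_le_square_iff)
  have "integrable M (\<lambda>x. (U x)\<^sup>2)"
    by (rule Bochner_Integration.integrable_bound[OF W2]) (auto intro!: AE_I2 le2)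
  then show ?thesis
    using W2 le2 by (auto simp: norm_L2_def intro!: integral_mono)
qed

lemma (in finite_measure) norm_L2_sum_le:
  fixes U :: "'i \<Rightarrow> 'a \<Rightarrow> real"
  assumes "finite I" "\<And>i. i \<in> I \<Longrightarrow> U i \<in> borel_measurable M"
    and "\<And>i x. i \<in> I \<Longrightarrow> \<bar>U i x\<bar> \<le> B"
  shows "norm_L2 M (\<lambda>x. \<Sum>i\<in>I. U i x) \<le> (\<Sum>i\<in>I. norm_L2 M (U i))"
  using assms
proof (induction I rule: finite_induct)
  case empty
  then show ?case by (simp add: norm_L2_def)
next
  case (insert i I)
  note [measurable] = insert.prems(1)
  have sq: "integrable M (\<lambda>x. (f x)\<^sup>2)"
    if "f \<in> borel_measurable M" "\<And>x. \<bar>f x\<bar> \<le> b" for f :: "'a \<Rightarrow> real" and b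
  proof (rule integrable_if_bounded[where B = "b\<^sup>2"])
    have "\<bar>f x\<bar>\<^sup>2 \<le> b\<^sup>2" for x by (rule power_mono[OF that(2)]) simp
    then show "norm ((f x)\<^sup>2) \<le> b\<^sup>2" for x by simp
  qed (use that in measurable)
  have "norm_L2 M (\<lambda>x. \<Sum>i\<in>insert i I. U i x) = norm_L2 M (\<lambda>x. U i x + (\<Sum>i\<in>I. U i x))"
    using insert.hyps by simp
  also have "\<dots> \<le> norm_L2 M (U i) + norm_L2 M (\<lambda>x. \<Sum>i\<in>I. U i x)"
  proof (rule norm_L2_triangle)
    show "integrable M (\<lambda>x. (U i x)\<^sup>2)"
      by (rule sq[where b = B]) (use insert.prems in auto)
    show "integrable M (\<lambda>x. (\<Sum>i\<in>I. U i x)\<^sup>2)"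
      by (rule sq[where b = "real (card I) * B"])
        (use insert.prems in \<open>auto intro!: order_trans[OF sum_abs] sum_bounded_above\<close>)
  qed (use insert.prems in auto)
  finally show ?case using insert by force
qed

section \<open>Independent families and coordinate resampling\<close>

abbreviation iid :: "'e measure \<Rightarrow> ('i \<Rightarrow> 'e) measure" where
  "iid \<nu> \<equiv> (\<Pi>\<^sub>M i\<in>UNIV. \<nu>)"

lemma measurable_reindex: "(\<lambda>z i. z (f i)) \<in> iid \<nu> \<rightarrow>\<^sub>M iid \<nu>"
  by (rule measurable_PiM_single') (auto simp: space_PiM)

lemma prob_space_iid: "prob_space \<nu> \<Longrightarrow> prob_space (iid \<nu>)"
  by (intro prob_space_PiM)

lemma distr_iid_reindex:
  assumes "prob_space \<nu>" "inj f"
  shows "distr (iid \<nu>) (iid \<nu>) (\<lambda>z i. z (f i)) = iid \<nu>"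
  using distr_PiM_reindex[of UNIV "\<lambda>_. \<nu>" f UNIV] assms by (simp add: restrict_UNIV)

lemma integral_iid_reindex:
  fixes g :: "('k \<Rightarrow> 'e) \<Rightarrow> 'b::{banach, second_countable_topology}"
  assumes "prob_space \<nu>" "inj f" "g \<in> borel_measurable (iid \<nu>)"
  shows "(\<integral>z. g (\<lambda>i. z (f i)) \<partial>iid \<nu>) = (\<integral>z. g z \<partial>iid \<nu>)"
  using integral_distr[OF measurable_reindex assms(3), of f] by (simp add: distr_iid_reindex assms(1,2))

lemma integrable_iid_reindex:
  fixes g :: "('k \<Rightarrow> 'e) \<Rightarrow> 'b::{banach, second_countable_topology}"
  assumes "prob_space \<nu>" "inj f" "integrable (iid \<nu>) g"
  shows "integrable (iid \<nu>) (\<lambda>z. g (\<lambda>i. z (f i)))"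
  by (rule integrable_distr[OF measurable_reindex]) (simp add: distr_iid_reindex assms)

lemma measure_iid_reindex:
  assumes "prob_space \<nu>" "inj f" "A \<in> sets (iid \<nu>)"
  shows "measure (iid \<nu>) {z \<in> space (iid \<nu>). (\<lambda>i. z (f i)) \<in> A} = measure (iid \<nu>) A"
  using measure_distr[OF measurable_reindex assms(3), of f]
  by (simp add: distr_iid_reindex assms(1,2) vimage_def Int_def conj_commute)

text \<open>Two independent copies of a family are a single family indexed by pairs with a flag; taking
  the second copy exactly at the coordinates in \<open>J\<close> is then a mere reindexing.\<close>

definition mixed :: "'i set \<Rightarrow> ('i \<times> bool \<Rightarrow> 'e) \<Rightarrow> 'i \<Rightarrow> 'e" where
  "mixed J z = (\<lambda>i. z (i, i \<in> J))"

lemma measurable_mixed [measurable]: "mixed J \<in> iid \<nu> \<rightarrow>\<^sub>M iid \<nu>"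
  unfolding mixed_def by (rule measurable_reindex)

lemma inj_mixed: "inj (\<lambda>i. (i, i \<in> J))"
  by (auto simp: inj_def)

lemmas integral_mixed = integral_iid_reindex[OF _ inj_mixed, folded mixed_def]
lemmas integrable_mixed = integrable_iid_reindex[OF _ inj_mixed, folded mixed_def]
lemmas measure_mixed = measure_iid_reindex[OF _ inj_mixed, folded mixed_def]

text \<open>Only one coordinate is resampled at a time, so the option type supplies the index set with the one
spare coordinate \<open>None\<close> that holds the independent copy. Both the original family and the resampled
one are then reindexings of the same independent family.\<close>

definition resample :: "'i \<Rightarrow> ('i option \<Rightarrow> 'e) \<Rightarrow> 'i \<Rightarrow> 'e" where
  "resample j w = (\<lambda>i. w (if i = j then None else Some i))"

definition influence :: "'e measure \<Rightarrow> (('i \<Rightarrow> 'e) \<Rightarrow> 'b::real_normed_vector) \<Rightarrow> 'i \<Rightarrow> real" where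
  "influence \<nu> A j = norm_L2 (iid \<nu>) (\<lambda>w. norm (A (\<lambda>i. w (Some i)) - A (resample j w)))"

lemma measurable_resample [measurable]: "resample j \<in> iid \<nu> \<rightarrow>\<^sub>M iid \<nu>"
  unfolding resample_def by (rule measurable_reindex)

lemma influence_nonneg [simp]: "0 \<le> influence \<nu> A j"
  by (simp add: influence_def)

text \<open>The sets with this property form a \<open>\<sigma>\<close>-algebra that contains the cylinders over one coordinate: in a
countable union all but finitely many members can be neglected, up to small measure, and a finite
union depends on the coordinates of its members.\<close>

lemma set_depends_on_finitely_many:
  assumes \<nu>: "prob_space \<nu>" and A: "A \<in> sets (iid \<nu> :: ('i \<Rightarrow> 'e) measure)" and "0 < \<eta>"
  shows "\<exists>J0. finite J0 \<and> (\<forall>J. J0 \<subseteq> J \<longrightarrow>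
    measure (iid \<nu>) {z \<in> space (iid \<nu>). (mixed UNIV z \<in> A) \<noteq> (mixed J z \<in> A)} < \<eta>)"
proof -
  interpret Q: prob_space "iid \<nu> :: ('i \<times> bool \<Rightarrow> 'e) measure" by (rule prob_space_iid[OF \<nu>])
  interpret P: prob_space "iid \<nu> :: ('i \<Rightarrow> 'e) measure" by (rule prob_space_iid[OF \<nu>])
  let ?Q = "iid \<nu> :: ('i \<times> bool \<Rightarrow> 'e) measure"
  let ?bad = "\<lambda>A J. {z \<in> space ?Q. (mixed UNIV z \<in> A) \<noteq> (mixed J z \<in> A)}"
  let ?G = "{{f \<in> \<Pi>\<^sub>E i\<in>UNIV. space \<nu>. f i \<in> A} | (i::'i) A. i \<in> UNIV \<and> A \<in> sets \<nu>}"
  have sp: "mixed J z \<in> (\<Pi>\<^sub>E i\<in>UNIV. space \<nu>)" if "z \<in> space ?Q" for z and J :: "'i set"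
    using that by (auto simp: space_PiM mixed_def)
  have gen: "sets (iid \<nu>) = sigma_sets (\<Pi>\<^sub>E i\<in>UNIV. space \<nu>) ?G"
    by (rule sets_PiM_single)
  have "A \<in> sigma_sets (\<Pi>\<^sub>E i\<in>UNIV. space \<nu>) ?G"
    using A gen by simp
  then have "\<forall>\<eta>>0. \<exists>J0. finite J0 \<and> (\<forall>J. J0 \<subseteq> J \<longrightarrow> measure ?Q (?bad A J) < \<eta>)"
  proof (induction rule: sigma_sets.induct)
    case (Basic A)
    then obtain i B where A: "A = {f \<in> \<Pi>\<^sub>E i\<in>UNIV. space \<nu>. f i \<in> B}" by auto
    have "?bad A J = {}" if "{i} \<subseteq> J" for J
      using that sp[of _ J] sp[of _ UNIV] by (auto simp: A mixed_def simp del: PiE_UNIV_domain)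
    then show ?case by (intro allI impI exI[of _ "{i}"]) (auto simp del: Collect_empty_eq)
  next
    case Empty
    then show ?case by (intro allI impI exI[of _ "{}"]) auto
  next
    case (Compl A)
    have "?bad ((\<Pi>\<^sub>E i\<in>UNIV. space \<nu>) - A) J = ?bad A J" for J
      using sp by auto
    with Compl show ?case by simp
  next
    case (Union A)
    have A[measurable]: "A i \<in> sets (iid \<nu>)" for i
      using Union.hyps gen by blast
    show ?case
    proof (intro allI impI)
      fix \<eta> :: real assume "0 < \<eta>"
      define S where "S = (\<Union>i. A i)"
      define B where "B n = (\<Union>i<n. A i)" for n :: nat
      have sets[measurable]: "B n \<in> sets (iid \<nu>)" "S \<in> sets (iid \<nu>)" for n
        unfolding B_def S_def by measurable
      have "(\<lambda>n. measure (iid \<nu>) (B n)) \<longlonglongrightarrow> measure (iid \<nu>) (\<Union>n. B n)"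
        by (rule P.finite_Lim_measure_incseq) (auto simp: incseq_def B_def intro: order_less_le_trans)
      also have "(\<Union>n. B n) = S" by (auto simp: B_def S_def)
      finally obtain n where "\<bar>measure (iid \<nu>) (B n) - measure (iid \<nu>) S\<bar> < \<eta> / 3"
        using \<open>0 < \<eta>\<close> unfolding LIMSEQ_iff real_norm_def by (metis divide_pos_pos zero_less_numeral order_refl)
      then have "P.prob S - P.prob (B n) < \<eta> / 3" unfolding abs_less_iff by linarith
      moreover have "B n \<subseteq> S" by (auto simp: B_def S_def)
      ultimately have tail: "P.prob (S - B n) < \<eta> / 3"
        by (simp only: P.finite_measure_Diff[OF sets(2,1)])
      have "\<exists>J0. finite J0 \<and> (\<forall>J. J0 \<subseteq> J \<longrightarrow> measure ?Q (?bad (A i) J) < \<eta> / (3 * real (Suc n)))" for i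
        using Union.IH[of i] \<open>0 < \<eta>\<close> by simp
      then have "\<exists>J0. \<forall>i. finite (J0 i) \<and>
          (\<forall>J. J0 i \<subseteq> J \<longrightarrow> measure ?Q (?bad (A i) J) < \<eta> / (3 * real (Suc n)))"
        by (intro choice) blast
      then obtain J0 where J0': "\<forall>i. finite (J0 i) \<and>
          (\<forall>J. J0 i \<subseteq> J \<longrightarrow> measure ?Q (?bad (A i) J) < \<eta> / (3 * real (Suc n)))"
        by (rule exE)
      then have J0: "\<And>i. finite (J0 i)"
          "\<And>i J. J0 i \<subseteq> J \<Longrightarrow> measure ?Q (?bad (A i) J) < \<eta> / (3 * real (Suc n))"
        by blast+
      have "measure ?Q (?bad S J) < \<eta>" if J: "(\<Union>i<n. J0 i) \<subseteq> J" for J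
      proof -
        let ?T = "\<lambda>K. {z \<in> space ?Q. mixed K z \<in> S - B n}"
        have [measurable]: "?T K \<in> sets ?Q" for K
          by measurable
        have "?bad (A i) K = {z \<in> space ?Q. mixed UNIV z \<in> A i \<and> \<not> mixed K z \<in> A i} \<union>
          {z \<in> space ?Q. mixed K z \<in> A i \<and> \<not> mixed UNIV z \<in> A i}" for i K by blast
        then have [measurable]: "?bad (A i) K \<in> sets ?Q" for i K
          by simp
        have "?bad S J \<subseteq> ?T UNIV \<union> ?T J \<union> (\<Union>i<n. ?bad (A i) J)"
        proof
          fix z assume z: "z \<in> ?bad S J"
          show "z \<in> ?T UNIV \<union> ?T J \<union> (\<Union>i<n. ?bad (A i) J)"
          proof (cases "(mixed UNIV z \<in> B n) = (mixed J z \<in> B n)")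
            case True
            then show ?thesis using z \<open>B n \<subseteq> S\<close> by blast
          next
            case False
            then show ?thesis using z by (auto simp: B_def)
          qed
        qed
        then have "measure ?Q (?bad S J) \<le> measure ?Q (?T UNIV \<union> ?T J \<union> (\<Union>i<n. ?bad (A i) J))"
          by (rule Q.finite_measure_mono) measurable
        also have "\<dots> \<le> measure ?Q (?T UNIV \<union> ?T J) + measure ?Q (\<Union>i<n. ?bad (A i) J)"
          by (intro measure_Un_le) measurable
        also have "measure ?Q (?T UNIV \<union> ?T J) \<le> measure ?Q (?T UNIV) + measure ?Q (?T J)"
          by (intro measure_Un_le) measurable
        also have "measure ?Q (\<Union>i<n. ?bad (A i) J) \<le> (\<Sum>i<n. measure ?Q (?bad (A i) J))"
          by (intro measure_UNION_le) simp_all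
        also have "\<dots> \<le> (\<Sum>i<n. \<eta> / (3 * real (Suc n)))"
          by (rule sum_mono, rule less_imp_le, rule J0) (use J in blast)
        also have "\<dots> \<le> \<eta> / 3" using \<open>0 < \<eta>\<close> by (simp add: field_simps)
        finally have "measure ?Q (?bad S J) \<le> measure ?Q (?T UNIV) + measure ?Q (?T J) + \<eta> / 3"
          by simp
        moreover have "measure ?Q (?T K) < \<eta> / 3" for K
          using tail by (subst measure_mixed[OF \<nu>]) simp_all
        ultimately show ?thesis
          by (elim le_less_trans) (use \<open>\<And>K. measure ?Q (?T K) < \<eta> / 3\<close>[of UNIV] \<open>\<And>K. measure ?Q (?T K) < \<eta> / 3\<close>[of J] in argo)
      qed
      then show "\<exists>J0. finite J0 \<and> (\<forall>J. J0 \<subseteq> J \<longrightarrow> measure ?Q (?bad (\<Union> (range A)) J) < \<eta>)"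
        using J0(1) by (intro exI[of _ "\<Union>i<n. J0 i"]) (auto simp: S_def)
    qed
  qed
  then show ?thesis using \<open>0 < \<eta>\<close> by simp
qed

text \<open>The previous lemma for indicators passes to integrable functions by approximation. Its purpose is to
turn the exchange of finitely many coordinates into the exchange of all of them.\<close>

lemma depends_on_finitely_many:
  fixes B :: "('i \<Rightarrow> 'e) \<Rightarrow> 'b::{banach, second_countable_topology}"
  assumes \<nu>: "prob_space \<nu>" and B: "integrable (iid \<nu>) B"
  shows "0 < \<eta> \<Longrightarrow> \<exists>J0. finite J0 \<and> (\<forall>J. J0 \<subseteq> J \<longrightarrow>
    (\<integral>z. norm (B (mixed UNIV z) - B (mixed J z)) \<partial>iid \<nu>) < \<eta>)"
  using B
proof (induction arbitrary: \<eta> rule: integrable_induct)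
  case (base A c)
  interpret Q: prob_space "iid \<nu> :: ('i \<times> bool \<Rightarrow> 'e) measure" by (rule prob_space_iid[OF \<nu>])
  note [measurable] = \<open>A \<in> sets (iid \<nu>)\<close>
  let ?bad = "\<lambda>J. {z \<in> space (iid \<nu>). (mixed UNIV z \<in> A) \<noteq> (mixed J z \<in> A)}"
  have "0 < \<eta> / (norm c + 1)" using \<open>0 < \<eta>\<close> by (simp add: add_nonneg_pos)
  from set_depends_on_finitely_many[OF \<nu> \<open>A \<in> sets (iid \<nu>)\<close> this]
  obtain J0 where J0: "finite J0" "\<And>J. J0 \<subseteq> J \<Longrightarrow> measure (iid \<nu>) (?bad J) < \<eta> / (norm c + 1)"
    by blast
  have "(\<integral>z. norm (indicator A (mixed UNIV z) *\<^sub>R c - indicator A (mixed J z) *\<^sub>R c) \<partial>iid \<nu>) < \<eta>"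
    if "J0 \<subseteq> J" for J
  proof -
    have "(\<integral>z. norm (indicator A (mixed UNIV z) *\<^sub>R c - indicator A (mixed J z) *\<^sub>R c) \<partial>iid \<nu>) =
        (\<integral>z. indicator (?bad J) z * norm c \<partial>iid \<nu>)"
      by (rule Bochner_Integration.integral_cong) (auto simp: indicator_def)
    also have "\<dots> = norm c * measure (iid \<nu>) (?bad J)" by (simp add: mult.commute)
    also have "\<dots> \<le> norm c * (\<eta> / (norm c + 1))" using J0(2)[OF that] by (intro mult_left_mono) auto
    also have "\<dots> = \<eta> * (norm c / (norm c + 1))" by simp
    also have "\<dots> < \<eta> * 1"
      using \<open>0 < \<eta>\<close> by (intro mult_strict_left_mono) (simp_all add: divide_less_eq add_nonneg_pos)
    finally show ?thesis by simp
  qed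
  with J0(1) show ?case by blast
next
  case (add f g)
  have "0 < \<eta> / 2" using \<open>0 < \<eta>\<close> by simp
  from add.IH(1)[OF this] add.IH(2)[OF this] obtain J1 J2 where J: "finite J1" "finite J2"
    "\<And>J. J1 \<subseteq> J \<Longrightarrow> (\<integral>z. norm (f (mixed UNIV z) - f (mixed J z)) \<partial>iid \<nu>) < \<eta> / 2"
    "\<And>J. J2 \<subseteq> J \<Longrightarrow> (\<integral>z. norm (g (mixed UNIV z) - g (mixed J z)) \<partial>iid \<nu>) < \<eta> / 2"
    by blast
  note int = integrable_mixed[OF \<nu> add.hyps(1)] integrable_mixed[OF \<nu> add.hyps(2)]
  have "(\<integral>z. norm (f (mixed UNIV z) + g (mixed UNIV z) - (f (mixed J z) + g (mixed J z))) \<partial>iid \<nu>) < \<eta>"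
    if "J1 \<union> J2 \<subseteq> J" for J
  proof -
    have "(\<integral>z. norm (f (mixed UNIV z) + g (mixed UNIV z) - (f (mixed J z) + g (mixed J z))) \<partial>iid \<nu>) \<le>
       (\<integral>z. norm (f (mixed UNIV z) - f (mixed J z)) + norm (g (mixed UNIV z) - g (mixed J z)) \<partial>iid \<nu>)"
      by (intro integral_mono Bochner_Integration.integrable_add integrable_norm
          Bochner_Integration.integrable_diff int) (simp add: norm_diff_triangle_ineq)
    also have "\<dots> = (\<integral>z. norm (f (mixed UNIV z) - f (mixed J z)) \<partial>iid \<nu>) +
        (\<integral>z. norm (g (mixed UNIV z) - g (mixed J z)) \<partial>iid \<nu>)"
      by (intro Bochner_Integration.integral_add integrable_norm Bochner_Integration.integrable_diff int)
    finally show ?thesis using J(3,4)[of J] that by simp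
  qed
  with J(1,2) show ?case by (intro exI[of _ "J1 \<union> J2"]) auto
next
  case (lim f s)
  have "(\<lambda>i. \<integral>x. norm (f x - s i x) \<partial>iid \<nu>) \<longlonglongrightarrow> (\<integral>x. norm (0::'b) \<partial>(iid \<nu> :: ('i \<Rightarrow> 'e) measure))"
  proof (rule integral_dominated_convergence[where w = "\<lambda>x. 3 * norm (f x)"])
    show "AE x in iid \<nu>. (\<lambda>i. norm (f x - s i x)) \<longlonglongrightarrow> norm (0::'b)"
      using lim.hyps by (intro AE_I2 tendsto_norm) (auto intro!: tendsto_eq_intros)
    show "AE x in iid \<nu>. norm (norm (f x - s i x)) \<le> 3 * norm (f x)" for i
    proof (rule AE_I2)
      fix x :: "'i \<Rightarrow> 'e" assume "x \<in> space (iid \<nu>)"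
      then show "norm (norm (f x - s i x)) \<le> 3 * norm (f x)"
        using lim.hyps(3)[of x i] norm_triangle_ineq4[of "f x" "s i x"] by simp
    qed
  qed (use lim.hyps in \<open>auto intro!: borel_measurable_norm borel_measurable_diff\<close>)
  then obtain i where i: "(\<integral>x. norm (f x - s i x) \<partial>iid \<nu>) < \<eta> / 3"
    using order_tendstoD(2)[of _ "0::real" sequentially "\<eta> / 3"] \<open>0 < \<eta>\<close>
    by (auto simp: eventually_sequentially)
  from lim.IH[of "\<eta> / 3" i] \<open>0 < \<eta>\<close> obtain J0 where J0: "finite J0"
    "\<And>J. J0 \<subseteq> J \<Longrightarrow> (\<integral>z. norm (s i (mixed UNIV z) - s i (mixed J z)) \<partial>iid \<nu>) < \<eta> / 3"
    by auto
  note int = integrable_mixed[OF \<nu> \<open>integrable _ f\<close>] integrable_mixed[OF \<nu> lim.hyps(1)[of i]]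
  have tri: "norm (a - d) \<le> norm (a - b) + norm (b - c) + norm (d - c)" for a b c d :: 'b
  proof -
    have "a - d = (a - b) + (b - c) - (d - c)" by simp
    then have "norm (a - d) \<le> norm ((a - b) + (b - c)) + norm (d - c)" by (metis norm_triangle_ineq4)
    then show ?thesis using norm_triangle_ineq[of "a - b" "b - c"] by linarith
  qed
  have mx: "(\<integral>z. norm (f (mixed J z) - s i (mixed J z)) \<partial>iid \<nu>) = (\<integral>x. norm (f x - s i x) \<partial>iid \<nu>)" for J
    using lim.hyps by (intro integral_mixed[OF \<nu>] borel_measurable_norm borel_measurable_diff) auto
  have "(\<integral>z. norm (f (mixed UNIV z) - f (mixed J z)) \<partial>iid \<nu>) < \<eta>" if "J0 \<subseteq> J" for J
  proof -
    have "(\<integral>z. norm (f (mixed UNIV z) - f (mixed J z)) \<partial>iid \<nu>) \<le>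
       (\<integral>z. norm (f (mixed UNIV z) - s i (mixed UNIV z)) +
          norm (s i (mixed UNIV z) - s i (mixed J z)) + norm (f (mixed J z) - s i (mixed J z)) \<partial>iid \<nu>)"
      by (intro integral_mono Bochner_Integration.integrable_add integrable_norm
          Bochner_Integration.integrable_diff int)
        (rule tri)
    also have "\<dots> = (\<integral>z. norm (f (mixed UNIV z) - s i (mixed UNIV z)) \<partial>iid \<nu>) +
          (\<integral>z. norm (s i (mixed UNIV z) - s i (mixed J z)) \<partial>iid \<nu>) +
          (\<integral>z. norm (f (mixed J z) - s i (mixed J z)) \<partial>iid \<nu>)"
      by (simp add: int)
    finally show ?thesis using i J0(2)[OF that] by (simp add: mx)
  qed
  with J0(1) show ?case by blast
qed

section \<open>The covariance inequality\<close>

lemma iid_copies_independent: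
  fixes A B :: "('i \<Rightarrow> 'e) \<Rightarrow> 'b::{real_normed_field, banach, second_countable_topology}"
  assumes \<nu>: "prob_space \<nu>" and A: "integrable (iid \<nu>) A" and B: "integrable (iid \<nu>) B"
  shows "(\<integral>z. A (mixed {} z) * B (mixed UNIV z) \<partial>iid \<nu>) = (\<integral>x. A x \<partial>iid \<nu>) * (\<integral>x. B x \<partial>iid \<nu>)"
proof -
  interpret Q: prob_space "iid \<nu> :: ('i \<times> bool \<Rightarrow> 'e) measure" by (rule prob_space_iid[OF \<nu>])
  interpret \<nu>: prob_space \<nu> by fact
  let ?Q = "iid \<nu> :: ('i \<times> bool \<Rightarrow> 'e) measure"
  have "Q.indep_vars (\<lambda>_. \<nu>) (\<lambda>k z. z k) UNIV"
    by (subst Q.indep_vars_iff_distr_eq_PiM)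
       (auto simp: restrict_UNIV distr_PiM_component[OF \<nu>] distr_id2 intro!: measurable_component_singleton)
  then have ind: "Q.indep_var (Pi\<^sub>M (UNIV \<times> {False}) (\<lambda>_. \<nu>)) (\<lambda>z. restrict (\<lambda>k. z k) (UNIV \<times> {False}))
      (Pi\<^sub>M (UNIV \<times> {True}) (\<lambda>_. \<nu>)) (\<lambda>z. restrict (\<lambda>k. z k) (UNIV \<times> {True}))"
    by (rule Q.indep_var_restrict) auto
  have copy: "(\<lambda>z (i::'i). z (i, b)) \<in> Pi\<^sub>M (UNIV \<times> {b}) (\<lambda>_. \<nu>) \<rightarrow>\<^sub>M iid \<nu>" for b :: bool
    by (rule measurable_PiM_single') (auto simp: space_PiM PiE_iff intro!: measurable_component_singleton)
  have "Q.indep_var (iid \<nu>) ((\<lambda>z i. z (i, False)) \<circ> (\<lambda>z. restrict (\<lambda>k. z k) (UNIV \<times> {False})))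
      (iid \<nu>) ((\<lambda>z i. z (i, True)) \<circ> (\<lambda>z. restrict (\<lambda>k. z k) (UNIV \<times> {True})))"
    by (rule Q.indep_var_compose[OF ind copy copy])
  moreover have "(\<lambda>(z :: 'i \<times> bool \<Rightarrow> 'e) (i::'i). z (i, False)) \<circ> (\<lambda>z. restrict (\<lambda>k. z k) (UNIV \<times> {False})) = mixed {}"
    "(\<lambda>(z :: 'i \<times> bool \<Rightarrow> 'e) (i::'i). z (i, True)) \<circ> (\<lambda>z. restrict (\<lambda>k. z k) (UNIV \<times> {True})) = mixed UNIV"
    by (auto simp: mixed_def fun_eq_iff)
  ultimately have "Q.indep_var (iid \<nu>) (mixed {}) (iid \<nu>) (mixed UNIV)"
    by simp
  then have "Q.indep_var borel (A \<circ> mixed {}) borel (B \<circ> mixed UNIV)"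
    by (rule Q.indep_var_compose) (use A B in auto)
  note ind' = this
  have "(\<integral>z. (A \<circ> mixed {}) z * (B \<circ> mixed UNIV) z \<partial>?Q) =
      (\<integral>z. (A \<circ> mixed {}) z \<partial>?Q) * (\<integral>z. (B \<circ> mixed UNIV) z \<partial>?Q)"
    by (rule Q.indep_var_lebesgue_integral)
       (use ind' integrable_mixed[OF \<nu> A] integrable_mixed[OF \<nu> B] in \<open>simp_all add: comp_def\<close>)
  then show ?thesis
    using A B by (simp add: integral_mixed[OF \<nu>])
qed

text \<open>Whether the other coordinates already come from the second copy does not matter: together with the
two values at \<open>j\<close> they always form an independent family with the same law.\<close>

lemma influence_mixed:
  fixes A :: "('i \<Rightarrow> 'e) \<Rightarrow> 'b::{banach, second_countable_topology}"
  assumes \<nu>: "prob_space \<nu>" and [measurable]: "A \<in> borel_measurable (iid \<nu>)" and "j \<notin> J"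
  shows "norm_L2 (iid \<nu>) (\<lambda>z. norm (A (mixed J z) - A (mixed (insert j J) z))) = influence \<nu> A j"
proof -
  define f :: "'i option \<Rightarrow> 'i \<times> bool" where
    "f = case_option (j, True) (\<lambda>i. (i, i \<in> J))"
  have "inj f" using \<open>j \<notin> J\<close> by (auto simp: inj_def f_def split: option.splits)
  have some: "(\<lambda>w i. w (Some i)) \<in> iid \<nu> \<rightarrow>\<^sub>M iid \<nu>" by (rule measurable_reindex)
  have meas: "(\<lambda>w. \<bar>norm (A (\<lambda>i. w (Some i)) - A (resample j w))\<bar>\<^sup>2) \<in> borel_measurable (iid \<nu>)"
    using measurable_compose[OF some assms(2)] measurable_compose[OF measurable_resample assms(2)]
    by (intro borel_measurable_power borel_measurable_abs borel_measurable_norm borel_measurable_diff) auto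
  have "(\<lambda>i. z (f (Some i))) = mixed J z" "resample j (\<lambda>i. z (f i)) = mixed (insert j J) z" for z :: "'i \<times> bool \<Rightarrow> 'e"
    by (auto simp: f_def mixed_def resample_def fun_eq_iff)
  with integral_iid_reindex[OF \<nu> \<open>inj f\<close> meas] show ?thesis
    by (simp add: influence_def norm_L2_def)
qed

text \<open>Let \<open>h J\<close> be the mean of \<open>A\<close> at the first copy times \<open>B\<close> at the mixed copy that takes the coordinates
in \<open>J\<close> from the second one. It interpolates between the mean of \<open>A B\<close>, for empty \<open>J\<close>, and the product of
the means, for full \<open>J\<close>. Adding one coordinate \<open>j\<close> to \<open>J\<close> changes \<open>h\<close> by the mean of \<open>A\<close> times
an increment of \<open>B\<close> that changes sign when the two copies of coordinate \<open>j\<close> are swapped. Averaging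
over the swap turns \<open>A\<close> into half its own increment, and the Cauchy-Schwarz inequality bounds the
step by half the product of the influences.\<close>

theorem covariance_influence_bound:
  fixes A B :: "('i \<Rightarrow> 'e) \<Rightarrow> 'b::{real_normed_field, banach, second_countable_topology}"
  assumes \<nu>: "prob_space \<nu>"
    and A[measurable]: "A \<in> borel_measurable (iid \<nu>)" and B[measurable]: "B \<in> borel_measurable (iid \<nu>)"
    and bA: "\<And>x. norm (A x) \<le> KA" and bB: "\<And>x. norm (B x) \<le> KB"
    and K: "\<And>J. finite J \<Longrightarrow> (\<Sum>j\<in>J. influence \<nu> A j * influence \<nu> B j) \<le> K"
  shows "norm ((\<integral>x. A x * B x \<partial>iid \<nu>) - (\<integral>x. A x \<partial>iid \<nu>) * (\<integral>x. B x \<partial>iid \<nu>)) \<le> K / 2"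
proof -
  interpret Q: prob_space "iid \<nu> :: ('i \<times> bool \<Rightarrow> 'e) measure" by (rule prob_space_iid[OF \<nu>])
  interpret P: prob_space "iid \<nu> :: ('i \<Rightarrow> 'e) measure" by (rule prob_space_iid[OF \<nu>])
  let ?Q = "iid \<nu> :: ('i \<times> bool \<Rightarrow> 'e) measure"
  define h where "h J = (\<integral>z. A (mixed {} z) * B (mixed J z) \<partial>?Q)" for J
  have "0 \<le> KA" "0 \<le> KB" using bA bB norm_ge_zero order_trans by blast+
  have intA: "integrable (iid \<nu>) A" and intB: "integrable (iid \<nu>) B"
    by (rule P.integrable_if_bounded, measurable, rule bA bB)+
  have int[simp]: "integrable ?Q (\<lambda>z. A (mixed I z) * B (mixed J z))" for I J
    by (rule Q.integrable_if_bounded[where B = "KA * KB"], measurable)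
       (simp add: norm_mult mult_mono bA bB \<open>0 \<le> KA\<close>)
  have step: "norm (h J - h (insert j J)) \<le> influence \<nu> A j * influence \<nu> B j / 2" if "j \<notin> J" for j J
  proof -
    \<comment> \<open>exchanges the two copies of coordinate \<open>j\<close> and fixes all others\<close>
    define \<sigma> :: "'i \<times> bool \<Rightarrow> 'i \<times> bool" where "\<sigma> = (\<lambda>(i, b). (i, if i = j then \<not> b else b))"
    have "inj \<sigma>" by (auto simp: inj_def \<sigma>_def split: if_splits)
    have swap: "mixed {} (\<lambda>k. z (\<sigma> k)) = mixed {j} z" "mixed J (\<lambda>k. z (\<sigma> k)) = mixed (insert j J) z"
      "mixed (insert j J) (\<lambda>k. z (\<sigma> k)) = mixed J z" for z :: "'i \<times> bool \<Rightarrow> 'e"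
      using that by (auto simp: mixed_def \<sigma>_def fun_eq_iff)
    have "h J - h (insert j J) = (\<integral>z. A (mixed {} z) * (B (mixed J z) - B (mixed (insert j J) z)) \<partial>?Q)"
      by (simp add: h_def right_diff_distrib)
    moreover from this have "h J - h (insert j J) =
        (\<integral>z. A (mixed {j} z) * (B (mixed (insert j J) z) - B (mixed J z)) \<partial>?Q)"
      using integral_iid_reindex[OF \<nu> \<open>inj \<sigma>\<close>,
          of "\<lambda>z. A (mixed {} z) * (B (mixed J z) - B (mixed (insert j J) z))"]
      by (simp add: swap)
    ultimately have "2 * (h J - h (insert j J)) =
        (\<integral>z. A (mixed {} z) * (B (mixed J z) - B (mixed (insert j J) z)) \<partial>?Q) +
        (\<integral>z. A (mixed {j} z) * (B (mixed (insert j J) z) - B (mixed J z)) \<partial>?Q)"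
      by simp
    also have "\<dots> =
        (\<integral>z. (A (mixed {} z) - A (mixed {j} z)) * (B (mixed J z) - B (mixed (insert j J) z)) \<partial>?Q)"
      by (subst Bochner_Integration.integral_add[symmetric])
         (simp_all only: right_diff_distrib left_diff_distrib Bochner_Integration.integrable_diff int, simp add: algebra_simps)
    finally have "2 * norm (h J - h (insert j J)) =
        norm (\<integral>z. (A (mixed {} z) - A (mixed {j} z)) * (B (mixed J z) - B (mixed (insert j J) z)) \<partial>?Q)"
      by (metis norm_mult norm_numeral)
    also have "\<dots> \<le> (\<integral>z. norm (A (mixed {} z) - A (mixed {j} z)) *
        norm (B (mixed J z) - B (mixed (insert j J) z)) \<partial>?Q)"
      unfolding norm_mult[symmetric] by (rule integral_norm_bound)
    also have "\<dots> \<le> influence \<nu> A j * influence \<nu> B j"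
    proof -
      have sq: "integrable ?Q (\<lambda>z. (norm (f (mixed I z) - f (mixed I' z)))\<^sup>2)"
        if [measurable]: "f \<in> borel_measurable (iid \<nu>)" and b: "\<And>x. norm (f x) \<le> b"
        for f :: "('i \<Rightarrow> 'e) \<Rightarrow> 'b" and b I I'
      proof (rule Q.integrable_if_bounded[where B = "(b + b)\<^sup>2"])
        fix z
        have "norm (f (mixed I z) - f (mixed I' z)) \<le> b + b"
          by (rule order_trans[OF norm_triangle_ineq4 add_mono[OF b b]])
        then show "norm ((norm (f (mixed I z) - f (mixed I' z)))\<^sup>2) \<le> (b + b)\<^sup>2"
          using power_mono[OF _ norm_ge_zero] by (metis norm_ge_zero real_norm_def abs_of_nonneg zero_le_power2)
      qed measurable
      show ?thesis
        using norm_L2_Cauchy_Schwarz(2)[OF _ _ sq[OF A bA, of "{}" "{j}"] sq[OF B bB, of J "insert j J"]]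
        by (simp add: influence_mixed[OF \<nu>] that)
    qed
    finally show ?thesis by simp
  qed
  have sum: "norm (h {} - h J) \<le> (\<Sum>j\<in>J. influence \<nu> A j * influence \<nu> B j) / 2" if "finite J" for J
    using that
  proof (induction J)
    case (insert j J)
    then show ?case
      using step[of j J] norm_triangle_ineq[of "h {} - h J" "h J - h (insert j J)"] by simp
  qed simp
  have h_empty: "h {} = (\<integral>x. A x * B x \<partial>iid \<nu>)"
    unfolding h_def by (rule integral_mixed[OF \<nu>]) measurable
  have h_UNIV: "h UNIV = (\<integral>x. A x \<partial>iid \<nu>) * (\<integral>x. B x \<partial>iid \<nu>)"
    unfolding h_def by (rule iid_copies_independent[OF \<nu> intA intB])
  show ?thesis
  proof (rule field_le_epsilon)
    fix \<eta> :: real assume "0 < \<eta>"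
    then have "0 < \<eta> / (KA + 1)" using \<open>0 \<le> KA\<close> by simp
    from depends_on_finitely_many[OF \<nu> intB this] obtain J where J: "finite J"
      "(\<integral>z. norm (B (mixed UNIV z) - B (mixed J z)) \<partial>?Q) < \<eta> / (KA + 1)"
      by blast
    have "norm (h UNIV - h J) = norm (\<integral>z. A (mixed {} z) * (B (mixed UNIV z) - B (mixed J z)) \<partial>?Q)"
      by (simp add: h_def right_diff_distrib)
    also have "\<dots> \<le> (\<integral>z. norm (A (mixed {} z) * (B (mixed UNIV z) - B (mixed J z))) \<partial>?Q)"
      by (rule integral_norm_bound)
    also have "\<dots> \<le> (\<integral>z. KA * norm (B (mixed UNIV z) - B (mixed J z)) \<partial>?Q)"
    proof (rule integral_mono)
      show "integrable ?Q (\<lambda>z. norm (A (mixed {} z) * (B (mixed UNIV z) - B (mixed J z))))"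
        by (rule integrable_norm) (simp add: right_diff_distrib)
      show "integrable ?Q (\<lambda>z. KA * norm (B (mixed UNIV z) - B (mixed J z)))"
        by (intro integrable_mult_right integrable_norm Bochner_Integration.integrable_diff
            integrable_mixed[OF \<nu> intB])
    qed (simp add: norm_mult mult_right_mono bA)
    also have "\<dots> \<le> KA * (\<eta> / (KA + 1))"
      using mult_left_mono[OF less_imp_le[OF J(2)] \<open>0 \<le> KA\<close>] by simp
    also have "\<dots> \<le> \<eta>"
      using \<open>0 \<le> KA\<close> \<open>0 < \<eta>\<close> by (simp add: divide_le_eq mult.commute)
    finally have "norm (h UNIV - h J) \<le> \<eta>" .
    moreover have "norm (h {} - h J) \<le> K / 2"
      using sum[OF J(1)] K[OF J(1)] by simp
    ultimately have "norm (h {} - h UNIV) \<le> K / 2 + \<eta>"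
      using norm_triangle_ineq4[of "h {} - h J" "h UNIV - h J"] by simp
    then show "norm ((\<integral>x. A x * B x \<partial>iid \<nu>) - (\<integral>x. A x \<partial>iid \<nu>) * (\<integral>x. B x \<partial>iid \<nu>)) \<le> K / 2 + \<eta>"
      by (simp add: h_empty h_UNIV)
  qed
qed

section \<open>Causal functionals of independent innovations\<close>

definition past :: "int \<Rightarrow> (int \<Rightarrow> 'e) \<Rightarrow> nat \<Rightarrow> 'e" where
  "past t x = (\<lambda>j. x (t - int j))"

lemma measurable_past [measurable]: "past t \<in> iid \<nu> \<rightarrow>\<^sub>M iid \<nu>"
  unfolding past_def by (rule measurable_reindex)

lemma influence_Lipschitz:
  fixes S :: "('i \<Rightarrow> 'e) \<Rightarrow> real" and f :: "real \<Rightarrow> 'b::{banach, second_countable_topology}"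
  assumes \<nu>: "prob_space \<nu>" and S[measurable]: "S \<in> borel_measurable (iid \<nu>)"
    and f[measurable]: "f \<in> borel_measurable borel"
    and bS: "\<And>x. \<bar>S x\<bar> \<le> b"
    and lip: "\<And>x y. norm (f x - f y) \<le> L * \<bar>x - y\<bar>"
  shows "influence \<nu> (\<lambda>x. f (S x)) j \<le> L * influence \<nu> S j"
proof -
  interpret P: prob_space "iid \<nu> :: ('i option \<Rightarrow> 'e) measure" by (rule prob_space_iid[OF \<nu>])
  have "0 \<le> L" using order_trans[OF norm_ge_zero lip[of 1 0]] by simp
  note [measurable] = measurable_compose[OF measurable_reindex S] measurable_compose[OF measurable_resample S]
  let ?D = "\<lambda>w. S (\<lambda>i. w (Some i)) - S (resample j w)"
  have "integrable (iid \<nu>) (\<lambda>w. (L * \<bar>?D w\<bar>)\<^sup>2)"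
  proof (rule P.integrable_if_bounded[where B = "(L * (b + b))\<^sup>2"])
    fix w
    have "\<bar>?D w\<bar> \<le> b + b" using bS[of "\<lambda>i. w (Some i)"] bS[of "resample j w"] by linarith
    then have "(L * \<bar>?D w\<bar>)\<^sup>2 \<le> (L * (b + b))\<^sup>2"
      using \<open>0 \<le> L\<close> by (intro power_mono mult_left_mono) auto
    then show "norm ((L * \<bar>?D w\<bar>)\<^sup>2) \<le> (L * (b + b))\<^sup>2" by simp
  qed measurable
  then have "influence \<nu> (\<lambda>x. f (S x)) j \<le> norm_L2 (iid \<nu>) (\<lambda>w. L * \<bar>?D w\<bar>)"
    unfolding influence_def
    by (rule P.norm_L2_mono[rotated 2]) (use \<open>0 \<le> L\<close> lip in \<open>auto simp: abs_mult\<close>)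
  also have "\<dots> = L * influence \<nu> S j"
    using \<open>0 \<le> L\<close> by (simp add: norm_L2_cmult influence_def)
  finally show ?thesis .
qed

lemma influence_sum_le:
  fixes X :: "'k \<Rightarrow> ('i \<Rightarrow> 'e) \<Rightarrow> real"
  assumes \<nu>: "prob_space \<nu>" and "finite I" and X: "\<And>t. X t \<in> borel_measurable (iid \<nu>)"
    and b: "\<And>t x. \<bar>X t x\<bar> \<le> b"
  shows "influence \<nu> (\<lambda>x. \<Sum>t\<in>I. X t x) j \<le> (\<Sum>t\<in>I. influence \<nu> (X t) j)"
proof -
  interpret P: prob_space "iid \<nu> :: ('i option \<Rightarrow> 'e) measure" by (rule prob_space_iid[OF \<nu>])
  note [measurable] = measurable_compose[OF measurable_reindex X] measurable_compose[OF measurable_resample X]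
  have "influence \<nu> (\<lambda>x. \<Sum>t\<in>I. X t x) j =
      norm_L2 (iid \<nu>) (\<lambda>w. \<Sum>t\<in>I. X t (\<lambda>i. w (Some i)) - X t (resample j w))"
    by (simp add: influence_def sum_subtractf)
  also have "\<dots> \<le> (\<Sum>t\<in>I. norm_L2 (iid \<nu>) (\<lambda>w. X t (\<lambda>i. w (Some i)) - X t (resample j w)))"
  proof (rule P.norm_L2_sum_le[where B = "b + b"])
    show "\<bar>X t (\<lambda>i. w (Some i)) - X t (resample j w)\<bar> \<le> b + b" for t w
      using b[of t "\<lambda>i. w (Some i)"] b[of t "resample j w"] by linarith
  qed (use \<open>finite I\<close> in auto)
  finally show ?thesis by (simp add: influence_def)
qed

lemma norm_iexp_diff_le: "norm (iexp x - iexp y) \<le> \<bar>x - y\<bar>"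
proof -
  have "iexp x - iexp y = iexp y * (iexp (x - y) - 1)"
    by (simp add: algebra_simps exp_diff)
  moreover have "cmod (iexp (x - y) - 1) \<le> \<bar>x - y\<bar>"
    using iexp_approx1[of "x - y" 0] by simp
  ultimately show ?thesis by (simp add: norm_mult)
qed

lemma Cesaro_mean_tendsto:
  fixes s :: "nat \<Rightarrow> real"
  assumes "s \<longlonglongrightarrow> L"
  shows "(\<lambda>n. (\<Sum>i<n. s i) / real n) \<longlonglongrightarrow> L"
proof (rule LIMSEQ_I)
  fix r :: real assume "0 < r"
  then obtain N where N: "\<And>n. n \<ge> N \<Longrightarrow> \<bar>s n - L\<bar> < r / 2"
    using LIMSEQ_D[OF assms, of "r / 2"] by auto
  define C where "C = (\<Sum>i<N. \<bar>s i - L\<bar>)"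
  obtain M where M: "2 * C / r < real M" using reals_Archimedean2 by blast
  have "\<bar>(\<Sum>i<n. s i) / real n - L\<bar> < r" if n: "n \<ge> Suc (max N M)" for n
  proof -
    have "n > 0" "N \<le> n" "real M < real n" using n by auto
    have "(\<Sum>i<n. s i) / real n - L = (\<Sum>i<n. s i - L) / real n"
      using \<open>n > 0\<close> by (simp add: sum_subtractf field_simps)
    also have "\<bar>\<dots>\<bar> \<le> (\<Sum>i<n. \<bar>s i - L\<bar>) / real n"
      by (simp add: divide_right_mono)
    also have "(\<Sum>i<n. \<bar>s i - L\<bar>) = C + (\<Sum>i=N..<n. \<bar>s i - L\<bar>)"
      using \<open>N \<le> n\<close> by (simp add: C_def sum.atLeastLessThan_concat lessThan_atLeast0)
    also have "(\<Sum>i=N..<n. \<bar>s i - L\<bar>) \<le> (\<Sum>i=N..<n. r / 2)"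
      by (rule sum_mono, rule less_imp_le, rule N) simp
    also have "\<dots> \<le> real n * (r / 2)" using \<open>0 < r\<close> by (simp add: mult_right_mono)
    finally have "\<bar>(\<Sum>i<n. s i) / real n - L\<bar> \<le> (C + real n * (r / 2)) / real n"
      using \<open>n > 0\<close> by (simp add: divide_right_mono)
    also have "C < real n * (r / 2)"
    proof -
      have "2 * C / r < real n" using M \<open>real M < real n\<close> by linarith
      then show ?thesis using \<open>0 < r\<close> by (simp add: divide_less_eq)
    qed
    then have "(C + real n * (r / 2)) / real n < r"
      using \<open>n > 0\<close> by (simp add: divide_less_eq mult.commute)
    finally show ?thesis .
  qed
  then show "\<exists>no. \<forall>n\<ge>no. norm ((\<Sum>i<n. s i) / real n - L) < r" by auto
qed

text \<open>The sequence \<open>d\<close> bounds the influence of the innovation \<open>k\<close> steps back. It is a parameter of its own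
because two kinds of bounds occur: the dependence coefficients for the indicator of one threshold, and
a bound that is small for close thresholds when \<open>g\<close> is an increment between two of them.\<close>

locale causal_functional =
  fixes \<nu> :: "'e measure" and g :: "(nat \<Rightarrow> 'e) \<Rightarrow> real" and d :: "nat \<Rightarrow> real"
  assumes \<nu>: "prob_space \<nu>"
    and g[measurable]: "g \<in> borel_measurable (iid \<nu>)"
    and g_bounded: "\<bar>g y\<bar> \<le> 1"
    and influence_le: "influence \<nu> (\<lambda>x. g (past (int k) x)) 0 \<le> d k"
    and summable_d: "summable d"
begin

sublocale P: prob_space "iid \<nu> :: (int \<Rightarrow> 'e) measure"
  by (rule prob_space_iid[OF \<nu>])

definition \<xi> :: "int \<Rightarrow> (int \<Rightarrow> 'e) \<Rightarrow> real" where
  "\<xi> t x = g (past t x)"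

definition S :: "int \<Rightarrow> nat \<Rightarrow> (int \<Rightarrow> 'e) \<Rightarrow> real" where
  "S a n x = (\<Sum>t\<in>{a + 1..a + int n}. \<xi> t x)"

text \<open>Extends \<open>d\<close> by zero to negative lags, since an innovation has no influence on earlier times; sums over
all innovations then need no case distinction.\<close>

definition D :: "int \<Rightarrow> real" where
  "D k = (if k < 0 then 0 else d (nat k))"

definition tail :: "nat \<Rightarrow> real" where
  "tail r = (\<Sum>k. d (k + r))"

abbreviation "\<Theta> \<equiv> tail 0"

lemma \<xi>_measurable [measurable]: "\<xi> t \<in> borel_measurable (iid \<nu>)"
  unfolding \<xi>_def[abs_def] by (rule measurable_compose[OF measurable_past g])

lemma S_measurable [measurable]: "S a n \<in> borel_measurable (iid \<nu>)"
  unfolding S_def[abs_def] by (rule borel_measurable_sum) (rule \<xi>_measurable)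

lemma \<xi>_bounded: "\<bar>\<xi> t x\<bar> \<le> 1"
  by (simp add: \<xi>_def g_bounded)

lemma S_bounded: "\<bar>S a n x\<bar> \<le> real n"
  unfolding S_def using sum_bounded_above[of "{a + 1..a + int n}" "\<lambda>t. \<bar>\<xi> t x\<bar>" 1] \<xi>_bounded
  by (intro order_trans[OF sum_abs]) simp

lemma d_nonneg: "0 \<le> d k"
  by (rule order_trans[OF influence_nonneg influence_le])

lemma D_nonneg: "0 \<le> D k"
  by (simp add: D_def d_nonneg)

lemma summable_tail: "summable (\<lambda>k. d (k + r))"
  by (rule summable_ignore_initial_segment[OF summable_d])

lemma tail_nonneg: "0 \<le> tail r"
  unfolding tail_def by (intro suminf_nonneg summable_tail d_nonneg)

lemma tail_tendsto_0: "tail \<longlonglongrightarrow> 0"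
  unfolding tail_def by (rule suminf_exist_split2[OF summable_d])

lemma sum_D_le_tail:
  assumes "finite K" "\<And>i. i \<in> K \<Longrightarrow> i < 0 \<or> int r \<le> i"
  shows "(\<Sum>i\<in>K. D i) \<le> tail r"
proof -
  have "(\<Sum>i\<in>K. D i) = (\<Sum>i\<in>{i \<in> K. int r \<le> i}. d (nat (i - int r) + r))"
  proof (rule sum.mono_neutral_cong_right)
    show "\<forall>i\<in>K - {i \<in> K. int r \<le> i}. D i = 0"
      using assms(2) by (auto simp: D_def)
    show "D i = d (nat (i - int r) + r)" if "i \<in> {i \<in> K. int r \<le> i}" for i
    proof -
      have "nat i = nat (i - int r) + r" "\<not> i < 0" using that by auto
      then show ?thesis by (simp add: D_def)
    qed
  qed (use assms in auto)
  also have "\<dots> = (\<Sum>k\<in>(\<lambda>i. nat (i - int r)) ` {i \<in> K. int r \<le> i}. d (k + r))"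
    by (subst sum.reindex) (auto simp: inj_on_def)
  also have "\<dots> \<le> tail r"
    unfolding tail_def by (rule sum_le_suminf[OF summable_tail]) (auto simp: assms d_nonneg)
  finally show ?thesis .
qed

lemma sum_D_le: "finite K \<Longrightarrow> inj_on f K \<Longrightarrow> (\<Sum>i\<in>K. D (f i)) \<le> \<Theta>"
  using sum_D_le_tail[of "f ` K" 0] by (simp add: sum.reindex not_le[symmetric] linear)

lemma past_shift: "past (t + a) x = past t (\<lambda>i. x (i + a))"
  by (simp add: past_def algebra_simps)

text \<open>A shift of the index set by \<open>j\<close> is a reindexing, so only the lag \<open>t - j\<close> matters.\<close>

lemma influence_\<xi>_le: "influence \<nu> (\<xi> t) j \<le> D (t - j)"
proof (cases "t < j")
  case True
  then have "\<xi> t (\<lambda>i. w (Some i)) = \<xi> t (resample j w)" for w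
    by (auto simp: \<xi>_def past_def resample_def intro!: arg_cong[where f = g])
  then show ?thesis using True by (simp add: influence_def norm_L2_def D_def)
next
  case False
  define f :: "int option \<Rightarrow> int option" where "f = map_option (\<lambda>i. i + j)"
  have "inj f" unfolding f_def by (rule option.inj_map) (simp add: inj_def)
  have eq: "\<xi> t (\<lambda>i. w (Some i)) = \<xi> (t - j) (\<lambda>i. w (f (Some i)))"
    "\<xi> t (resample j w) = \<xi> (t - j) (resample 0 (\<lambda>i. w (f i)))" for w
    by (auto simp: \<xi>_def past_def resample_def f_def algebra_simps intro!: arg_cong[where f = g])
  have meas: "(\<lambda>w. \<bar>norm (\<xi> (t - j) (\<lambda>i. w (Some i)) - \<xi> (t - j) (resample 0 w))\<bar>\<^sup>2) \<in> borel_measurable (iid \<nu>)"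
  proof -
    note [measurable] = measurable_compose[OF measurable_reindex \<xi>_measurable]
      measurable_compose[OF measurable_resample \<xi>_measurable]
    show ?thesis by measurable
  qed
  have "influence \<nu> (\<xi> t) j = influence \<nu> (\<xi> (t - j)) 0"
    using integral_iid_reindex[OF \<nu> \<open>inj f\<close> meas] by (simp add: influence_def norm_L2_def eq)
  also have "\<dots> \<le> D (t - j)"
    using influence_le[of "nat (t - j)"] False by (simp add: D_def \<xi>_def[abs_def])
  finally show ?thesis .
qed

lemma influence_S_le: "influence \<nu> (S a n) j \<le> (\<Sum>t\<in>{a + 1..a + int n}. D (t - j))"
proof -
  have "influence \<nu> (S a n) j \<le> (\<Sum>t\<in>{a + 1..a + int n}. influence \<nu> (\<xi> t) j)"
    unfolding S_def[abs_def] by (rule influence_sum_le[OF \<nu>]) (auto intro: \<xi>_bounded)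
  also have "\<dots> \<le> (\<Sum>t\<in>{a + 1..a + int n}. D (t - j))"
    by (intro sum_mono influence_\<xi>_le)
  finally show ?thesis .
qed

text \<open>One innovation has total influence at most \<open>\<Theta>\<close> on a sum of any length. With the next lemma, which
sums over the innovations instead, this makes variances grow at most linearly.\<close>

lemma influence_S_le_total: "influence \<nu> (S a n) j \<le> \<Theta>"
  using influence_S_le[of a n j] sum_D_le[of "{a + 1..a + int n}" "\<lambda>t. t - j"] by (simp add: inj_on_def)

lemma sum_influence_S_le: "finite J \<Longrightarrow> (\<Sum>j\<in>J. influence \<nu> (S a n) j) \<le> real n * \<Theta>"
proof -
  assume "finite J"
  have "(\<Sum>j\<in>J. influence \<nu> (S a n) j) \<le> (\<Sum>j\<in>J. \<Sum>t\<in>{a + 1..a + int n}. D (t - j))"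
    by (intro sum_mono influence_S_le)
  also have "\<dots> = (\<Sum>t\<in>{a + 1..a + int n}. \<Sum>j\<in>J. D (t - j))"
    by (rule sum.swap)
  also have "\<dots> \<le> (\<Sum>t\<in>{a + 1..a + int n}. \<Theta>)"
    using \<open>finite J\<close> by (intro sum_mono sum_D_le) (auto simp: inj_on_def)
  finally show ?thesis by simp
qed

lemma integrable_S [simp]: "integrable (iid \<nu>) (S a n)"
  by (rule P.integrable_if_bounded[where B = "real n"]) (auto simp: S_bounded)

lemma integrable_\<xi> [simp]: "integrable (iid \<nu>) (\<xi> t)"
  by (rule P.integrable_if_bounded[where B = 1]) (auto simp: \<xi>_bounded)

lemma variance_S_le:
  "\<bar>(\<integral>x. (S a n x)\<^sup>2 \<partial>iid \<nu>) - (\<integral>x. S a n x \<partial>iid \<nu>)\<^sup>2\<bar> \<le> real n * \<Theta>\<^sup>2 / 2"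
proof -
  have "norm ((\<integral>x. S a n x * S a n x \<partial>iid \<nu>) - (\<integral>x. S a n x \<partial>iid \<nu>) * (\<integral>x. S a n x \<partial>iid \<nu>)) \<le>
      (real n * \<Theta>\<^sup>2) / 2"
  proof (rule covariance_influence_bound[OF \<nu>, where KA = "real n" and KB = "real n"])
    fix J :: "int set" assume "finite J"
    have "(\<Sum>j\<in>J. influence \<nu> (S a n) j * influence \<nu> (S a n) j) \<le> (\<Sum>j\<in>J. \<Theta> * influence \<nu> (S a n) j)"
      by (intro sum_mono mult_right_mono influence_S_le_total) simp
    also have "\<dots> \<le> \<Theta> * (real n * \<Theta>)"
      unfolding sum_distrib_left[symmetric]
      using sum_influence_S_le[OF \<open>finite J\<close>] by (intro mult_left_mono tail_nonneg)
    finally show "(\<Sum>j\<in>J. influence \<nu> (S a n) j * influence \<nu> (S a n) j) \<le> real n * \<Theta>\<^sup>2"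
      by (simp add: power2_eq_square mult_ac)
  qed (auto simp: S_bounded)
  then show ?thesis by (simp add: power2_eq_square)
qed

lemma integral_shift:
  fixes f :: "(int \<Rightarrow> 'e) \<Rightarrow> 'b::{banach, second_countable_topology}"
  assumes "f \<in> borel_measurable (iid \<nu>)"
  shows "(\<integral>x. f (\<lambda>i. x (i + a)) \<partial>iid \<nu>) = (\<integral>x. f x \<partial>iid \<nu>)"
  by (rule integral_iid_reindex[OF \<nu> _ assms]) (simp add: inj_def)

lemma S_shift: "S a n x = S 0 n (\<lambda>i. x (i + a))"
proof -
  have "S a n x = (\<Sum>t\<in>(\<lambda>t. t + a) ` {0 + 1..0 + int n}. \<xi> t x)"
    unfolding S_def by (intro sum.cong) (auto simp: image_add_atLeastAtMost')
  also have "\<dots> = S 0 n (\<lambda>i. x (i + a))"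
    unfolding S_def by (subst sum.reindex) (auto simp: \<xi>_def past_shift)
  finally show ?thesis .
qed

lemma S_append: "S 0 (m + n) x = S 0 m x + S (int m) n x"
proof -
  have "{0 + 1..0 + int (m + n)} = {0 + 1..0 + int m} \<union> {int m + 1..int m + int n}" by auto
  then show ?thesis unfolding S_def by (subst sum.union_disjoint[symmetric]) (auto intro: sum.cong)
qed

lemma S_1: "S a 1 x = \<xi> (a + 1) x"
  by (simp add: S_def)

definition \<phi> :: "nat \<Rightarrow> real \<Rightarrow> complex" where
  "\<phi> n u = (\<integral>x. iexp (u * S 0 n x) \<partial>iid \<nu>)"

lemma char_S_shift: "(\<integral>x. iexp (u * S a n x) \<partial>iid \<nu>) = \<phi> n u"
  unfolding \<phi>_def S_shift[of a] by (rule integral_shift) measurable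

text \<open>The exponentials inherit their influences from the two sums. Only innovations up to time \<open>a\<close> act on
both; each acts on the first sum by at most \<open>\<Theta>\<close>, and all of them together act on the term at
time \<open>a + i\<close> of the second sum by at most \<open>tail i\<close>. The bound is therefore \<open>o(b)\<close>, whatever the
length \<open>a\<close> of the first block.\<close>

lemma char_adjacent_blocks:
  "norm ((\<integral>x. iexp (u * S 0 a x) * iexp (u' * S (int a) b x) \<partial>iid \<nu>) - \<phi> a u * \<phi> b u')
     \<le> \<bar>u\<bar> * \<bar>u'\<bar> * \<Theta> * (\<Sum>i<b. tail (Suc i)) / 2"
proof -
  let ?A = "\<lambda>x. iexp (u * S 0 a x)" and ?B = "\<lambda>x. iexp (u' * S (int a) b x)"
  have lip: "norm (iexp (v * y) - iexp (v * z)) \<le> \<bar>v\<bar> * \<bar>y - z\<bar>" for v y z :: real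
    using norm_iexp_diff_le[of "v * y" "v * z"] by (simp add: right_diff_distrib[symmetric] abs_mult)
  have inf: "influence \<nu> (\<lambda>x. iexp (v * S c n x)) j \<le> \<bar>v\<bar> * influence \<nu> (S c n) j" for v c n j
    by (rule influence_Lipschitz[OF \<nu>, where f = "\<lambda>s. iexp (v * s)"]) (use S_bounded lip in auto)
  have "norm ((\<integral>x. ?A x * ?B x \<partial>iid \<nu>) - (\<integral>x. ?A x \<partial>iid \<nu>) * (\<integral>x. ?B x \<partial>iid \<nu>)) \<le>
    (\<bar>u\<bar> * \<bar>u'\<bar> * \<Theta> * (\<Sum>i<b. tail (Suc i))) / 2"
  proof (rule covariance_influence_bound[OF \<nu>, where KA = 1 and KB = 1])
    fix J :: "int set" assume "finite J"
    let ?J = "{j \<in> J. j \<le> int a}"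
    \<comment> \<open>innovations after time \<open>a\<close> do not act on the first block\<close>
    have zero: "influence \<nu> (S 0 a) j = 0" if "j > int a" for j
    proof -
      have "(\<Sum>t\<in>{0 + 1..0 + int a}. D (t - j)) = 0"
        using that by (intro sum.neutral) (auto simp: D_def)
      then show ?thesis using influence_S_le[of 0 a j] influence_nonneg[of \<nu> "S 0 a" j] by simp
    qed
    have "(\<Sum>j\<in>J. influence \<nu> ?A j * influence \<nu> ?B j) \<le>
        (\<Sum>j\<in>J. (\<bar>u\<bar> * influence \<nu> (S 0 a) j) * (\<bar>u'\<bar> * influence \<nu> (S (int a) b) j))"
      by (intro sum_mono mult_mono inf) auto
    also have "\<dots> = (\<Sum>j\<in>?J. (\<bar>u\<bar> * influence \<nu> (S 0 a) j) * (\<bar>u'\<bar> * influence \<nu> (S (int a) b) j))"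
      using \<open>finite J\<close> by (intro sum.mono_neutral_right) (auto, metis zero not_le)
    also have "\<dots> \<le> (\<Sum>j\<in>?J. (\<bar>u\<bar> * \<Theta>) * (\<bar>u'\<bar> * (\<Sum>t\<in>{int a + 1..int a + int b}. D (t - j))))"
      by (intro sum_mono mult_mono mult_left_mono influence_S_le_total influence_S_le)
         (auto intro!: mult_nonneg_nonneg tail_nonneg)
    also have "\<dots> = \<bar>u\<bar> * \<bar>u'\<bar> * \<Theta> * (\<Sum>j\<in>?J. \<Sum>t\<in>{int a + 1..int a + int b}. D (t - j))"
      by (simp add: sum_distrib_left mult_ac)
    also have "(\<Sum>j\<in>?J. \<Sum>t\<in>{int a + 1..int a + int b}. D (t - j)) =
        (\<Sum>t\<in>{int a + 1..int a + int b}. \<Sum>j\<in>?J. D (t - j))"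
      by (rule sum.swap)
    also have "\<dots> \<le> (\<Sum>t\<in>{int a + 1..int a + int b}. tail (nat (t - int a)))"
    proof (rule sum_mono)
      fix t assume "t \<in> {int a + 1..int a + int b}"
      then have "(\<Sum>i\<in>(\<lambda>j. t - j) ` ?J. D i) \<le> tail (nat (t - int a))"
        using \<open>finite J\<close> by (intro sum_D_le_tail) auto
      then show "(\<Sum>j\<in>?J. D (t - j)) \<le> tail (nat (t - int a))"
        by (simp add: sum.reindex inj_on_def)
    qed
    also have "\<dots> = (\<Sum>i<b. tail (Suc i))"
      by (rule sum.reindex_bij_witness[of _ "\<lambda>i. int a + int (Suc i)" "\<lambda>t. nat (t - int a) - 1"]) auto
    finally show "(\<Sum>j\<in>J. influence \<nu> ?A j * influence \<nu> ?B j) \<le> \<bar>u\<bar> * \<bar>u'\<bar> * \<Theta> * (\<Sum>i<b. tail (Suc i))"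
      by (simp add: mult_left_mono tail_nonneg)
  qed (auto simp: norm_exp_i_times)
  then show ?thesis by (simp only: char_S_shift)
qed

end

section \<open>Long-run variance and normal limit of partial sums\<close>

lemma exp_minus_quadratic_bound:
  fixes y :: real
  assumes "0 \<le> y"
  shows "\<bar>exp (- y) - (1 - y)\<bar> \<le> y\<^sup>2 / 2"
proof -
  have "(1 - y + y\<^sup>2 / 2) * (1 + y + y\<^sup>2 / 2) = 1 + y ^ 4 / 4"
    by (simp add: field_simps power2_eq_square power4_eq_xxxx)
  then have "1 \<le> (1 - y + y\<^sup>2 / 2) * (1 + y + y\<^sup>2 / 2)" by simp
  also have "\<dots> \<le> (1 - y + y\<^sup>2 / 2) * exp y"
  proof (rule mult_left_mono[OF exp_lower_Taylor_quadratic[OF assms]])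
    have "1 - y + y\<^sup>2 / 2 = ((1 - y)\<^sup>2 + 1) / 2" by (simp add: power2_eq_square field_simps)
    also have "\<dots> \<ge> 0" by simp
    finally show "0 \<le> 1 - y + y\<^sup>2 / 2" .
  qed
  finally have "exp (- y) \<le> 1 - y + y\<^sup>2 / 2"
    by (simp add: exp_minus field_simps)
  moreover have "1 - y \<le> exp (- y)" using exp_ge_add_one_self[of "- y"] by simp
  ultimately show ?thesis by (simp add: abs_le_iff)
qed

context causal_functional
begin

definition autocov :: "nat \<Rightarrow> real" where
  "autocov h = (\<integral>x. \<xi> 0 x * \<xi> (int h) x \<partial>iid \<nu>) - (\<integral>x. \<xi> 0 x \<partial>iid \<nu>) * (\<integral>x. \<xi> (int h) x \<partial>iid \<nu>)"

lemma d_le_\<Theta>: "d k \<le> \<Theta>"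
  using sum_D_le[of "{int k}" id] by (simp add: D_def)

lemma summable_d_prod: "summable (\<lambda>k. d k * d (k + h))"
  by (rule summable_comparison_test'[OF summable_mult2[OF summable_d, of \<Theta>], of 0])
     (simp add: mult_left_mono d_le_\<Theta> d_nonneg abs_mult)

lemma autocov_le: "\<bar>autocov h\<bar> \<le> (\<Sum>k. d k * d (k + h)) / 2"
  unfolding autocov_def real_norm_def[symmetric]
proof (rule covariance_influence_bound[OF \<nu>, where KA = 1 and KB = 1])
  fix J :: "int set" assume "finite J"
  have "(\<Sum>j\<in>J. influence \<nu> (\<xi> 0) j * influence \<nu> (\<xi> (int h)) j) \<le> (\<Sum>j\<in>J. D (0 - j) * D (int h - j))"
    by (intro sum_mono mult_mono influence_\<xi>_le D_nonneg influence_nonneg)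
  also have "\<dots> = (\<Sum>j\<in>{j \<in> J. j \<le> 0}. d (nat (- j)) * d (nat (- j) + h))"
  proof (rule sum.mono_neutral_cong_right)
    show "D (0 - j) * D (int h - j) = d (nat (- j)) * d (nat (- j) + h)" if "j \<in> {j \<in> J. j \<le> 0}" for j
    proof -
      have "nat (int h - j) = nat (- j) + h" using that by auto
      then show ?thesis using that by (simp add: D_def)
    qed
  qed (use \<open>finite J\<close> in \<open>auto simp: D_def\<close>)
  also have "\<dots> = (\<Sum>k\<in>(\<lambda>j. nat (- j)) ` {j \<in> J. j \<le> 0}. d k * d (k + h))"
    by (subst sum.reindex) (auto simp: inj_on_def)
  also have "\<dots> \<le> (\<Sum>k. d k * d (k + h))"
    using \<open>finite J\<close> by (intro sum_le_suminf summable_d_prod) (auto simp: d_nonneg)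
  finally show "(\<Sum>j\<in>J. influence \<nu> (\<xi> 0) j * influence \<nu> (\<xi> (int h)) j) \<le> (\<Sum>k. d k * d (k + h))" .
qed (auto simp: \<xi>_bounded)

text \<open>Summing the previous bound over \<open>h\<close> first gives at most \<open>d k * \<Theta> / 2\<close> for each \<open>k\<close>, hence at
most \<open>\<Theta>\<^sup>2 / 2\<close> in total.\<close>

lemma summable_autocov: "summable (\<lambda>h. \<bar>autocov h\<bar>)"
proof (rule bounded_imp_summable[where B = "\<Theta>\<^sup>2 / 2"])
  fix n
  have "(\<Sum>h\<le>n. \<bar>autocov h\<bar>) \<le> (\<Sum>h\<le>n. (\<Sum>k. d k * d (k + h)) / 2)"
    by (intro sum_mono autocov_le)
  also have "\<dots> = (\<Sum>k. \<Sum>h\<le>n. d k * d (k + h)) / 2"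
    by (simp add: suminf_sum[OF summable_d_prod] sum_divide_distrib)
  also have "(\<Sum>k. \<Sum>h\<le>n. d k * d (k + h)) \<le> (\<Sum>k. d k * \<Theta>)"
  proof (rule suminf_le)
    fix k
    have "(\<Sum>h\<le>n. d (k + h)) = (\<Sum>h\<le>n. D (int (k + h)))" by (simp add: D_def nat_add_distrib)
    also have "\<dots> \<le> \<Theta>" by (rule sum_D_le) (auto simp: inj_on_def)
    finally show "(\<Sum>h\<le>n. d k * d (k + h)) \<le> d k * \<Theta>"
      by (simp add: sum_distrib_left[symmetric] mult_left_mono d_nonneg)
  qed (auto intro!: summable_sum summable_d_prod summable_mult2 summable_d)
  also have "(\<Sum>k. d k * \<Theta>) = \<Theta>\<^sup>2"
    by (simp add: suminf_mult2[OF summable_d, symmetric] power2_eq_square) (simp add: tail_def)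
  finally show "(\<Sum>h\<le>n. \<bar>autocov h\<bar>) \<le> \<Theta>\<^sup>2 / 2" by simp
qed auto

definition long_run_variance :: real where
  "long_run_variance = autocov 0 + 2 * (\<Sum>i. autocov (Suc i))"

lemma integrable_\<xi>_prod [simp]: "integrable (iid \<nu>) (\<lambda>x. \<xi> s x * \<xi> t x)"
  by (rule P.integrable_if_bounded[where B = 1]) (auto simp: abs_mult intro!: mult_le_one \<xi>_bounded)

lemma integrable_S_power [simp]: "integrable (iid \<nu>) (\<lambda>x. (S a n x) ^ k)"
proof (rule P.integrable_if_bounded[where B = "real n ^ k"])
  show "norm (S a n x ^ k) \<le> real n ^ k" for x
    using power_mono[OF S_bounded[of a n x]] by (simp add: power_abs)
qed measurable

lemma norm_\<phi>_le_1: "norm (\<phi> n u) \<le> 1"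
proof -
  have "norm (\<phi> n u) \<le> (\<integral>x. norm (iexp (u * S 0 n x)) \<partial>iid \<nu>)"
    unfolding \<phi>_def by (rule integral_norm_bound)
  then show ?thesis by (simp add: P.prob_space)
qed

text \<open>Blocks of length \<open>p\<close> are split off from the right one by one, down to the remainder of
length \<open>\<rho>\<close>; the cost of each step is independent of the length of what is left.\<close>

lemma char_blocks:
  "norm (\<phi> (\<rho> + J * p) u - \<phi> \<rho> u * \<phi> p u ^ J) \<le> real J * (u\<^sup>2 * \<Theta> * (\<Sum>i<p. tail (Suc i)) / 2)"
proof (induction J)
  case (Suc J)
  let ?a = "\<rho> + J * p"
  have "\<phi> (\<rho> + Suc J * p) u = (\<integral>x. iexp (u * S 0 ?a x) * iexp (u * S (int ?a) p x) \<partial>iid \<nu>)"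
  proof -
    have "\<rho> + Suc J * p = ?a + p" by simp
    then show ?thesis unfolding \<phi>_def by (simp only: S_append) (simp add: distrib_left exp_add)
  qed
  then have *: "norm (\<phi> (\<rho> + Suc J * p) u - \<phi> ?a u * \<phi> p u) \<le> u\<^sup>2 * \<Theta> * (\<Sum>i<p. tail (Suc i)) / 2"
    using char_adjacent_blocks[of u ?a u p] by (simp add: power2_eq_square)
  have "norm (\<phi> ?a u * \<phi> p u - \<phi> \<rho> u * \<phi> p u ^ Suc J) = norm (\<phi> ?a u - \<phi> \<rho> u * \<phi> p u ^ J) * norm (\<phi> p u)"
    by (simp add: norm_mult[symmetric] algebra_simps)
  also have "\<dots> \<le> norm (\<phi> ?a u - \<phi> \<rho> u * \<phi> p u ^ J) * 1"
    by (intro mult_left_mono norm_\<phi>_le_1) simp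
  finally show ?case
    using * Suc.IH norm_diff_triangle_ineq[of "\<phi> (\<rho> + Suc J * p) u" "\<phi> ?a u * \<phi> p u" "\<phi> ?a u * \<phi> p u" "\<phi> \<rho> u * \<phi> p u ^ Suc J"]
      norm_triangle_ineq[of "\<phi> (\<rho> + Suc J * p) u - \<phi> ?a u * \<phi> p u" "\<phi> ?a u * \<phi> p u - \<phi> \<rho> u * \<phi> p u ^ Suc J"]
    by (simp add: distrib_right)
qed (simp add: \<phi>_def)

lemma \<phi>_near_1: "norm (\<phi> n u - 1) \<le> \<bar>u\<bar> * real n"
proof -
  have int: "integrable (iid \<nu>) (\<lambda>x. iexp (u * S 0 n x))"
    by (rule P.integrable_if_bounded[where B = 1]) auto
  have "\<phi> n u - 1 = (\<integral>x. iexp (u * S 0 n x) - 1 \<partial>iid \<nu>)"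
    unfolding \<phi>_def using int by (simp add: P.prob_space)
  also have "norm \<dots> \<le> (\<integral>x. norm (iexp (u * S 0 n x) - 1) \<partial>iid \<nu>)"
    by (rule integral_norm_bound)
  also have "\<dots> \<le> (\<integral>x. \<bar>u\<bar> * real n \<partial>(iid \<nu> :: (int \<Rightarrow> 'e) measure))"
  proof (rule integral_mono)
    show "norm (iexp (u * S 0 n x) - 1) \<le> \<bar>u\<bar> * real n" for x
      using norm_iexp_diff_le[of "u * S 0 n x" 0] mult_left_mono[OF S_bounded[of 0 n x] abs_ge_zero[of u]]
      by (simp add: abs_mult)
  qed (use int in auto)
  finally show ?thesis by (simp add: P.prob_space)
qed

end

locale centered_causal_functional = causal_functional +
  assumes centered: "(\<integral>x. g (past 0 x) \<partial>iid \<nu>) = 0"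
begin

lemma integral_\<xi> [simp]: "(\<integral>x. \<xi> t x \<partial>iid \<nu>) = 0"
  using integral_shift[OF \<xi>_measurable[of 0], of t] centered
  by (simp add: \<xi>_def past_shift[of 0 t, simplified])

lemma integral_S [simp]: "(\<integral>x. S a n x \<partial>iid \<nu>) = 0"
  unfolding S_def by simp

lemma integral_\<xi>_prod: "(\<integral>x. \<xi> t x * \<xi> (t + int h) x \<partial>iid \<nu>) = autocov h"
proof -
  have [measurable]: "(\<lambda>x. \<xi> 0 x * \<xi> (int h) x) \<in> borel_measurable (iid \<nu>)" by measurable
  have "(\<integral>x. \<xi> t x * \<xi> (t + int h) x \<partial>iid \<nu>) = (\<integral>x. \<xi> 0 (\<lambda>i. x (i + t)) * \<xi> (int h) (\<lambda>i. x (i + t)) \<partial>iid \<nu>)"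
    by (simp add: \<xi>_def past_shift[of 0 t, simplified] past_shift[of "int h" t, symmetric] add.commute)
  also have "\<dots> = autocov h"
    using integral_shift[of "\<lambda>x. \<xi> 0 x * \<xi> (int h) x" t] by (simp add: autocov_def)
  finally show ?thesis .
qed

definition var_S :: "nat \<Rightarrow> real" where
  "var_S n = (\<integral>x. (S 0 n x)\<^sup>2 \<partial>iid \<nu>)"

text \<open>The increments of the variance are partial sums of the long-run variance, so the variance per unit
length is a Cesaro mean of a convergent sequence.\<close>

lemma var_S_Suc: "var_S (Suc n) = var_S n + (autocov 0 + 2 * (\<Sum>i<n. autocov (Suc i)))"
proof -
  let ?t = "int n + 1"
  have int: "integrable (iid \<nu>) (\<lambda>x. S 0 n x * \<xi> ?t x)"
    unfolding S_def sum_distrib_right by (intro Bochner_Integration.integrable_sum integrable_\<xi>_prod)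
  have "S 0 (Suc n) x = S 0 n x + \<xi> ?t x" for x
    using S_append[of n 1 x] S_1[of "int n" x] by simp
  then have "var_S (Suc n) = (\<integral>x. (S 0 n x)\<^sup>2 + 2 * (S 0 n x * \<xi> ?t x) + \<xi> ?t x * \<xi> ?t x \<partial>iid \<nu>)"
    by (simp add: var_S_def power2_eq_square algebra_simps)
  also have "\<dots> = var_S n + 2 * (\<integral>x. S 0 n x * \<xi> ?t x \<partial>iid \<nu>) + autocov 0"
    using int integral_\<xi>_prod[of ?t 0] by (simp add: var_S_def)
  also have "(\<integral>x. S 0 n x * \<xi> ?t x \<partial>iid \<nu>) = (\<Sum>t\<in>{0 + 1..0 + int n}. \<integral>x. \<xi> t x * \<xi> ?t x \<partial>iid \<nu>)"
    unfolding S_def sum_distrib_right by (intro Bochner_Integration.integral_sum integrable_\<xi>_prod)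
  also have "\<dots> = (\<Sum>i<n. autocov (Suc i))"
  proof (rule sum.reindex_bij_witness[of _ "\<lambda>i. int n - int i" "\<lambda>t. nat (int n - t)"])
    fix t assume t: "t \<in> {0 + 1..0 + int n}"
    then have "?t = t + int (Suc (nat (int n - t)))" by simp
    then show "autocov (Suc (nat (int n - t))) = (\<integral>x. \<xi> t x * \<xi> ?t x \<partial>iid \<nu>)"
      using integral_\<xi>_prod[of t "Suc (nat (int n - t))"] by metis
  qed auto
  finally show ?thesis by simp
qed

lemma var_S_mean_tendsto: "(\<lambda>n. var_S n / real n) \<longlonglongrightarrow> long_run_variance"
proof -
  have "var_S 0 = 0" by (simp add: var_S_def S_def)
  then have "var_S n = (\<Sum>k<n. autocov 0 + 2 * (\<Sum>i<k. autocov (Suc i)))" for n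
    by (induction n) (simp_all add: var_S_Suc)
  moreover have "summable (\<lambda>i. autocov (Suc i))"
    using summable_rabs_cancel[OF summable_autocov] by (subst summable_Suc_iff)
  then have "(\<lambda>k. autocov 0 + 2 * (\<Sum>i<k. autocov (Suc i))) \<longlonglongrightarrow> long_run_variance"
    unfolding long_run_variance_def by (intro tendsto_intros summable_LIMSEQ)
  ultimately show ?thesis
    using Cesaro_mean_tendsto by simp
qed

lemma long_run_variance_nonneg: "0 \<le> long_run_variance"
  by (rule LIMSEQ_le_const[OF var_S_mean_tendsto]) (auto simp: var_S_def)

lemma \<phi>_Taylor: "norm (\<phi> p u - of_real (1 - u\<^sup>2 * var_S p / 2)) \<le> \<bar>u\<bar> ^ 3 * real p ^ 3"
proof -
  have ch: "char (distr (iid \<nu>) borel (S 0 p)) u = \<phi> p u"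
    unfolding char_def \<phi>_def by (subst integral_distr) auto
  have "norm (char (distr (iid \<nu>) borel (S 0 p)) u - (1 - u\<^sup>2 * var_S p / 2)) \<le>
      (u\<^sup>2 / 6) * (\<integral>x. min (6 * (S 0 p x)\<^sup>2) (\<bar>u\<bar> * \<bar>S 0 p x\<bar> ^ 3) \<partial>iid \<nu>)"
    by (rule P.char_approx3') (auto simp: var_S_def)
  also have "\<dots> \<le> (u\<^sup>2 / 6) * P.expectation (\<lambda>_. \<bar>u\<bar> * real p ^ 3)"
  proof (intro mult_left_mono integral_mono)
    have le: "\<bar>u\<bar> * \<bar>S 0 p x\<bar> ^ 3 \<le> \<bar>u\<bar> * real p ^ 3" for x
      by (intro mult_left_mono power_mono S_bounded) auto
    then show "min (6 * (S 0 p x)\<^sup>2) (\<bar>u\<bar> * \<bar>S 0 p x\<bar> ^ 3) \<le> \<bar>u\<bar> * real p ^ 3" for x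
      by (rule min.coboundedI2)
    show "integrable (iid \<nu>) (\<lambda>x. min (6 * (S 0 p x)\<^sup>2) (\<bar>u\<bar> * \<bar>S 0 p x\<bar> ^ 3))"
      by (rule P.integrable_if_bounded[where B = "\<bar>u\<bar> * real p ^ 3"])
         (auto intro!: min.coboundedI2 le)
  qed auto
  also have "\<dots> = \<bar>u\<bar> ^ 3 * real p ^ 3 / 6"
    by (simp add: P.prob_space power2_eq_square power3_eq_cube abs_mult[symmetric] mult_ac)
  also have "\<dots> \<le> \<bar>u\<bar> ^ 3 * real p ^ 3" by simp
  finally show ?thesis by (simp add: ch)
qed

text \<open>Uniformity over all \<open>u\<close> with \<open>\<bar>u\<bar> sqrt n \<le> T\<close> is needed because the factor in front of a sample sum
depends on both sample sizes. The block length \<open>p\<close> is chosen first, so that the cost of cutting into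
blocks and the error in the block variance are small; with \<open>p\<close> fixed, the Taylor remainders and the
effect of the incomplete block vanish as \<open>n\<close> grows.\<close>

theorem char_S_normal_limit:
  assumes "0 < \<epsilon>" "0 < T"
  shows "\<exists>N. \<forall>n\<ge>N. \<forall>u. \<bar>u\<bar> * sqrt (real n) \<le> T \<longrightarrow>
    norm (\<phi> n u - of_real (exp (- (u\<^sup>2 * real n * long_run_variance / 2)))) < \<epsilon>"
proof -
  let ?s = long_run_variance
  define c where "c p = (\<Sum>i<p. tail (Suc i)) / real p" for p
  have "c \<longlonglongrightarrow> 0"
    unfolding c_def by (rule Cesaro_mean_tendsto) (rule LIMSEQ_Suc[OF tail_tendsto_0])
  then have "(\<lambda>p. T\<^sup>2 * \<Theta> * c p / 2 + T\<^sup>2 * \<bar>var_S p / real p - ?s\<bar> / 2) \<longlonglongrightarrow> T\<^sup>2 * \<Theta> * 0 / 2 + T\<^sup>2 * \<bar>?s - ?s\<bar> / 2"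
    by (intro tendsto_intros var_S_mean_tendsto) auto
  then have "eventually (\<lambda>p. T\<^sup>2 * \<Theta> * c p / 2 + T\<^sup>2 * \<bar>var_S p / real p - ?s\<bar> / 2 < \<epsilon> / 2) sequentially"
    using \<open>0 < \<epsilon>\<close> by (intro order_tendstoD(2)) auto
  then obtain p where p: "p > 0" "T\<^sup>2 * \<Theta> * c p / 2 + T\<^sup>2 * \<bar>var_S p / real p - ?s\<bar> / 2 < \<epsilon> / 2"
    unfolding eventually_sequentially by (metis le_eq_less_or_eq not_less_eq_eq zero_less_Suc nle_le)
  \<comment> \<open>collects the errors that vanish with \<open>u\<close> for fixed \<open>p\<close>; the argument stands for \<open>\<bar>u\<bar>\<close>\<close>
  define h where "h \<delta> = \<delta> * real p + T\<^sup>2 * real p ^ 2 * \<delta> + \<delta>\<^sup>2 * (T\<^sup>2 * real p * ?s\<^sup>2 + real p * ?s)" for \<delta>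
  have "filterlim (\<lambda>n. sqrt (real n)) at_top sequentially"
    by (rule filterlim_compose[OF sqrt_at_top filterlim_real_sequentially])
  then have "(\<lambda>n. T / sqrt (real n)) \<longlonglongrightarrow> 0"
    by (intro tendsto_divide_0[OF tendsto_const] filterlim_at_top_imp_at_infinity)
  then have "(\<lambda>n. h (T / sqrt (real n))) \<longlonglongrightarrow> 0 * real p + T\<^sup>2 * real p ^ 2 * 0 + 0\<^sup>2 * (T\<^sup>2 * real p * ?s\<^sup>2 + real p * ?s)"
    unfolding h_def by (intro tendsto_intros)
  then have "eventually (\<lambda>n. h (T / sqrt (real n)) < \<epsilon> / 2) sequentially"
    using \<open>0 < \<epsilon>\<close> by (intro order_tendstoD(2)) auto
  then obtain N where N: "\<And>n. n \<ge> N \<Longrightarrow> h (T / sqrt (real n)) < \<epsilon> / 2"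
    unfolding eventually_sequentially by blast
  have "norm (\<phi> n u - of_real (exp (- (u\<^sup>2 * real n * ?s / 2)))) < \<epsilon>"
    if n: "n \<ge> Suc N" and u: "\<bar>u\<bar> * sqrt (real n) \<le> T" for n u
  proof -
    define J \<rho> where "J = n div p" and "\<rho> = n mod p"
    have n_eq: "n = \<rho> + J * p" by (simp add: J_def \<rho>_def)
    have "\<rho> < p" using p(1) by (simp add: \<rho>_def)
    have "real n > 0" using n by simp
    have Jp: "real J * real p \<le> real n"
      using n_eq by (metis le_add2 of_nat_le_iff of_nat_mult)
    have u2n: "u\<^sup>2 * real n \<le> T\<^sup>2"
      using power_mono[OF u, of 2] by (simp add: power_mult_distrib)
    have u2Jp: "u\<^sup>2 * (real J * real p) \<le> T\<^sup>2"
      using mult_left_mono[OF Jp, of "u\<^sup>2"] u2n by simp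
    define w where "w = exp (- (u\<^sup>2 * real p * ?s / 2))"
    define w\<^sub>\<rho> where "w\<^sub>\<rho> = exp (- (u\<^sup>2 * real \<rho> * ?s / 2))"
    have s0: "0 \<le> ?s" by (rule long_run_variance_nonneg)
    have w: "0 \<le> w" "w \<le> 1" "0 \<le> w\<^sub>\<rho>" "w\<^sub>\<rho> \<le> 1"
      using s0 by (auto simp: w_def w\<^sub>\<rho>_def)
    have e_eq: "exp (- (u\<^sup>2 * real n * ?s / 2)) = w\<^sub>\<rho> * w ^ J"
      unfolding w_def w\<^sub>\<rho>_def n_eq exp_of_nat_mult[symmetric] exp_add[symmetric]
      by (simp add: field_simps)
    have 1: "norm (\<phi> n u - \<phi> \<rho> u * \<phi> p u ^ J) \<le> T\<^sup>2 * \<Theta> * c p / 2"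
    proof -
      have "norm (\<phi> n u - \<phi> \<rho> u * \<phi> p u ^ J) \<le> real J * (u\<^sup>2 * \<Theta> * (\<Sum>i<p. tail (Suc i)) / 2)"
        unfolding n_eq by (rule char_blocks)
      also have "\<dots> = (u\<^sup>2 * (real J * real p)) * (\<Theta> * c p / 2)"
        using p(1) by (simp add: c_def)
      also have "\<dots> \<le> T\<^sup>2 * (\<Theta> * c p / 2)"
        by (intro mult_right_mono u2Jp) (auto simp: c_def intro!: mult_nonneg_nonneg tail_nonneg sum_nonneg divide_nonneg_nonneg)
      finally show ?thesis by simp
    qed
    have 2: "norm (\<phi> \<rho> u * \<phi> p u ^ J - \<phi> p u ^ J) \<le> \<bar>u\<bar> * real p"
    proof -
      have "norm (\<phi> \<rho> u * \<phi> p u ^ J - \<phi> p u ^ J) = norm (\<phi> \<rho> u - 1) * norm (\<phi> p u) ^ J"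
        by (simp add: norm_mult[symmetric] norm_power[symmetric] algebra_simps)
      also have "\<dots> \<le> (\<bar>u\<bar> * real \<rho>) * 1"
        by (intro mult_mono \<phi>_near_1 power_le_one norm_\<phi>_le_1) auto
      also have "\<dots> \<le> \<bar>u\<bar> * real p" using \<open>\<rho> < p\<close> by (simp add: mult_left_mono)
      finally show ?thesis .
    qed
    have 3: "norm (\<phi> p u ^ J - of_real w ^ J) \<le>
        T\<^sup>2 * real p ^ 2 * \<bar>u\<bar> + T\<^sup>2 * \<bar>var_S p / real p - ?s\<bar> / 2 + \<bar>u\<bar>\<^sup>2 * (T\<^sup>2 * real p * ?s\<^sup>2)"
    proof -
      have "norm (\<phi> p u - of_real w) \<le>
          norm (\<phi> p u - of_real (1 - u\<^sup>2 * var_S p / 2)) + norm (of_real (1 - u\<^sup>2 * var_S p / 2) - of_real w :: complex)"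
        by (rule norm_diff_triangle_le[OF order_refl order_refl])
      also have "norm (of_real (1 - u\<^sup>2 * var_S p / 2) - of_real w :: complex) = \<bar>(1 - u\<^sup>2 * var_S p / 2) - w\<bar>"
        by (simp only: of_real_diff[symmetric] norm_of_real)
      also have "\<bar>(1 - u\<^sup>2 * var_S p / 2) - w\<bar> \<le> u\<^sup>2 * \<bar>var_S p - real p * ?s\<bar> / 2 + (u\<^sup>2 * real p * ?s / 2)\<^sup>2 / 2"
      proof -
        have "\<bar>w - (1 - u\<^sup>2 * real p * ?s / 2)\<bar> \<le> (u\<^sup>2 * real p * ?s / 2)\<^sup>2 / 2"
          unfolding w_def by (rule exp_minus_quadratic_bound) (simp add: s0)
        moreover have "u\<^sup>2 * \<bar>var_S p - real p * ?s\<bar> / 2 = \<bar>u\<^sup>2 / 2 * (var_S p - real p * ?s)\<bar>"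
          by (simp add: abs_mult)
        moreover have "u\<^sup>2 / 2 * (var_S p - real p * ?s) = u\<^sup>2 * var_S p / 2 - u\<^sup>2 * real p * ?s / 2"
          by (simp add: field_simps)
        ultimately show ?thesis by linarith
      qed
      finally have near: "norm (\<phi> p u - of_real w) \<le> norm (\<phi> p u - of_real (1 - u\<^sup>2 * var_S p / 2)) +
          (u\<^sup>2 * \<bar>var_S p - real p * ?s\<bar> / 2 + (u\<^sup>2 * real p * ?s / 2)\<^sup>2 / 2)"
        by simp
      have "norm (\<phi> p u ^ J - of_real w ^ J) \<le> real J * norm (\<phi> p u - of_real w)"
        using w by (intro norm_power_diff norm_\<phi>_le_1) simp
      also have "\<dots> \<le> real J * (\<bar>u\<bar> ^ 3 * real p ^ 3 +
          (u\<^sup>2 * \<bar>var_S p - real p * ?s\<bar> / 2 + (u\<^sup>2 * real p * ?s / 2)\<^sup>2 / 2))"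
        by (intro mult_left_mono order_trans[OF near] add_right_mono \<phi>_Taylor) auto
      also have "\<dots> = (u\<^sup>2 * (real J * real p)) * (\<bar>u\<bar> * real p ^ 2 + \<bar>var_S p / real p - ?s\<bar> / 2 + \<bar>u\<bar>\<^sup>2 * (real p * ?s\<^sup>2) / 8)"
      proof -
        have "\<bar>var_S p - real p * ?s\<bar> = real p * \<bar>var_S p / real p - ?s\<bar>"
        proof -
          have "var_S p - real p * ?s = real p * (var_S p / real p - ?s)"
            using p(1) by (simp add: right_diff_distrib)
          then show ?thesis by (simp only: abs_mult abs_of_nat)
        qed
        moreover have "k * (a ^ 3 * q ^ 3 + (a\<^sup>2 * (q * x) / 2 + (a\<^sup>2 * q * s / 2)\<^sup>2 / 2)) =
            (a\<^sup>2 * (k * q)) * (a * q\<^sup>2 + x / 2 + a\<^sup>2 * (q * s\<^sup>2) / 8)" for k a q x s :: real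
          by (simp add: field_simps power2_eq_square power3_eq_cube)
        from this[of "real J" "\<bar>u\<bar>"] have "real J * (\<bar>u\<bar> ^ 3 * real p ^ 3 +
            (u\<^sup>2 * (real p * x) / 2 + (u\<^sup>2 * real p * s / 2)\<^sup>2 / 2)) =
            (u\<^sup>2 * (real J * real p)) * (\<bar>u\<bar> * (real p)\<^sup>2 + x / 2 + \<bar>u\<bar>\<^sup>2 * (real p * s\<^sup>2) / 8)" for x s
          by (simp only: power2_abs)
        ultimately show ?thesis by (simp only:)
      qed
      also have "\<dots> \<le> T\<^sup>2 * (\<bar>u\<bar> * real p ^ 2 + \<bar>var_S p / real p - ?s\<bar> / 2 + \<bar>u\<bar>\<^sup>2 * (real p * ?s\<^sup>2) / 8)"
        by (intro mult_right_mono u2Jp) auto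
      also have "\<dots> \<le> T\<^sup>2 * (\<bar>u\<bar> * real p ^ 2 + \<bar>var_S p / real p - ?s\<bar> / 2 + \<bar>u\<bar>\<^sup>2 * (real p * ?s\<^sup>2))"
        by (intro mult_left_mono add_left_mono) auto
      finally show ?thesis by (simp add: algebra_simps)
    qed
    have 4: "norm (of_real w ^ J - of_real (w\<^sub>\<rho> * w ^ J) :: complex) \<le> \<bar>u\<bar>\<^sup>2 * (real p * ?s)"
    proof -
      have "norm (of_real w ^ J - of_real (w\<^sub>\<rho> * w ^ J) :: complex) = \<bar>w ^ J - w\<^sub>\<rho> * w ^ J\<bar>"
        by (simp only: of_real_power[symmetric] of_real_diff[symmetric] norm_of_real)
      also have "\<dots> = (1 - w\<^sub>\<rho>) * w ^ J"
      proof -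
        have "w ^ J - w\<^sub>\<rho> * w ^ J = (1 - w\<^sub>\<rho>) * w ^ J" by (simp add: algebra_simps)
        then show ?thesis using w by simp
      qed
      also have "\<dots> \<le> (1 - w\<^sub>\<rho>) * 1" using w by (intro mult_left_mono power_le_one) auto
      also have "\<dots> \<le> u\<^sup>2 * real \<rho> * ?s / 2"
        using exp_ge_add_one_self[of "- (u\<^sup>2 * real \<rho> * ?s / 2)"] by (simp add: w\<^sub>\<rho>_def)
      also have "\<dots> \<le> u\<^sup>2 * real \<rho> * ?s" using s0 by simp
      also have "\<dots> \<le> u\<^sup>2 * real p * ?s"
        using \<open>\<rho> < p\<close> s0 by (intro mult_right_mono mult_left_mono) auto
      finally show ?thesis by (simp add: mult.assoc)
    qed
    have "\<bar>u\<bar> \<le> T / sqrt (real n)" using u \<open>real n > 0\<close> by (simp add: field_simps)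
    then have hu: "h \<bar>u\<bar> \<le> h (T / sqrt (real n))"
      unfolding h_def using s0
      by (intro add_mono mult_right_mono mult_left_mono power_mono) auto
    have "norm (\<phi> n u - of_real (w\<^sub>\<rho> * w ^ J)) \<le> T\<^sup>2 * \<Theta> * c p / 2 + T\<^sup>2 * \<bar>var_S p / real p - ?s\<bar> / 2 + h \<bar>u\<bar>"
    proof -
      have tri: "norm (a - e) \<le> norm (a - b) + norm (b - c) + norm (c - d) + norm (d - e)" for a b c d e :: complex
        using norm_triangle_ineq[of "a - b" "b - e"] norm_triangle_ineq[of "b - c" "c - e"]
          norm_triangle_ineq[of "c - d" "d - e"] by simp
      show ?thesis
        using tri[of "\<phi> n u" "of_real (w\<^sub>\<rho> * w ^ J)" "\<phi> \<rho> u * \<phi> p u ^ J" "\<phi> p u ^ J" "of_real w ^ J"] 1 2 3 4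
        unfolding h_def distrib_left by linarith
    qed
    also have "\<dots> < \<epsilon>" using p(2) N[of n] hu n by simp
    finally show ?thesis unfolding e_eq .
  qed
  then show ?thesis by blast
qed

end

context centered_causal_functional
begin

text \<open>The coefficients \<open>u\<close>, \<open>u'\<close> of the two sums satisfy \<open>u\<^sup>2 n + u'\<^sup>2 m = t\<^sup>2\<close>, so the
product of the two Gaussian factors does not depend on the ratio of the sample sizes. They
also satisfy \<open>\<bar>u\<bar> \<bar>u'\<bar> = t\<^sup>2 / (n + m)\<close>, which makes the dependence between the adjacent
samples a Cesaro mean of tail sums.\<close>

theorem char_two_samples_normal_limit:
  assumes "0 < \<epsilon>"
  shows "\<exists>N. \<forall>n\<ge>N. \<forall>m\<ge>N.
    norm ((\<integral>x. iexp (t * (sqrt (real n * real m / (real n + real m)) *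
        (S (int n) m x / real m - S 0 n x / real n))) \<partial>iid \<nu>)
      - of_real (exp (- (t\<^sup>2 * long_run_variance / 2)))) < \<epsilon>"
proof -
  let ?s = long_run_variance
  define c where "c p = (\<Sum>i<p. tail (Suc i)) / real p" for p
  have "c \<longlonglongrightarrow> 0"
    unfolding c_def by (rule Cesaro_mean_tendsto) (rule LIMSEQ_Suc[OF tail_tendsto_0])
  then have "(\<lambda>m. t\<^sup>2 * \<Theta> * c m / 2) \<longlonglongrightarrow> t\<^sup>2 * \<Theta> * 0 / 2"
    by (intro tendsto_intros) auto
  then have "eventually (\<lambda>m. t\<^sup>2 * \<Theta> * c m / 2 < \<epsilon> / 3) sequentially"
    by (rule order_tendstoD(2)) (use \<open>0 < \<epsilon>\<close> in simp)
  then obtain N1 where N1: "\<And>m. m \<ge> N1 \<Longrightarrow> t\<^sup>2 * \<Theta> * c m / 2 < \<epsilon> / 3"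
    unfolding eventually_sequentially by blast
  have "0 < \<epsilon> / 3" "0 < \<bar>t\<bar> + 1" using \<open>0 < \<epsilon>\<close> by auto
  from char_S_normal_limit[OF this] obtain N2 where
    N2: "\<And>n u. n \<ge> N2 \<Longrightarrow> \<bar>u\<bar> * sqrt (real n) \<le> \<bar>t\<bar> + 1 \<Longrightarrow>
      norm (\<phi> n u - of_real (exp (- (u\<^sup>2 * real n * ?s / 2)))) < \<epsilon> / 3"
    by blast
  have "norm ((\<integral>x. iexp (t * (sqrt (real n * real m / (real n + real m)) *
        (S (int n) m x / real m - S 0 n x / real n))) \<partial>iid \<nu>)
      - of_real (exp (- (t\<^sup>2 * ?s / 2)))) < \<epsilon>"
    if n: "n \<ge> max (Suc N1) N2" and m: "m \<ge> max (Suc N1) N2" for n m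
  proof -
    have pos: "real n > 0" "real m > 0" using n m by auto
    define r where "r = sqrt (real n * real m / (real n + real m))"
    have r2: "r\<^sup>2 = real n * real m / (real n + real m)" and "0 \<le> r"
      using pos by (auto simp: r_def)
    define u u' where "u = - (t * r / real n)" and "u' = t * r / real m"
    have u2: "u\<^sup>2 * real n = t\<^sup>2 * (real m / (real n + real m))"
      and u2': "u'\<^sup>2 * real m = t\<^sup>2 * (real n / (real n + real m))"
      using pos by (simp_all add: u_def u'_def power_mult_distrib power_divide r2)
        (simp_all add: power2_eq_square)
    have uu: "\<bar>u\<bar> * \<bar>u'\<bar> = t\<^sup>2 / (real n + real m)"
    proof -
      have "\<bar>u\<bar> * \<bar>u'\<bar> = t\<^sup>2 * r\<^sup>2 / (real n * real m)"
        using pos \<open>0 \<le> r\<close> power2_abs[of t] by (simp add: u_def u'_def abs_mult power2_eq_square mult_ac)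
      then show ?thesis using pos by (simp add: r2)
    qed
    have le: "\<bar>v\<bar> * sqrt (real k) \<le> \<bar>t\<bar> + 1" if "v\<^sup>2 * real k = t\<^sup>2 * y" "y \<le> 1" for v k y
    proof -
      have "(\<bar>v\<bar> * sqrt (real k))\<^sup>2 \<le> \<bar>t\<bar>\<^sup>2"
        using that mult_left_mono[of y 1 "t\<^sup>2"] by (simp add: power_mult_distrib)
      then have "\<bar>v\<bar> * sqrt (real k) \<le> \<bar>t\<bar>" by (rule power2_le_imp_le) simp
      then show ?thesis by simp
    qed
    define e e' where "e = exp (- (u\<^sup>2 * real n * ?s / 2))" and "e' = exp (- (u'\<^sup>2 * real m * ?s / 2))"
    have e1: "norm (\<phi> n u - of_real e) < \<epsilon> / 3"
      unfolding e_def using n pos by (intro N2 le[OF u2]) auto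
    have e2: "norm (\<phi> m u' - of_real e') < \<epsilon> / 3"
      unfolding e'_def using m pos by (intro N2 le[OF u2']) auto
    have "e * e' = exp (- (t\<^sup>2 * ?s / 2))"
    proof -
      have "u\<^sup>2 * real n + u'\<^sup>2 * real m = t\<^sup>2 * ((real m + real n) / (real n + real m))"
        unfolding u2 u2' by (simp add: distrib_left add_divide_distrib)
      then have "u\<^sup>2 * real n + u'\<^sup>2 * real m = t\<^sup>2" using pos by (simp add: add.commute)
      moreover have "- (u\<^sup>2 * real n * ?s / 2) + - (u'\<^sup>2 * real m * ?s / 2) = - ((u\<^sup>2 * real n + u'\<^sup>2 * real m) * ?s / 2)"
        by (simp add: field_simps)
      ultimately show ?thesis unfolding e_def e'_def exp_add[symmetric] by simp
    qed
    have "norm e' \<le> 1" using long_run_variance_nonneg by (simp add: e'_def)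
    have 1: "norm ((\<integral>x. iexp (u * S 0 n x) * iexp (u' * S (int n) m x) \<partial>iid \<nu>) - \<phi> n u * \<phi> m u') < \<epsilon> / 3"
    proof -
      have "norm ((\<integral>x. iexp (u * S 0 n x) * iexp (u' * S (int n) m x) \<partial>iid \<nu>) - \<phi> n u * \<phi> m u') \<le>
          \<bar>u\<bar> * \<bar>u'\<bar> * \<Theta> * (\<Sum>i<m. tail (Suc i)) / 2"
        by (rule char_adjacent_blocks)
      also have "\<dots> = t\<^sup>2 * \<Theta> * ((\<Sum>i<m. tail (Suc i)) / (real n + real m)) / 2"
        unfolding uu by simp
      also have "\<dots> \<le> t\<^sup>2 * \<Theta> * c m / 2"
        unfolding c_def using pos
        by (intro divide_right_mono mult_left_mono divide_left_mono mult_nonneg_nonneg sum_nonneg tail_nonneg) auto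
      also have "\<dots> < \<epsilon> / 3" using m by (intro N1) simp
      finally show ?thesis .
    qed
    have "\<phi> n u * \<phi> m u' - of_real (e * e') =
        \<phi> n u * (\<phi> m u' - of_real e') + (\<phi> n u - of_real e) * of_real e'"
      by (simp add: algebra_simps)
    then have "norm (\<phi> n u * \<phi> m u' - of_real (e * e')) \<le>
        norm (\<phi> n u) * norm (\<phi> m u' - of_real e') + norm (\<phi> n u - of_real e) * norm e'"
      by (metis norm_triangle_ineq norm_mult norm_of_real real_norm_def)
    also have "\<dots> \<le> 1 * norm (\<phi> m u' - of_real e') + norm (\<phi> n u - of_real e) * 1"
      using \<open>norm e' \<le> 1\<close> by (intro add_mono mult_right_mono mult_left_mono norm_\<phi>_le_1) auto
    finally have 2: "norm (\<phi> n u * \<phi> m u' - of_real (e * e')) < 2 * \<epsilon> / 3"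
      using e1 e2 by simp
    have "iexp (t * (r * (S (int n) m x / real m - S 0 n x / real n))) =
        iexp (u * S 0 n x) * iexp (u' * S (int n) m x)" for x
    proof -
      have "t * (r * (S (int n) m x / real m - S 0 n x / real n)) = u * S 0 n x + u' * S (int n) m x"
        by (simp add: u_def u'_def right_diff_distrib)
      then show ?thesis by (simp only: of_real_add distrib_left exp_add)
    qed
    then show ?thesis
      unfolding r_def[symmetric] using norm_triangle_lt[of "(\<integral>x. iexp (u * S 0 n x) * iexp (u' * S (int n) m x) \<partial>iid \<nu>) - \<phi> n u * \<phi> m u'" "\<phi> n u * \<phi> m u' - of_real (e * e')" \<epsilon>] 1 2 \<open>e * e' = _\<close>
      by simp
  qed
  then show ?thesis by blast
qed

end

section \<open>Convergence in law along two indices\<close>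

text \<open>Levy's theorem speaks of sequences. If convergence failed along the product filter, it would fail
along some sequence of index pairs with both components tending to infinity, to which the theorem applies.\<close>

lemma weak_conv_along_prod_sequentiallyI:
  assumes \<mu>: "\<And>n m. real_distribution (\<mu> n m)" and \<nu>: "real_distribution \<nu>"
    and char: "\<And>t. ((\<lambda>(n, m). char (\<mu> n m) t) \<longlongrightarrow> char \<nu> t) (sequentially \<times>\<^sub>F sequentially)"
  shows "weak_conv_along (\<lambda>(n, m). \<mu> n m) \<nu> (sequentially \<times>\<^sub>F sequentially)"
  unfolding weak_conv_along_def
proof (intro allI impI)
  fix x assume x: "isCont (cdf \<nu>) x"
  show "((\<lambda>i. cdf (case i of (n, m) \<Rightarrow> \<mu> n m) x) \<longlongrightarrow> cdf \<nu> x) (sequentially \<times>\<^sub>F sequentially)"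
  proof (rule ccontr)
    assume "\<not> ?thesis"
    then obtain e where e: "e > 0" "\<not> eventually (\<lambda>i. dist (cdf (case i of (n, m) \<Rightarrow> \<mu> n m) x) (cdf \<nu> x) < e)
        (sequentially \<times>\<^sub>F sequentially)"
      unfolding tendsto_iff by blast
    then have "\<forall>N. \<exists>i. N \<le> fst i \<and> N \<le> snd i \<and> e \<le> dist (cdf (\<mu> (fst i) (snd i)) x) (cdf \<nu> x)"
      unfolding eventually_prod_sequentially by (force simp: not_less)
    then obtain s where s: "\<And>N. N \<le> fst (s N)" "\<And>N. N \<le> snd (s N)"
        "\<And>N. e \<le> dist (cdf (\<mu> (fst (s N)) (snd (s N))) x) (cdf \<nu> x)"
      by metis
    have lim: "filterlim s (sequentially \<times>\<^sub>F sequentially) sequentially"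
      using filterlim_Pair[of "\<lambda>N. fst (s N)" sequentially sequentially "\<lambda>N. snd (s N)" sequentially]
        s(1,2) by (auto simp: filterlim_at_top eventually_sequentially intro: order_trans)
    have "weak_conv_m (\<lambda>N. \<mu> (fst (s N)) (snd (s N))) \<nu>"
    proof (rule levy_continuity[OF \<mu> \<nu>])
      show "(\<lambda>N. char (\<mu> (fst (s N)) (snd (s N))) t) \<longlonglongrightarrow> char \<nu> t" for t
        using filterlim_compose[OF char lim] by (simp add: case_prod_unfold)
    qed
    then have "(\<lambda>N. cdf (\<mu> (fst (s N)) (snd (s N))) x) \<longlonglongrightarrow> cdf \<nu> x"
      using x by (auto simp: weak_conv_m_def weak_conv_def)
    then obtain N where "dist (cdf (\<mu> (fst (s N)) (snd (s N))) x) (cdf \<nu> x) < e"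
      using \<open>e > 0\<close> by (auto simp: tendsto_iff eventually_sequentially)
    then show False using s(3)[of N] by simp
  qed
qed

lemma normal_law_eq_distr:
  assumes "0 < v"
  shows "normal_law 0 v = distr std_normal_distribution borel (\<lambda>x. sqrt v * x)"
proof -
  interpret std: real_distribution std_normal_distribution by (rule real_dist_normal_dist)
  have "distributed std_normal_distribution lborel (\<lambda>x. x) std_normal_density"
    by (auto simp: distributed_def distr_id2)
  from std.normal_density_affine[OF this, of "sqrt v" 0] assms
  have "distributed std_normal_distribution lborel (\<lambda>x. sqrt v * x) (normal_density 0 (sqrt v))"
    by simp
  then have "distr std_normal_distribution lborel (\<lambda>x. sqrt v * x) = density lborel (normal_density 0 (sqrt v))"
    by (simp add: distributed_def)
  then show ?thesis
    using assms by (simp add: normal_law_def cong: distr_cong)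
qed

lemma real_distribution_normal_law:
  assumes "0 \<le> v"
  shows "real_distribution (normal_law 0 v)"
proof (cases "v = 0")
  case True
  then show ?thesis
    by (auto simp: normal_law_def real_distribution_def real_distribution_axioms_def prob_space_return)
next
  case False
  interpret std: real_distribution std_normal_distribution by (rule real_dist_normal_dist)
  from False assms show ?thesis by (simp add: normal_law_eq_distr std.real_distribution_distr)
qed

lemma char_normal_law:
  assumes "0 \<le> v"
  shows "char (normal_law 0 v) t = of_real (exp (- (t\<^sup>2 * v / 2)))"
proof (cases "v = 0")
  case True
  then show ?thesis
    by (simp add: normal_law_def char_def integral_return)
next
  case False
  then have "0 < v" using assms by simp
  have "char (normal_law 0 v) t = (CLINT x|std_normal_distribution. iexp (t * (sqrt v * x)))"
    unfolding normal_law_eq_distr[OF \<open>0 < v\<close>] char_def by (subst integral_distr) auto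
  also have "\<dots> = char std_normal_distribution (t * sqrt v)"
    by (simp add: char_def mult.assoc)
  also have "\<dots> = of_real (exp (- (t\<^sup>2 * v / 2)))"
    using assms by (simp add: char_std_normal_distribution power_mult_distrib)
  finally show ?thesis .
qed

section \<open>The empirical quantile\<close>

lemma sort_nth_le_iff:
  fixes xs :: "'a::linorder list"
  assumes k: "1 \<le> k" "k \<le> length xs"
  shows "sort xs ! (k - 1) \<le> v \<longleftrightarrow> k \<le> length (filter (\<lambda>x. x \<le> v) xs)"
proof -
  define ys where "ys = sort xs"
  have ys: "sorted ys" "length ys = length xs" by (simp_all add: ys_def)
  have len: "length (filter (\<lambda>x. x \<le> v) xs) = length (filter (\<lambda>x. x \<le> v) ys)"
    unfolding ys_def by (metis filter_sort length_sort)
  have split: "filter (\<lambda>x. x \<le> v) ys = filter (\<lambda>x. x \<le> v) (take j ys) @ filter (\<lambda>x. x \<le> v) (drop j ys)" for j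
    by (metis append_take_drop_id filter_append)
  show ?thesis
  proof (cases "ys ! (k - 1) \<le> v")
    case True
    have "filter (\<lambda>x. x \<le> v) (take k ys) = take k ys"
    proof (rule filter_True, rule ballI)
      fix x assume "x \<in> set (take k ys)"
      then obtain i where "i < k" "x = ys ! i"
        using k ys by (auto simp: in_set_conv_nth)
      then have "x \<le> ys ! (k - 1)"
        using k ys by (auto intro: sorted_nth_mono)
      with True show "x \<le> v" by simp
    qed
    then have "k \<le> length (filter (\<lambda>x. x \<le> v) ys)"
      using k ys by (subst split[of k]) simp
    with True show ?thesis by (simp add: len ys_def)
  next
    case False
    have "filter (\<lambda>x. x \<le> v) (drop (k - 1) ys) = []"
    proof (rule filter_False, rule ballI)
      fix x assume "x \<in> set (drop (k - 1) ys)"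
      then obtain i where i: "i < length (drop (k - 1) ys)" "x = drop (k - 1) ys ! i"
        by (metis in_set_conv_nth)
      then have "x = ys ! (k - 1 + i)" "k - 1 + i < length ys"
        using k ys by auto
      then have "ys ! (k - 1) \<le> x"
        using ys(1) by (auto intro: sorted_nth_mono)
      with False show "\<not> x \<le> v" by simp
    qed
    then have "length (filter (\<lambda>x. x \<le> v) ys) = length (filter (\<lambda>x. x \<le> v) (take (k - 1) ys))"
      by (subst split[of "k - 1"]) simp
    also have "\<dots> \<le> k - 1"
      by (rule order_trans[OF length_filter_le]) simp
    finally have "\<not> k \<le> length (filter (\<lambda>x. x \<le> v) ys)" using k by linarith
    with False show ?thesis by (simp add: len ys_def)
  qed
qed

definition count_le :: "(int \<Rightarrow> 'a \<Rightarrow> real) \<Rightarrow> int \<Rightarrow> nat \<Rightarrow> real \<Rightarrow> 'a \<Rightarrow> real" where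
  "count_le V a n v \<omega> = (\<Sum>t\<in>{a + 1..a + int n}. indicator {..v} (V t \<omega>))"

lemma count_le_mono: "v \<le> w \<Longrightarrow> count_le V a n v \<omega> \<le> count_le V a n w \<omega>"
  unfolding count_le_def by (intro sum_mono) (auto simp: indicator_def)

lemma count_le_eq_length:
  "count_le V 0 n v \<omega> = real (length (filter (\<lambda>x. x \<le> v) (map (\<lambda>t. V t \<omega>) [1..int n])))"
proof -
  have "length (filter (\<lambda>x. x \<le> v) (map (\<lambda>t. V t \<omega>) [1..int n])) =
      card (set (filter (\<lambda>t. V t \<omega> \<le> v) [1..int n]))"
    using distinct_card[of "filter (\<lambda>t. V t \<omega> \<le> v) [1..int n]"] by (simp add: filter_map comp_def)
  also have "set (filter (\<lambda>t. V t \<omega> \<le> v) [1..int n]) = {t \<in> {1..int n}. V t \<omega> \<le> v}"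
    by auto
  finally show ?thesis
    unfolding count_le_def by (simp add: sum.If_cases indicator_def Int_def)
qed

text \<open>The real number that \<open>conformal_quantile\<close> injects into the extended reals when the rank is at most \<open>n\<close>.\<close>

definition order_stat :: "(int \<Rightarrow> 'a \<Rightarrow> real) \<Rightarrow> nat \<Rightarrow> nat \<Rightarrow> 'a \<Rightarrow> real" where
  "order_stat V n k \<omega> = sort (map (\<lambda>t. V t \<omega>) [1..int n]) ! (k - 1)"

text \<open>Through this equivalence every statement about the empirical quantile becomes one about counts.\<close>

lemma order_stat_le_iff:
  assumes "1 \<le> k" "k \<le> n"
  shows "order_stat V n k \<omega> \<le> v \<longleftrightarrow> real k \<le> count_le V 0 n v \<omega>"
  unfolding order_stat_def count_le_eq_length using assms by (subst sort_nth_le_iff) auto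

lemma realized_coverage_eq:
  assumes V: "\<And>t. V t \<omega> = \<bar>Y t \<omega> - \<mu> (X t \<omega>)\<bar>"
  shows "realized_coverage \<alpha> \<mu> X Y V n m \<omega> =
    (if conformal_rank \<alpha> n \<le> n then count_le V (int n) m (order_stat V n (conformal_rank \<alpha> n) \<omega>) \<omega> / real m
     else (\<Sum>t\<in>{int n + 1..int n + int m}. 1) / real m)"
proof -
  have ind: "indicator (prediction_interval \<alpha> \<mu> V n \<omega> (X t \<omega>)) (Y t \<omega>) =
    (if conformal_rank \<alpha> n \<le> n then indicator {..order_stat V n (conformal_rank \<alpha> n) \<omega>} (V t \<omega>) else (1::real))" for t
    unfolding V[of t]
    by (auto simp: prediction_interval_def conformal_quantile_def order_stat_def indicator_def abs_le_iff)
  show ?thesis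
    unfolding realized_coverage_def count_le_def ind by (simp add: sum_distrib_left sum_divide_distrib)
qed

lemma (in prob_space) Chebyshev_second_moment:
  assumes [measurable]: "X \<in> borel_measurable M" and "integrable M (\<lambda>x. (X x)\<^sup>2)" and "0 < a"
  shows "prob {x \<in> space M. a < \<bar>X x\<bar>} \<le> expectation (\<lambda>x. (X x)\<^sup>2) / a\<^sup>2"
proof -
  have "prob {x \<in> space M. a < \<bar>X x\<bar>} \<le> prob {x \<in> space M. a\<^sup>2 \<le> (X x)\<^sup>2}"
    using \<open>0 < a\<close> by (intro finite_measure_mono) (auto intro: power_mono[of a "\<bar>X _\<bar>" 2, simplified])
  also have "\<dots> \<le> expectation (\<lambda>x. (X x)\<^sup>2) / a\<^sup>2"
    using assms by (intro integral_Markov_inequality_measure[where A = "{}"]) auto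
  finally show ?thesis .
qed

text \<open>The deterministic part of the linearization, for one outcome: \<open>cnt\<close> and \<open>cnt'\<close> stand for the counts
on the calibration and on the test set, \<open>x\<close> for the empirical quantile and \<open>u\<close> for the grid. By \<open>bulk\<close>
the quantile falls inside the grid, say between \<open>u j\<close> and \<open>u (j + 1)\<close>. The calibration counts at
these two points lie on either side of the rank, which locates the level \<open>(j - K) \<epsilon>\<close> within \<open>2 \<epsilon>\<close> of
\<open>- (cnt q - n p) / sqrt n\<close>. The coverage lies between the test counts at the same two points, which
\<open>test\<close> compares with the test count at \<open>q\<close> shifted by that level.\<close>

lemma coverage_linearization:
  fixes cnt cnt' :: "real \<Rightarrow> real" and u :: "nat \<Rightarrow> real" and n m K :: nat
  assumes pos: "0 < n" "0 < m" "0 < \<epsilon>"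
    and rank: "real n * p \<le> k" "k \<le> real n * p + \<epsilon> * sqrt (real n)"
    and x: "\<And>v. x \<le> v \<longleftrightarrow> k \<le> cnt v"
    and mono: "\<And>v w. v \<le> w \<Longrightarrow> cnt' v \<le> cnt' w"
    and grid: "\<And>j. j \<le> 2 * K \<Longrightarrow> F (u j) = p + (real j - real K) * \<epsilon> / sqrt (real n)"
    and Fq: "F q = p"
    and cal: "\<And>j. j \<le> 2 * K \<Longrightarrow>
      \<bar>(cnt (u j) - real n * F (u j)) - (cnt q - real n * F q)\<bar> \<le> \<epsilon> * sqrt (real n)"
    and test: "\<And>j. j \<le> 2 * K \<Longrightarrow>
      \<bar>(cnt' (u j) - real m * F (u j)) - (cnt' q - real m * F q)\<bar> \<le> \<epsilon> * sqrt (real m)"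
    and bulk: "\<bar>cnt q - real n * F q\<bar> \<le> (real K - 2) * \<epsilon> * sqrt (real n)"
  defines "r \<equiv> sqrt (real n * real m / (real n + real m))"
  shows "\<bar>r * (cnt' x / real m - p) - r * ((cnt' q - real m * p) / real m - (cnt q - real n * p) / real n)\<bar> \<le> 4 * \<epsilon>"
proof -
  let ?n = "sqrt (real n)"
  have n[simp]: "0 < ?n" "?n * ?n = real n" using pos by auto
  define Z where "Z = (cnt q - real n * p) / ?n"
  have cntu: "cnt (u j) \<le> real n * p + ?n * ((real j - real K) * \<epsilon> + Z + \<epsilon>)"
    "cnt (u j) \<ge> real n * p + ?n * ((real j - real K) * \<epsilon> + Z - \<epsilon>)" if "j \<le> 2 * K" for j
  proof -
    have "real n * F (u j) = real n * p + ?n * ((real j - real K) * \<epsilon>)"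
      unfolding grid[OF that] using n by (simp add: distrib_left field_simps)
    moreover have "cnt q - real n * F q = ?n * Z" using n(1) by (simp add: Z_def Fq)
    ultimately show "cnt (u j) \<le> real n * p + ?n * ((real j - real K) * \<epsilon> + Z + \<epsilon>)"
      "cnt (u j) \<ge> real n * p + ?n * ((real j - real K) * \<epsilon> + Z - \<epsilon>)"
      using cal[OF that] by (auto simp: abs_le_iff distrib_left right_diff_distrib mult.commute)
  qed
  have Z: "\<bar>Z\<bar> \<le> (real K - 2) * \<epsilon>"
    using bulk n(1) by (simp add: Z_def Fq abs_div_pos[symmetric] divide_le_eq)
  have "u 0 < x"
  proof -
    have "?n * ((real 0 - real K) * \<epsilon> + Z + \<epsilon>) < 0"
      using Z pos(3) n(1) by (intro mult_pos_neg) (auto simp: left_diff_distrib abs_le_iff)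
    then have "cnt (u 0) < k" using cntu(1)[of 0] rank(1) by simp
    then show ?thesis using x[of "u 0"] by simp
  qed
  moreover have "x \<le> u (2 * K)"
  proof -
    have "?n * \<epsilon> \<le> ?n * ((real (2 * K) - real K) * \<epsilon> + Z - \<epsilon>)"
      using Z n(1) by (intro mult_left_mono) (auto simp: left_diff_distrib abs_le_iff)
    then have "k \<le> cnt (u (2 * K))" using cntu(2)[of "2 * K"] rank(2) by (simp add: mult.commute)
    then show ?thesis using x by simp
  qed
  ultimately obtain j where j: "j < 2 * K" "u j < x" "x \<le> u (Suc j)"
  proof -
    have "\<exists>j<l. u j < x \<and> x \<le> u (Suc j)" if "u 0 < x" "x \<le> u l" for l
      using that
    proof (induction l)
      case (Suc l)
      then show ?case by (cases "x \<le> u l") (auto intro: less_SucI)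
    qed simp
    then show ?thesis using \<open>u 0 < x\<close> \<open>x \<le> u (2 * K)\<close> that by blast
  qed
  \<comment> \<open>the level of the grid point below the quantile, relative to \<open>p\<close> and in units of \<open>1 / sqrt n\<close>\<close>
  define i where "i = (real j - real K) * \<epsilon>"
  have "i < 2 * \<epsilon> - Z"
  proof -
    have "cnt (u j) < k" using x[of "u j"] j(2) by simp
    then have "?n * (i + Z - \<epsilon>) < ?n * \<epsilon>"
      using cntu(2)[of j] j(1) rank(2) by (simp add: i_def mult.commute)
    then show ?thesis using n(1) by simp
  qed
  moreover have "- 2 * \<epsilon> - Z \<le> i"
  proof -
    have "k \<le> cnt (u (Suc j))" using x j(3) by simp
    also have "cnt (u (Suc j)) \<le> real n * p + ?n * (i + \<epsilon> + Z + \<epsilon>)"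
      using cntu(1)[of "Suc j"] j(1) by (simp add: i_def algebra_simps)
    finally have "0 \<le> ?n * (i + \<epsilon> + Z + \<epsilon>)" using rank(1) by simp
    then show ?thesis using n(1) by (simp add: zero_le_mult_iff)
  qed
  ultimately have i: "\<bar>i + Z\<bar> \<le> 2 * \<epsilon>" by (simp add: abs_le_iff)
  let ?W = "cnt' q - real m * p" and ?m = "sqrt (real m)"
  have m[simp]: "0 < ?m" "?m * ?m = real m" using pos by auto
  have F_j: "F (u j) = p + i / ?n" "F (u (Suc j)) = p + (i + \<epsilon>) / ?n"
    using grid[of j] grid[of "Suc j"] j(1) by (auto simp: i_def algebra_simps)
  have lower: "real m * (i / ?n) + ?W - \<epsilon> * ?m \<le> cnt' x - real m * p"
    using test[of j] mono[of "u j" x] j(1,2) unfolding F_j Fq by (simp add: abs_le_iff distrib_left)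
  have upper: "cnt' x - real m * p \<le> real m * ((i + \<epsilon>) / ?n) + ?W + \<epsilon> * ?m"
    using test[of "Suc j"] mono[of x "u (Suc j)"] j(1,3) unfolding F_j Fq by (simp add: abs_le_iff distrib_left)
  have r: "0 \<le> r" "r \<le> ?n" "r \<le> ?m"
    unfolding r_def using pos by (auto simp: field_simps intro!: real_sqrt_le_mono)
  \<comment> \<open>the calibration error enters the coverage with this weight\<close>
  define c where "c = r / ?n"
  have c: "0 \<le> c" "c \<le> 1" using r n(1) by (auto simp: c_def divide_le_eq)
  have rm: "0 \<le> r / real m" using r by simp
  have eps: "r / real m * (\<epsilon> * ?m) \<le> \<epsilon>"
  proof -
    have "r / real m * (\<epsilon> * ?m) = \<epsilon> * (r / ?m)" using m(1) pos(2) by (simp add: field_simps)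
    also have "\<dots> \<le> \<epsilon> * 1" using r m(1) pos(3) by (intro mult_left_mono) (auto simp: divide_le_eq)
    finally show ?thesis by simp
  qed
  have T: "r * (cnt' x / real m - p) = r / real m * (cnt' x - real m * p)"
    using pos by (simp add: field_simps)
  have S: "r * (?W / real m - (cnt q - real n * p) / real n) = r / real m * ?W - c * Z"
  proof -
    have "c * Z = r * (cnt q - real n * p) / (?n * ?n)" by (simp add: c_def Z_def)
    then show ?thesis
      unfolding n(2) right_diff_distrib[of r "?W / real m"] by (simp only: times_divide_eq_left times_divide_eq_right)
  qed
  have mi: "r / real m * (real m * (y / ?n)) = c * y" for y
    using pos by (simp add: c_def)
  have "r / real m * (cnt' x - real m * p) \<le> c * (i + \<epsilon>) + r / real m * ?W + \<epsilon>"
    using mult_left_mono[OF upper rm] eps unfolding distrib_left mi by linarith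
  moreover have "c * i + r / real m * ?W - \<epsilon> \<le> r / real m * (cnt' x - real m * p)"
    using mult_left_mono[OF lower rm] eps unfolding distrib_left right_diff_distrib mi by linarith
  moreover have "c * (i + \<epsilon>) + c * Z \<le> 3 * \<epsilon>"
  proof -
    have "c * (i + \<epsilon>) + c * Z = c * (i + Z + \<epsilon>)" by (simp add: distrib_left)
    also have "\<dots> \<le> c * (3 * \<epsilon>)" using c i by (intro mult_left_mono) (auto simp: abs_le_iff)
    also have "\<dots> \<le> 1 * (3 * \<epsilon>)" using c pos(3) by (intro mult_right_mono) auto
    finally show ?thesis by simp
  qed
  moreover have "- (3 * \<epsilon>) \<le> c * i + c * Z"
  proof -
    have "\<bar>c * (i + Z)\<bar> \<le> 1 * (2 * \<epsilon>)" unfolding abs_mult using c i by (intro mult_mono) auto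
    then show ?thesis using pos(3) by (simp add: distrib_left abs_le_iff)
  qed
  ultimately show ?thesis unfolding T S by (simp add: abs_le_iff)
qed

lemma count_le_measurable [measurable]:
  assumes [measurable]: "\<And>t. V t \<in> borel_measurable M"
  shows "count_le V a n v \<in> borel_measurable M"
  unfolding count_le_def[abs_def] by measurable

lemma order_stat_measurable:
  assumes [measurable]: "\<And>t. V t \<in> borel_measurable M" and k: "1 \<le> k" "k \<le> n"
  shows "order_stat V n k \<in> borel_measurable M"
  unfolding borel_measurable_iff_le order_stat_le_iff[OF k] by measurable

lemma count_le_at_measurable:
  assumes [measurable]: "\<And>t. V t \<in> borel_measurable M" "x \<in> borel_measurable M"
  shows "(\<lambda>\<omega>. count_le V a n (x \<omega>) \<omega>) \<in> borel_measurable M"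
proof -
  have "count_le V a n (x \<omega>) \<omega> = (\<Sum>t\<in>{a + 1..a + int n}. if V t \<omega> \<le> x \<omega> then 1 else 0)" for \<omega>
    unfolding count_le_def by (intro sum.cong) (auto simp: indicator_def)
  then show ?thesis by simp
qed

lemma count_le_bounds: "0 \<le> count_le V a n v \<omega>" "count_le V a n v \<omega> \<le> real n"
proof -
  show "0 \<le> count_le V a n v \<omega>" unfolding count_le_def by (intro sum_nonneg) simp
  have "count_le V a n v \<omega> \<le> real (card {a + 1..a + int n}) * 1"
    unfolding count_le_def by (rule sum_bounded_above) (simp add: indicator_def)
  then show "count_le V a n v \<omega> \<le> real n" by simp
qed

lemma conformal_rank_bounds:
  assumes "0 < \<alpha>" "\<alpha> < 1"
  shows "1 \<le> conformal_rank \<alpha> n" "real n * (1 - \<alpha>) \<le> real (conformal_rank \<alpha> n)"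
    "real (conformal_rank \<alpha> n) \<le> real n * (1 - \<alpha>) + 2"
proof -
  have pos: "0 < (real n + 1) * (1 - \<alpha>)" using assms by simp
  then have *: "real (conformal_rank \<alpha> n) = of_int \<lceil>(real n + 1) * (1 - \<alpha>)\<rceil>"
    unfolding conformal_rank_def by simp
  have "(real n + 1) * (1 - \<alpha>) = real n * (1 - \<alpha>) + (1 - \<alpha>)" by (simp add: algebra_simps)
  moreover have "(real n + 1) * (1 - \<alpha>) \<le> real (conformal_rank \<alpha> n)"
    "real (conformal_rank \<alpha> n) < (real n + 1) * (1 - \<alpha>) + 1"
    unfolding * by linarith+
  ultimately show "real n * (1 - \<alpha>) \<le> real (conformal_rank \<alpha> n)"
    "real (conformal_rank \<alpha> n) \<le> real n * (1 - \<alpha>) + 2"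
    using assms by linarith+
  show "1 \<le> conformal_rank \<alpha> n" using pos unfolding conformal_rank_def by linarith
qed

lemma eventually_conformal_rank_le:
  assumes "0 < \<alpha>" "\<alpha> < 1"
  shows "eventually (\<lambda>n. conformal_rank \<alpha> n \<le> n) sequentially"
proof -
  have "eventually (\<lambda>n. 2 / \<alpha> \<le> real n) sequentially"
    using filterlim_real_sequentially unfolding filterlim_at_top by blast
  then show ?thesis
  proof eventually_elim
    case (elim n)
    then have "2 \<le> real n * \<alpha>" using \<open>0 < \<alpha>\<close> by (simp add: divide_le_eq)
    then have "real n * (1 - \<alpha>) + 2 \<le> real n" by (simp add: algebra_simps)
    then have "real (conformal_rank \<alpha> n) \<le> real n"
      using conformal_rank_bounds(3)[OF assms, of n] by linarith
    then show ?case by simp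
  qed
qed

text \<open>Chebyshev's inequality at the finitely many grid points. The half-width \<open>K\<close> of the grid is fixed first,
so that the quantile stays inside with high probability; then \<open>n\<close> is taken so large that all
levels of the grid, which lie within \<open>K \<epsilon> / sqrt n\<close> of \<open>1 - \<alpha>\<close>, make the modulus \<open>\<psi>\<close> small.\<close>

theorem (in prob_space) coverage_linearization_in_probability:
  fixes V :: "int \<Rightarrow> 'a \<Rightarrow> real" and F \<psi> :: "real \<Rightarrow> real"
  defines "C a n v \<omega> \<equiv> count_le V a n v \<omega> - real n * F v"
  assumes V[measurable]: "\<And>t. V t \<in> borel_measurable M"
    and \<alpha>: "0 < \<alpha>" "\<alpha> < 1" and Fq: "F q = 1 - \<alpha>"
    and onto: "\<And>y. 0 < y \<Longrightarrow> y < 1 \<Longrightarrow> \<exists>v. F v = y"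
    and modulus: "\<And>a n v. expectation (\<lambda>\<omega>. (C a n v \<omega> - C a n q \<omega>)\<^sup>2) \<le> real n * \<psi> \<bar>F v - F q\<bar>"
    and \<psi>: "\<And>\<eta>. 0 < \<eta> \<Longrightarrow> \<exists>\<delta>>0. \<forall>x. 0 \<le> x \<and> x < \<delta> \<longrightarrow> \<psi> x \<le> \<eta>"
    and variance: "\<And>n. expectation (\<lambda>\<omega>. (C 0 n q \<omega>)\<^sup>2) \<le> real n * B"
    and "0 < \<eta>" "0 < \<delta>"
  shows "\<exists>N. \<forall>n\<ge>N. \<forall>m\<ge>1. conformal_rank \<alpha> n \<le> n \<and> (\<exists>A\<in>events. prob A \<le> \<eta> \<and>
    (\<forall>\<omega>\<in>space M - A. \<bar>sqrt (real n * real m / (real n + real m)) *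
        (count_le V (int n) m (order_stat V n (conformal_rank \<alpha> n) \<omega>) \<omega> / real m - (1 - \<alpha>))
      - sqrt (real n * real m / (real n + real m)) * (C (int n) m q \<omega> / real m - C 0 n q \<omega> / real n)\<bar> \<le> \<delta>))"
proof -
  define p where "p = 1 - \<alpha>"
  have p: "0 < p" "p < 1" using \<alpha> by (auto simp: p_def)
  define \<epsilon> where "\<epsilon> = \<delta> / 4"
  have "0 < \<epsilon>" using \<open>0 < \<delta>\<close> by (simp add: \<epsilon>_def)
  have int: "integrable M (\<lambda>\<omega>. (C a n v \<omega> - c * C a n w \<omega>)\<^sup>2)" for a n v w c
  proof (rule integrable_if_bounded[where B = "((real n + \<bar>real n * F v\<bar>) + \<bar>c\<bar> * (real n + \<bar>real n * F w\<bar>))\<^sup>2"])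
    fix \<omega>
    have b: "\<bar>C a n v \<omega>\<bar> \<le> real n + \<bar>real n * F v\<bar>" for v
      unfolding C_def using count_le_bounds[of V a n v \<omega>] by linarith
    have "\<bar>C a n v \<omega> - c * C a n w \<omega>\<bar> \<le> \<bar>C a n v \<omega>\<bar> + \<bar>c\<bar> * \<bar>C a n w \<omega>\<bar>"
      using abs_triangle_ineq4[of "C a n v \<omega>" "c * C a n w \<omega>"] by (simp add: abs_mult)
    also have "\<dots> \<le> (real n + \<bar>real n * F v\<bar>) + \<bar>c\<bar> * (real n + \<bar>real n * F w\<bar>)"
      by (intro add_mono mult_left_mono b) auto
    finally have "\<bar>C a n v \<omega> - c * C a n w \<omega>\<bar>\<^sup>2 \<le> \<dots>\<^sup>2" by (intro power_mono) auto
    then show "norm ((C a n v \<omega> - c * C a n w \<omega>)\<^sup>2) \<le> ((real n + \<bar>real n * F v\<bar>) + \<bar>c\<bar> * (real n + \<bar>real n * F w\<bar>))\<^sup>2"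
      by simp
  qed (simp add: C_def)
  have Cm[measurable]: "C a n v \<in> borel_measurable M" for a n v
    unfolding C_def[abs_def] by measurable
  obtain K :: nat where K: "max 3 (3 + 2 * \<bar>B\<bar> / (\<eta> * \<epsilon>\<^sup>2)) \<le> real K"
    using real_arch_simple by blast
  have K2: "1 \<le> real K - 2" "2 * \<bar>B\<bar> / (\<eta> * \<epsilon>\<^sup>2) \<le> real K - 2" using K by auto
  have KB: "B / ((real K - 2) * \<epsilon>)\<^sup>2 \<le> \<eta> / 2"
  proof -
    have "2 * \<bar>B\<bar> / (\<eta> * \<epsilon>\<^sup>2) \<le> (real K - 2)\<^sup>2"
    proof -
      have "(real K - 2) * 1 \<le> (real K - 2) * (real K - 2)"
        using K2(1) by (intro mult_left_mono) auto
      then show ?thesis using K2(2) by (simp only: power2_eq_square mult_1_right)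
    qed
    then have "2 * \<bar>B\<bar> \<le> \<eta> * ((real K - 2) * \<epsilon>)\<^sup>2"
      using \<open>0 < \<eta>\<close> \<open>0 < \<epsilon>\<close> by (simp add: divide_le_eq power_mult_distrib mult_ac)
    then have "B \<le> \<eta> / 2 * ((real K - 2) * \<epsilon>)\<^sup>2" by linarith
    then show ?thesis using K2(1) \<open>0 < \<epsilon>\<close> by (subst divide_le_eq) auto
  qed
  define \<eta>' where "\<eta>' = \<eta> * \<epsilon>\<^sup>2 / (4 * real (2 * K + 1))"
  have "0 < \<eta>'" using \<open>0 < \<eta>\<close> \<open>0 < \<epsilon>\<close> by (simp add: \<eta>'_def)
  from \<psi>[OF this] obtain \<delta>' where \<delta>': "0 < \<delta>'" "\<And>x. 0 \<le> x \<Longrightarrow> x < \<delta>' \<Longrightarrow> \<psi> x \<le> \<eta>'" by blast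
  \<comment> \<open>a distance from \<open>p\<close> at which levels are still attained by \<open>F\<close> and the modulus is small\<close>
  define L where "L = min \<delta>' (min p (1 - p))"
  have "0 < L" using \<delta>' p by (simp add: L_def)
  have sqrt_top: "filterlim (\<lambda>n. sqrt (real n)) at_top sequentially"
    by (rule filterlim_compose[OF sqrt_at_top filterlim_real_sequentially])
  have "eventually (\<lambda>n. max (2 / \<epsilon>) (real K * \<epsilon> / L + 1) \<le> sqrt (real n) \<and> conformal_rank \<alpha> n \<le> n \<and> 0 < n) sequentially"
    using sqrt_top unfolding filterlim_at_top
    by (intro eventually_conj eventually_conformal_rank_le[OF \<alpha>] eventually_gt_at_top) blast
  then obtain N where N: "\<And>n. n \<ge> N \<Longrightarrow> 2 / \<epsilon> \<le> sqrt (real n) \<and> real K * \<epsilon> / L + 1 \<le> sqrt (real n) \<and>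
      conformal_rank \<alpha> n \<le> n \<and> 0 < n"
    unfolding eventually_sequentially by auto
  have "conformal_rank \<alpha> n \<le> n \<and> (\<exists>A\<in>events. prob A \<le> \<eta> \<and>
    (\<forall>\<omega>\<in>space M - A. \<bar>sqrt (real n * real m / (real n + real m)) *
        (count_le V (int n) m (order_stat V n (conformal_rank \<alpha> n) \<omega>) \<omega> / real m - (1 - \<alpha>))
      - sqrt (real n * real m / (real n + real m)) * (C (int n) m q \<omega> / real m - C 0 n q \<omega> / real n)\<bar> \<le> \<delta>))"
    if n: "n \<ge> N" and m: "m \<ge> 1" for n m
  proof
    let ?k = "conformal_rank \<alpha> n"
    show k: "?k \<le> n" using N[OF n] by simp
    have pos: "0 < n" "0 < m" using N[OF n] m by auto
    have "2 / \<epsilon> \<le> sqrt (real n)" using N[OF n] by simp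
    then have e2: "2 \<le> \<epsilon> * sqrt (real n)" using \<open>0 < \<epsilon>\<close> by (simp add: divide_le_eq mult.commute)
    have "real K * \<epsilon> / L < sqrt (real n)" using N[OF n] by linarith
    then have KL: "real K * \<epsilon> / sqrt (real n) < L"
      using \<open>0 < L\<close> pos by (simp add: divide_less_eq mult.commute)
    have near: "\<bar>(real j - real K) * \<epsilon> / sqrt (real n)\<bar> < L" if "j \<le> 2 * K" for j
    proof -
      have "\<bar>real j - real K\<bar> \<le> real K" using that by (auto simp: abs_le_iff)
      then have "\<bar>(real j - real K) * \<epsilon> / sqrt (real n)\<bar> \<le> real K * \<epsilon> / sqrt (real n)"
        using \<open>0 < \<epsilon>\<close> by (simp add: abs_mult divide_right_mono)
      with KL show ?thesis by linarith
    qed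
    have "\<exists>v. j \<le> 2 * K \<longrightarrow> F v = p + (real j - real K) * \<epsilon> / sqrt (real n)" for j
    proof (cases "j \<le> 2 * K")
      case True
      have "\<bar>(real j - real K) * \<epsilon> / sqrt (real n)\<bar> < p" "\<bar>(real j - real K) * \<epsilon> / sqrt (real n)\<bar> < 1 - p"
        using near[OF True] by (auto simp: L_def)
      then have "0 < p + (real j - real K) * \<epsilon> / sqrt (real n)" "p + (real j - real K) * \<epsilon> / sqrt (real n) < 1"
        unfolding abs_less_iff by linarith+
      from onto[OF this] show ?thesis by blast
    qed simp
    then obtain u where u: "\<And>j. j \<le> 2 * K \<Longrightarrow> F (u j) = p + (real j - real K) * \<epsilon> / sqrt (real n)"
      by metis
    have \<psi>u: "\<psi> \<bar>F (u j) - F q\<bar> \<le> \<eta>'" if "j \<le> 2 * K" for j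
      using near[OF that] by (intro \<delta>') (auto simp: u[OF that] Fq p_def L_def)
    define A0 where "A0 = {\<omega> \<in> space M. (real K - 2) * \<epsilon> * sqrt (real n) < \<bar>C 0 n q \<omega>\<bar>}"
    define A1 where "A1 j = {\<omega> \<in> space M. \<epsilon> * sqrt (real n) < \<bar>C 0 n (u j) \<omega> - C 0 n q \<omega>\<bar>}" for j
    define A2 where "A2 j = {\<omega> \<in> space M. \<epsilon> * sqrt (real m) < \<bar>C (int n) m (u j) \<omega> - C (int n) m q \<omega>\<bar>}" for j
    have [measurable]: "A0 \<in> events" "A1 j \<in> events" "A2 j \<in> events" for j
      unfolding A0_def A1_def A2_def by measurable
    have P0: "prob A0 \<le> \<eta> / 2"
    proof -
      have "prob A0 \<le> expectation (\<lambda>\<omega>. (C 0 n q \<omega>)\<^sup>2) / ((real K - 2) * \<epsilon> * sqrt (real n))\<^sup>2"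
        unfolding A0_def using int[of 0 n q 0 q] K2(1) \<open>0 < \<epsilon>\<close> pos
        by (intro Chebyshev_second_moment) auto
      also have "\<dots> \<le> real n * B / ((real K - 2) * \<epsilon> * sqrt (real n))\<^sup>2"
        by (intro divide_right_mono variance) auto
      also have "\<dots> = B / ((real K - 2) * \<epsilon>)\<^sup>2"
        using pos by (simp add: power_mult_distrib)
      finally show ?thesis using KB by linarith
    qed
    have P12: "prob {\<omega> \<in> space M. \<epsilon> * sqrt (real l) < \<bar>C a l (u j) \<omega> - C a l q \<omega>\<bar>} \<le> \<eta>' / \<epsilon>\<^sup>2"
      if "j \<le> 2 * K" "0 < l" for j l a
    proof -
      have "prob {\<omega> \<in> space M. \<epsilon> * sqrt (real l) < \<bar>C a l (u j) \<omega> - C a l q \<omega>\<bar>} \<le>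
          expectation (\<lambda>\<omega>. (C a l (u j) \<omega> - C a l q \<omega>)\<^sup>2) / (\<epsilon> * sqrt (real l))\<^sup>2"
        using int[of a l "u j" 1 q] \<open>0 < \<epsilon>\<close> \<open>0 < l\<close> by (intro Chebyshev_second_moment) auto
      also have "\<dots> \<le> real l * \<eta>' / (\<epsilon> * sqrt (real l))\<^sup>2"
        by (intro divide_right_mono order_trans[OF modulus] mult_left_mono \<psi>u that) auto
      also have "\<dots> = \<eta>' / \<epsilon>\<^sup>2" using \<open>0 < l\<close> by (simp add: power_mult_distrib)
      finally show ?thesis .
    qed
    define A where "A = A0 \<union> (\<Union>j\<in>{..2 * K}. A1 j \<union> A2 j)"
    have [measurable]: "A \<in> events" unfolding A_def by measurable
    have "prob A \<le> prob A0 + prob (\<Union>j\<in>{..2 * K}. A1 j \<union> A2 j)"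
      unfolding A_def by (intro measure_Un_le) measurable
    also have "prob (\<Union>j\<in>{..2 * K}. A1 j \<union> A2 j) \<le> (\<Sum>j\<in>{..2 * K}. prob (A1 j \<union> A2 j))"
      by (intro measure_UNION_le) auto
    also have "\<dots> \<le> (\<Sum>j\<in>{..2 * K}. 2 * (\<eta>' / \<epsilon>\<^sup>2))"
    proof (rule sum_mono)
      fix j assume "j \<in> {..2 * K}"
      then have "prob (A1 j) \<le> \<eta>' / \<epsilon>\<^sup>2" "prob (A2 j) \<le> \<eta>' / \<epsilon>\<^sup>2"
        unfolding A1_def A2_def using pos by (auto intro: P12)
      moreover have "prob (A1 j \<union> A2 j) \<le> prob (A1 j) + prob (A2 j)"
        by (intro measure_Un_le) auto
      ultimately show "prob (A1 j \<union> A2 j) \<le> 2 * (\<eta>' / \<epsilon>\<^sup>2)" by linarith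
    qed
    also have "\<dots> = \<eta> / 2"
    proof -
      have "\<eta>' / \<epsilon>\<^sup>2 = \<eta> / (4 * real (2 * K + 1))" using \<open>0 < \<epsilon>\<close> by (simp add: \<eta>'_def)
      moreover have "y * (2 * (\<eta> / (4 * y))) = \<eta> / 2" if "0 < y" for y
        using that by simp
      from this[of "real (2 * K + 1)"] have "real (2 * K + 1) * (2 * (\<eta> / (4 * real (2 * K + 1)))) = \<eta> / 2"
        by simp
      ultimately have "real (2 * K + 1) * (2 * (\<eta>' / \<epsilon>\<^sup>2)) = \<eta> / 2" by (simp only:)
      then show ?thesis by simp
    qed
    finally have "prob A \<le> \<eta>" using P0 by linarith
    moreover have "\<bar>sqrt (real n * real m / (real n + real m)) *
        (count_le V (int n) m (order_stat V n ?k \<omega>) \<omega> / real m - (1 - \<alpha>))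
      - sqrt (real n * real m / (real n + real m)) * (C (int n) m q \<omega> / real m - C 0 n q \<omega> / real n)\<bar> \<le> \<delta>"
      if \<omega>: "\<omega> \<in> space M - A" for \<omega>
    proof -
      have A1: "\<omega> \<notin> A1 j" "\<omega> \<notin> A2 j" if "j \<le> 2 * K" for j
        using \<omega> that by (auto simp: A_def)
      note kb = conformal_rank_bounds[OF \<alpha>, of n]
      have "\<bar>sqrt (real n * real m / (real n + real m)) *
          (count_le V (int n) m (order_stat V n ?k \<omega>) \<omega> / real m - p)
        - sqrt (real n * real m / (real n + real m)) *
          ((count_le V (int n) m q \<omega> - real m * p) / real m - (count_le V 0 n q \<omega> - real n * p) / real n)\<bar> \<le> 4 * \<epsilon>"
      proof (rule coverage_linearization[OF pos \<open>0 < \<epsilon>\<close>, where k = "real ?k" and u = u and K = K and F = F])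
        show "real n * p \<le> real ?k" "real ?k \<le> real n * p + \<epsilon> * sqrt (real n)"
          using kb e2 by (auto simp: p_def)
        show "order_stat V n ?k \<omega> \<le> v \<longleftrightarrow> real ?k \<le> count_le V 0 n v \<omega>" for v
          by (rule order_stat_le_iff[OF kb(1) k])
        show "count_le V (int n) m v \<omega> \<le> count_le V (int n) m w \<omega>" if "v \<le> w" for v w
          using that by (rule count_le_mono)
        show "F q = p" by (simp add: Fq p_def)
        show "\<bar>count_le V 0 n (u j) \<omega> - real n * F (u j) - (count_le V 0 n q \<omega> - real n * F q)\<bar> \<le> \<epsilon> * sqrt (real n)"
          if "j \<le> 2 * K" for j using A1(1)[OF that] \<omega> by (simp add: A1_def C_def not_less)
        show "\<bar>count_le V (int n) m (u j) \<omega> - real m * F (u j) - (count_le V (int n) m q \<omega> - real m * F q)\<bar> \<le> \<epsilon> * sqrt (real m)"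
          if "j \<le> 2 * K" for j using A1(2)[OF that] \<omega> by (simp add: A2_def C_def not_less)
        show "\<bar>count_le V 0 n q \<omega> - real n * F q\<bar> \<le> (real K - 2) * \<epsilon> * sqrt (real n)"
          using \<omega> by (simp add: A_def A0_def C_def not_less)
      qed (rule u)
      then show ?thesis by (simp add: C_def Fq p_def \<epsilon>_def)
    qed
    ultimately show "\<exists>A\<in>events. prob A \<le> \<eta> \<and>
      (\<forall>\<omega>\<in>space M - A. \<bar>sqrt (real n * real m / (real n + real m)) *
        (count_le V (int n) m (order_stat V n ?k \<omega>) \<omega> / real m - (1 - \<alpha>))
      - sqrt (real n * real m / (real n + real m)) * (C (int n) m q \<omega> / real m - C 0 n q \<omega> / real n)\<bar> \<le> \<delta>)"
      by (intro bexI[of _ A]) auto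
  qed
  then show ?thesis by blast
qed

lemma (in prob_space) char_close:
  fixes f g :: "'a \<Rightarrow> real"
  assumes [measurable]: "f \<in> borel_measurable M" "g \<in> borel_measurable M" "A \<in> events"
    and "prob A \<le> \<eta>" and close: "\<And>\<omega>. \<omega> \<in> space M - A \<Longrightarrow> \<bar>f \<omega> - g \<omega>\<bar> \<le> \<delta>" and "0 \<le> \<delta>"
  shows "norm (char (distr M borel f) t - (\<integral>\<omega>. iexp (t * g \<omega>) \<partial>M)) \<le> \<bar>t\<bar> * \<delta> + 2 * \<eta>"
proof -
  have int: "integrable M (\<lambda>\<omega>. iexp (t * h \<omega>))" if "h \<in> borel_measurable M" for h
    using that by (intro integrable_if_bounded[where B = 1]) auto
  have "char (distr M borel f) t - (\<integral>\<omega>. iexp (t * g \<omega>) \<partial>M) = (\<integral>\<omega>. iexp (t * f \<omega>) - iexp (t * g \<omega>) \<partial>M)"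
    unfolding char_def
    by (subst integral_distr, simp, simp, rule Bochner_Integration.integral_diff[symmetric, OF int int]) simp_all
  also have "norm \<dots> \<le> (\<integral>\<omega>. norm (iexp (t * f \<omega>) - iexp (t * g \<omega>)) \<partial>M)"
    by (rule integral_norm_bound)
  also have "\<dots> \<le> (\<integral>\<omega>. \<bar>t\<bar> * \<delta> + 2 * indicator A \<omega> \<partial>M)"
  proof (rule integral_mono)
    fix \<omega> assume \<omega>: "\<omega> \<in> space M"
    show "norm (iexp (t * f \<omega>) - iexp (t * g \<omega>)) \<le> \<bar>t\<bar> * \<delta> + 2 * indicator A \<omega>"
    proof (cases "\<omega> \<in> A")
      case True
      have "norm (iexp (t * f \<omega>) - iexp (t * g \<omega>)) \<le> norm (iexp (t * f \<omega>)) + norm (iexp (t * g \<omega>))"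
        by (rule norm_triangle_ineq4)
      then have "norm (iexp (t * f \<omega>) - iexp (t * g \<omega>)) \<le> 2" by (simp only: norm_exp_i_times)
      moreover have "0 \<le> \<bar>t\<bar> * \<delta>" using \<open>0 \<le> \<delta>\<close> by simp
      ultimately show ?thesis using True by simp
    next
      case False
      have "norm (iexp (t * f \<omega>) - iexp (t * g \<omega>)) \<le> \<bar>t * f \<omega> - t * g \<omega>\<bar>"
        by (rule norm_iexp_diff_le)
      also have "\<dots> = \<bar>t\<bar> * \<bar>f \<omega> - g \<omega>\<bar>" by (simp add: right_diff_distrib[symmetric] abs_mult)
      also have "\<dots> \<le> \<bar>t\<bar> * \<delta>" using close \<omega> False by (intro mult_left_mono) auto
      finally show ?thesis using False by simp
    qed
  next
    show "integrable M (\<lambda>\<omega>. norm (iexp (t * f \<omega>) - iexp (t * g \<omega>)))"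
      by (intro integrable_norm Bochner_Integration.integrable_diff int) simp_all
    show "integrable M (\<lambda>\<omega>. \<bar>t\<bar> * \<delta> + 2 * indicator A \<omega>)"
      by (rule integrable_if_bounded[where B = "\<bar>t\<bar> * \<delta> + 2"])
        (use \<open>0 \<le> \<delta>\<close> in \<open>auto simp: indicator_def abs_mult\<close>)
  qed
  also have "\<dots> = \<bar>t\<bar> * \<delta> + 2 * prob A"
  proof -
    have "integrable M (\<lambda>\<omega>. 2 * indicator A \<omega> :: real)"
      by (rule integrable_if_bounded[where B = 2]) (auto simp: indicator_def)
    then show ?thesis by (subst Bochner_Integration.integral_add) (simp_all add: prob_space)
  qed
  finally show ?thesis using \<open>prob A \<le> \<eta>\<close> by simp
qed

section \<open>Threshold indicators of a causal process\<close>

lemma influence_diff_le: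
  fixes A B :: "('i \<Rightarrow> 'e) \<Rightarrow> real"
  assumes \<nu>: "prob_space \<nu>" and A: "A \<in> borel_measurable (iid \<nu>)" and B: "B \<in> borel_measurable (iid \<nu>)"
    and b: "\<And>x. \<bar>A x\<bar> \<le> b" "\<And>x. \<bar>B x\<bar> \<le> b"
  shows "influence \<nu> (\<lambda>x. A x - B x) j \<le> influence \<nu> A j + influence \<nu> B j"
proof -
  have neg: "influence \<nu> (\<lambda>x. - B x) j = influence \<nu> B j"
    by (simp add: influence_def norm_L2_def power2_commute)
  have "influence \<nu> (\<lambda>x. \<Sum>t\<in>UNIV. case t of True \<Rightarrow> A x | False \<Rightarrow> - B x) j \<le>
      (\<Sum>t\<in>UNIV. influence \<nu> (\<lambda>x. case t of True \<Rightarrow> A x | False \<Rightarrow> - B x) j)"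
  proof (rule influence_sum_le[OF \<nu>, where b = b])
    show "(\<lambda>x. case t of True \<Rightarrow> A x | False \<Rightarrow> - B x) \<in> borel_measurable (iid \<nu>)" for t
      by (cases t) (simp_all add: A B)
  qed (auto split: bool.split simp: b)
  then show ?thesis by (simp add: UNIV_bool neg)
qed

text \<open>For indicators of short intervals this is the better of the two available bounds at small lags,
where the dependence coefficients are not small.\<close>

lemma influence_le_twice_norm:
  fixes A :: "('i \<Rightarrow> 'e) \<Rightarrow> real"
  assumes \<nu>: "prob_space \<nu>" and A: "A \<in> borel_measurable (iid \<nu>)" and b: "\<And>x. \<bar>A x\<bar> \<le> b"
  shows "influence \<nu> A j \<le> 2 * norm_L2 (iid \<nu>) A"
proof -
  interpret P: prob_space "iid \<nu> :: ('i option \<Rightarrow> 'e) measure" by (rule prob_space_iid[OF \<nu>])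
  define f :: "'i \<Rightarrow> 'i option" where "f = (\<lambda>i. if i = j then None else Some i)"
  have "inj f" by (auto simp: f_def inj_def)
  have norm: "norm_L2 (iid \<nu>) (\<lambda>w. A (\<lambda>i. w (h i))) = norm_L2 (iid \<nu>) A" if "inj h" for h :: "'i \<Rightarrow> 'i option"
    unfolding norm_L2_def using A by (subst integral_iid_reindex[OF \<nu> that]) auto
  have m: "(\<lambda>w. A (\<lambda>i. w (h i))) \<in> borel_measurable (iid \<nu>)" for h :: "'i \<Rightarrow> 'i option"
    by (rule measurable_compose[OF measurable_reindex A])
  have sq: "integrable (iid \<nu>) (\<lambda>w. (A (\<lambda>i. w (h i)))\<^sup>2)" for h :: "'i \<Rightarrow> 'i option"
  proof (rule P.integrable_if_bounded[where B = "b\<^sup>2"])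
    show "norm ((A (\<lambda>i. w (h i)))\<^sup>2) \<le> b\<^sup>2" for w
      using power_mono[OF b[of "\<lambda>i. w (h i)"], of 2] by simp
  qed (use m in measurable)
  have "influence \<nu> A j = norm_L2 (iid \<nu>) (\<lambda>w. A (\<lambda>i. w (Some i)) + - A (\<lambda>i. w (f i)))"
    by (simp add: influence_def resample_def f_def)
  also have "\<dots> \<le> norm_L2 (iid \<nu>) (\<lambda>w. A (\<lambda>i. w (Some i))) + norm_L2 (iid \<nu>) (\<lambda>w. - A (\<lambda>i. w (f i)))"
    by (rule norm_L2_triangle) (use m sq in auto)
  also have "norm_L2 (iid \<nu>) (\<lambda>w. - A (\<lambda>i. w (f i))) = norm_L2 (iid \<nu>) (\<lambda>w. A (\<lambda>i. w (f i)))"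
    by (simp add: norm_L2_def)
  finally show ?thesis using norm[OF \<open>inj f\<close>] norm[of Some] by simp
qed

text \<open>The score process on the canonical space of its innovations. The bound \<open>\<theta>\<close> is uniform in the
threshold, like the supremum in \<open>threshold_dependence\<close>, so that it also covers increments.\<close>

locale threshold_process =
  fixes \<nu> :: "'e measure" and H :: "(nat \<Rightarrow> 'e) \<Rightarrow> real" and \<theta> :: "nat \<Rightarrow> real"
  assumes \<nu>: "prob_space \<nu>"
    and H[measurable]: "H \<in> borel_measurable (iid \<nu>)"
    and influence_le: "influence \<nu> (\<lambda>x. indicator {..v} (H (past (int k) x)) :: real) 0 \<le> \<theta> k"
    and summable_\<theta>: "summable \<theta>"
begin

sublocale P: prob_space "iid \<nu> :: (int \<Rightarrow> 'e) measure"
  by (rule prob_space_iid[OF \<nu>])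

definition U :: "int \<Rightarrow> (int \<Rightarrow> 'e) \<Rightarrow> real" where
  "U t x = H (past t x)"

lemma U_measurable [measurable]: "U t \<in> borel_measurable (iid \<nu>)"
  unfolding U_def[abs_def] by (rule measurable_compose[OF measurable_past H])

definition F :: "real \<Rightarrow> real" where
  "F v = (\<integral>x. indicator {..v} (U 0 x) \<partial>iid \<nu>)"

lemma integrable_indicator_U [simp]: "integrable (iid \<nu>) (\<lambda>x. indicator {..v} (U t x) :: real)"
  by (rule P.integrable_if_bounded[where B = 1]) (auto simp: indicator_def)

lemma indicator_past_measurable [measurable]:
  "(\<lambda>x. indicator {..v} (H (past t x)) :: real) \<in> borel_measurable (iid \<nu>)"
  using U_measurable[of t] unfolding U_def[abs_def] by measurable

lemma integral_indicator_U: "(\<integral>x. indicator {..v} (U t x) \<partial>iid \<nu>) = F v"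
proof -
  have "U t x = U 0 (\<lambda>i. x (i + t))" for x
    by (simp add: U_def past_def add.commute)
  then show ?thesis
    unfolding F_def
    using integral_iid_reindex[OF \<nu>, of "\<lambda>i. i + t" "\<lambda>x. indicator {..v} (U 0 x) :: real"]
    by (simp add: inj_def)
qed

lemma F_mono: "v \<le> w \<Longrightarrow> F v \<le> F w"
  unfolding F_def by (intro integral_mono integrable_indicator_U) (auto simp: indicator_def)

lemma F_bounds: "0 \<le> F v" "F v \<le> 1"
proof -
  show "0 \<le> F v" unfolding F_def by simp
  have "F v \<le> (\<integral>x. 1 \<partial>(iid \<nu> :: (int \<Rightarrow> 'e) measure))"
    unfolding F_def by (intro integral_mono integrable_indicator_U) (auto simp: indicator_def)
  then show "F v \<le> 1" by (simp add: P.prob_space)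
qed

lemma \<theta>_nonneg: "0 \<le> \<theta> k"
  by (rule order_trans[OF influence_nonneg influence_le])

lemma centered_indicator_functional:
  "centered_causal_functional \<nu> (\<lambda>y. indicator {..v} (H y) - F v) \<theta>"
proof (intro centered_causal_functional.intro causal_functional.intro centered_causal_functional_axioms.intro)
  show "(\<lambda>y. indicator {..v} (H y) - F v) \<in> borel_measurable (iid \<nu>)" by measurable
  show "\<bar>indicator {..v} (H y) - F v\<bar> \<le> 1" for y
    using F_bounds[of v] by (auto simp: indicator_def)
  show "influence \<nu> (\<lambda>x. indicator {..v} (H (past (int k) x)) - F v) 0 \<le> \<theta> k" for k
    using influence_le[of v k] by (simp add: influence_def)
  show "(\<integral>x. indicator {..v} (H (past 0 x)) - F v \<partial>iid \<nu>) = 0"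
    using integral_indicator_U[of v 0] integrable_indicator_U[of v 0] by (simp add: U_def P.prob_space)
qed (rule \<nu> summable_\<theta>)+

text \<open>Half the square of the total influence \<open>\<Theta>\<close> for an increment between two thresholds whose levels
differ by \<open>y\<close>; it bounds the variance of the increment of the counts per observation.\<close>

definition modulus :: "real \<Rightarrow> real" where
  "modulus y = (\<Sum>k. min (2 * \<theta> k) (2 * sqrt y))\<^sup>2 / 2"

lemma summable_min: "0 \<le> y \<Longrightarrow> summable (\<lambda>k. min (2 * \<theta> k) (2 * sqrt y))"
  by (rule summable_comparison_test'[OF summable_mult[OF summable_\<theta>, of 2], of 0]) (auto simp: \<theta>_nonneg)

text \<open>The influence of an increment is at most the sum of the influences of its two indicators, and at
most twice its own norm, which is the square root of the difference of the levels.\<close>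

lemma increment_functional:
  "causal_functional \<nu> (\<lambda>y. indicator {..v} (H y) - indicator {..q} (H y))
     (\<lambda>k. min (2 * \<theta> k) (2 * sqrt \<bar>F v - F q\<bar>))"
proof (intro causal_functional.intro)
  let ?A = "\<lambda>w t x. indicator {..w} (H (past t x)) :: real"
  show "(\<lambda>y. indicator {..v} (H y) - indicator {..q} (H y) :: real) \<in> borel_measurable (iid \<nu>)" by measurable
  show "\<bar>indicator {..v} (H y) - indicator {..q} (H y) :: real\<bar> \<le> 1" for y
    by (auto simp: indicator_def)
  show "summable (\<lambda>k. min (2 * \<theta> k) (2 * sqrt \<bar>F v - F q\<bar>))" by (rule summable_min) simp
  show "influence \<nu> (\<lambda>x. ?A v (int k) x - ?A q (int k) x) 0 \<le> min (2 * \<theta> k) (2 * sqrt \<bar>F v - F q\<bar>)" for k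
  proof (rule min.boundedI)
    have "influence \<nu> (\<lambda>x. ?A v (int k) x - ?A q (int k) x) 0 \<le>
        influence \<nu> (?A v (int k)) 0 + influence \<nu> (?A q (int k)) 0"
      by (rule influence_diff_le[OF \<nu>, where b = 1]) (auto simp: indicator_def)
    then show "influence \<nu> (\<lambda>x. ?A v (int k) x - ?A q (int k) x) 0 \<le> 2 * \<theta> k"
      using influence_le[of v k] influence_le[of q k] by linarith
    have "norm_L2 (iid \<nu>) (\<lambda>x. ?A v (int k) x - ?A q (int k) x) = sqrt \<bar>F v - F q\<bar>"
    proof -
      have "(\<integral>x. \<bar>?A v (int k) x - ?A q (int k) x\<bar>\<^sup>2 \<partial>iid \<nu>) = \<bar>F v - F q\<bar>"
        if "v \<le> q" for v q
      proof -
        have "(\<integral>x. \<bar>?A v (int k) x - ?A q (int k) x\<bar>\<^sup>2 \<partial>iid \<nu>) =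
            (\<integral>x. indicator {..q} (U (int k) x) - indicator {..v} (U (int k) x) \<partial>iid \<nu>)"
          using that by (intro Bochner_Integration.integral_cong) (auto simp: indicator_def U_def)
        also have "\<dots> = F q - F v" by (simp add: integral_indicator_U)
        finally show ?thesis using F_mono[OF that] by simp
      qed
      from this[of v q] this[of q v] show ?thesis
        unfolding norm_L2_def by (cases "v \<le> q") (simp_all add: abs_minus_commute)
    qed
    then show "influence \<nu> (\<lambda>x. ?A v (int k) x - ?A q (int k) x) 0 \<le> 2 * sqrt \<bar>F v - F q\<bar>"
      using influence_le_twice_norm[OF \<nu>, of "\<lambda>x. ?A v (int k) x - ?A q (int k) x" 1 0]
      by (force simp: indicator_def)
  qed
qed (rule \<nu>)

lemma count_increment_variance:
  "(\<integral>x. ((count_le U a n v x - real n * F v) - (count_le U a n q x - real n * F q))\<^sup>2 \<partial>iid \<nu>)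
     \<le> real n * modulus \<bar>F v - F q\<bar>"
proof -
  interpret I: causal_functional \<nu> "\<lambda>y. indicator {..v} (H y) - indicator {..q} (H y)"
    "\<lambda>k. min (2 * \<theta> k) (2 * sqrt \<bar>F v - F q\<bar>)"
    by (rule increment_functional)
  have S: "I.S a n x = count_le U a n v x - count_le U a n q x" for x
    by (simp add: I.S_def I.\<xi>_def count_le_def U_def sum_subtractf)
  have mean: "(\<integral>x. I.S a n x \<partial>iid \<nu>) = real n * (F v - F q)"
    unfolding S count_le_def by (simp add: integral_indicator_U right_diff_distrib)
  have "(\<integral>x. ((count_le U a n v x - real n * F v) - (count_le U a n q x - real n * F q))\<^sup>2 \<partial>iid \<nu>) =
      (\<integral>x. (I.S a n x - (\<integral>x. I.S a n x \<partial>iid \<nu>))\<^sup>2 \<partial>iid \<nu>)"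
    unfolding mean unfolding S by (intro Bochner_Integration.integral_cong) (auto simp: algebra_simps)
  also have "\<dots> = (\<integral>x. (I.S a n x)\<^sup>2 \<partial>iid \<nu>) - (\<integral>x. I.S a n x \<partial>iid \<nu>)\<^sup>2"
    by (rule P.variance_eq) auto
  also have "\<dots> \<le> real n * I.\<Theta>\<^sup>2 / 2"
    using I.variance_S_le[of a n] by linarith
  finally show ?thesis by (simp add: modulus_def I.tail_def)
qed

text \<open>Dominated convergence for the series: the tail of the coefficients \<open>\<theta>\<close> has a small sum, and
each of the finitely many other terms is at most \<open>2 sqrt y\<close>.\<close>

lemma modulus_small:
  assumes "0 < \<eta>"
  shows "\<exists>\<delta>>0. \<forall>y. 0 \<le> y \<and> y < \<delta> \<longrightarrow> modulus y \<le> \<eta>"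
proof -
  define s where "s = sqrt (2 * \<eta>)"
  have "0 < s" using assms by (simp add: s_def)
  have "(\<lambda>n. \<Sum>k. 2 * \<theta> (k + n)) \<longlonglongrightarrow> 0"
    using suminf_exist_split2[OF summable_mult[OF summable_\<theta>, of 2]] by simp
  then have "eventually (\<lambda>n. (\<Sum>k. 2 * \<theta> (k + n)) < s / 2) sequentially"
    by (rule order_tendstoD(2)) (use \<open>0 < s\<close> in simp)
  then obtain n where n: "(\<Sum>k. 2 * \<theta> (k + n)) < s / 2"
    unfolding eventually_sequentially by blast
  define \<delta> where "\<delta> = (s / (4 * (real n + 1)))\<^sup>2"
  have "0 < \<delta>" using \<open>0 < s\<close> by (simp add: \<delta>_def)
  moreover have "modulus y \<le> \<eta>" if y: "0 \<le> y" "y < \<delta>" for y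
  proof -
    let ?m = "\<lambda>k. min (2 * \<theta> k) (2 * sqrt y)"
    have "sqrt y \<le> s / (4 * (real n + 1))"
      using y \<open>0 < s\<close> unfolding \<delta>_def by (intro real_le_lsqrt) auto
    then have sy: "real n * (2 * sqrt y) \<le> s / 2"
      using \<open>0 < s\<close> y mult_left_mono[of "sqrt y" "s / (4 * (real n + 1))" "2 * (real n + 1)"]
      by (simp add: field_simps) (smt (verit) real_sqrt_ge_zero mult_nonneg_nonneg)
    have "suminf ?m = (\<Sum>k. ?m (k + n)) + (\<Sum>k<n. ?m k)"
      by (rule suminf_split_initial_segment[OF summable_min[OF y(1)]])
    also have "(\<Sum>k. ?m (k + n)) \<le> (\<Sum>k. 2 * \<theta> (k + n))"
      using summable_min[OF y(1)] summable_mult[OF summable_\<theta>, of 2]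
      by (intro suminf_le) (auto simp: summable_iff_shift[of ?m] summable_iff_shift[of "\<lambda>k. 2 * \<theta> k"])
    also have "(\<Sum>k<n. ?m k) \<le> real n * (2 * sqrt y)"
      using sum_bounded_above[of "{..<n}" ?m "2 * sqrt y"] by simp
    finally have "suminf ?m \<le> s" using n sy by linarith
    moreover have "0 \<le> suminf ?m"
      using y by (intro suminf_nonneg summable_min) (auto simp: \<theta>_nonneg)
    ultimately have "(suminf ?m)\<^sup>2 \<le> s\<^sup>2" by (intro power_mono)
    then show ?thesis using assms by (simp add: modulus_def s_def)
  qed
  ultimately show ?thesis by blast
qed

definition coverage :: "real \<Rightarrow> nat \<Rightarrow> nat \<Rightarrow> (int \<Rightarrow> 'e) \<Rightarrow> real" where
  "coverage \<alpha> n m x =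
    (if conformal_rank \<alpha> n \<le> n then count_le U (int n) m (order_stat U n (conformal_rank \<alpha> n) x) x / real m
     else (\<Sum>t\<in>{int n + 1..int n + int m}. 1) / real m)"

lemma coverage_measurable [measurable]:
  assumes "0 < \<alpha>" "\<alpha> < 1"
  shows "coverage \<alpha> n m \<in> borel_measurable (iid \<nu>)"
proof (cases "conformal_rank \<alpha> n \<le> n")
  case True
  then have "order_stat U n (conformal_rank \<alpha> n) \<in> borel_measurable (iid \<nu>)"
    using conformal_rank_bounds(1)[OF assms, of n] by (intro order_stat_measurable) auto
  with True show ?thesis
    unfolding coverage_def[abs_def]
    by (simp, intro borel_measurable_divide count_le_at_measurable U_measurable) simp_all
qed (simp add: coverage_def[abs_def])

text \<open>The linearization changes the characteristic function by little, and the linear term is covered by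
the normal limit for two adjacent samples.\<close>

theorem char_coverage_tendsto:
  assumes \<alpha>: "0 < \<alpha>" "\<alpha> < 1" and Fq: "F q = 1 - \<alpha>"
    and onto: "\<And>y. 0 < y \<Longrightarrow> y < 1 \<Longrightarrow> \<exists>v. F v = y"
  shows "((\<lambda>(n, m). char (distr (iid \<nu>) borel
        (\<lambda>x. sqrt (real n * real m / (real n + real m)) * (coverage \<alpha> n m x - (1 - \<alpha>)))) t)
      \<longlongrightarrow> of_real (exp (- (t\<^sup>2 * causal_functional.long_run_variance \<nu> (\<lambda>y. indicator {..q} (H y) - F q) / 2))))
    (sequentially \<times>\<^sub>F sequentially)"
proof -
  interpret C: centered_causal_functional \<nu> "\<lambda>y. indicator {..q} (H y) - F q" \<theta>
    by (rule centered_indicator_functional)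
  have S: "C.S a n x = count_le U a n q x - real n * F q" for a n x
    by (simp add: C.S_def C.\<xi>_def count_le_def U_def sum_subtractf)
  have var: "(\<integral>x. (count_le U 0 n q x - real n * F q)\<^sup>2 \<partial>iid \<nu>) \<le> real n * (C.\<Theta>\<^sup>2 / 2)" for n
    using C.variance_S_le[of 0 n] by (simp add: S[symmetric])
  show ?thesis
    unfolding tendsto_iff
  proof (intro allI impI)
    fix e :: real assume "0 < e"
    define \<delta> where "\<delta> = e / (4 * (\<bar>t\<bar> + 1))"
    have "0 < \<delta>" "0 < e / 8" "0 < e / 2" using \<open>0 < e\<close> by (auto simp: \<delta>_def)
    have "\<bar>t\<bar> * \<delta> \<le> e / 4"
    proof -
      have "\<bar>t\<bar> * \<delta> = (e / 4) * (\<bar>t\<bar> / (\<bar>t\<bar> + 1))" by (simp add: \<delta>_def)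
      also have "\<dots> \<le> (e / 4) * 1" using \<open>0 < e\<close> by (intro mult_left_mono) auto
      finally show ?thesis by simp
    qed
    obtain N1 where N1: "\<And>n m. n \<ge> N1 \<Longrightarrow> m \<ge> 1 \<Longrightarrow> conformal_rank \<alpha> n \<le> n \<and> (\<exists>A\<in>sets (iid \<nu>).
        P.prob A \<le> e / 8 \<and> (\<forall>x\<in>space (iid \<nu>) - A. \<bar>sqrt (real n * real m / (real n + real m)) *
        (count_le U (int n) m (order_stat U n (conformal_rank \<alpha> n) x) x / real m - (1 - \<alpha>))
      - sqrt (real n * real m / (real n + real m)) *
        ((count_le U (int n) m q x - real m * F q) / real m - (count_le U 0 n q x - real n * F q) / real n)\<bar> \<le> \<delta>))"
      using P.coverage_linearization_in_probability[OF U_measurable \<alpha> Fq onto count_increment_variance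
          modulus_small var \<open>0 < e / 8\<close> \<open>0 < \<delta>\<close>] by blast
    obtain N2 where N2: "\<And>n m. n \<ge> N2 \<Longrightarrow> m \<ge> N2 \<Longrightarrow> norm ((\<integral>x. iexp (t * (sqrt (real n * real m / (real n + real m)) *
        (C.S (int n) m x / real m - C.S 0 n x / real n))) \<partial>iid \<nu>)
      - of_real (exp (- (t\<^sup>2 * C.long_run_variance / 2)))) < e / 2"
      using C.char_two_samples_normal_limit[OF \<open>0 < e / 2\<close>, of t] by blast
    show "eventually (\<lambda>i. dist (case i of (n, m) \<Rightarrow> char (distr (iid \<nu>) borel
        (\<lambda>x. sqrt (real n * real m / (real n + real m)) * (coverage \<alpha> n m x - (1 - \<alpha>)))) t)
        (of_real (exp (- (t\<^sup>2 * C.long_run_variance / 2)))) < e) (sequentially \<times>\<^sub>F sequentially)"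
      unfolding eventually_prod_sequentially
    proof (intro exI[of _ "max (max N1 N2) 1"] allI impI)
      fix n m assume "max (max N1 N2) 1 \<le> m" "max (max N1 N2) 1 \<le> n"
      then have nm: "n \<ge> N1" "m \<ge> 1" "n \<ge> N2" "m \<ge> N2" by auto
      let ?r = "sqrt (real n * real m / (real n + real m))"
      let ?f = "\<lambda>x. ?r * (coverage \<alpha> n m x - (1 - \<alpha>))"
      let ?g = "\<lambda>x. ?r * (C.S (int n) m x / real m - C.S 0 n x / real n)"
      from N1[OF nm(1,2)] obtain A where A: "A \<in> sets (iid \<nu>)" "P.prob A \<le> e / 8"
        and k: "conformal_rank \<alpha> n \<le> n"
        and close: "\<forall>x\<in>space (iid \<nu>) - A. \<bar>?r *
        (count_le U (int n) m (order_stat U n (conformal_rank \<alpha> n) x) x / real m - (1 - \<alpha>))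
      - ?r * ((count_le U (int n) m q x - real m * F q) / real m - (count_le U 0 n q x - real n * F q) / real n)\<bar> \<le> \<delta>"
        by blast
      note [measurable] = coverage_measurable[OF \<alpha>]
      have "norm (char (distr (iid \<nu>) borel ?f) t - (\<integral>x. iexp (t * ?g x) \<partial>iid \<nu>)) \<le> \<bar>t\<bar> * \<delta> + 2 * (e / 8)"
      proof (rule P.char_close[OF _ _ A])
        show "\<bar>?f x - ?g x\<bar> \<le> \<delta>" if "x \<in> space (iid \<nu>) - A" for x
          using bspec[OF close that] k by (simp add: S coverage_def)
      qed (use \<open>0 < \<delta>\<close> in auto)
      moreover have "norm ((\<integral>x. iexp (t * ?g x) \<partial>iid \<nu>) - of_real (exp (- (t\<^sup>2 * C.long_run_variance / 2)))) < e / 2"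
        by (rule N2[OF nm(3,4)])
      ultimately have "norm (char (distr (iid \<nu>) borel ?f) t - of_real (exp (- (t\<^sup>2 * C.long_run_variance / 2)))) < e"
        using norm_triangle_ineq[of "char (distr (iid \<nu>) borel ?f) t - (\<integral>x. iexp (t * ?g x) \<partial>iid \<nu>)"
            "(\<integral>x. iexp (t * ?g x) \<partial>iid \<nu>) - of_real (exp (- (t\<^sup>2 * C.long_run_variance / 2)))"]
          \<open>\<bar>t\<bar> * \<delta> \<le> e / 4\<close> by simp
      then show "dist (case (n, m) of (n, m) \<Rightarrow> char (distr (iid \<nu>) borel
        (\<lambda>x. sqrt (real n * real m / (real n + real m)) * (coverage \<alpha> n m x - (1 - \<alpha>)))) t)
        (of_real (exp (- (t\<^sup>2 * C.long_run_variance / 2)))) < e"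
        by (simp add: dist_norm)
    qed
  qed
qed

end

section \<open>Central limit theorem for the realized coverage\<close>

lemma has_sum_symmetric_int:
  fixes f :: "nat \<Rightarrow> real"
  assumes "summable (\<lambda>n. \<bar>f n\<bar>)"
  shows "((\<lambda>h::int. f (nat \<bar>h\<bar>)) has_sum (f 0 + 2 * (\<Sum>i. f (Suc i)))) UNIV"
proof -
  have s: "summable (\<lambda>n. norm (f n))" "summable (\<lambda>n. norm (f (Suc n)))"
    using assms by (simp_all add: summable_Suc_iff[of "\<lambda>n. \<bar>f n\<bar>"])
  have "((\<lambda>h::int. f (nat \<bar>h\<bar>)) has_sum suminf f) (range int)"
    by (subst has_sum_reindex) (use norm_summable_imp_has_sum[OF s(1)] summable_sums[OF summable_norm_cancel[OF s(1)]] in \<open>auto simp: comp_def\<close>)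
  moreover have "((\<lambda>h::int. f (nat \<bar>h\<bar>)) has_sum (\<Sum>i. f (Suc i))) (range (\<lambda>n. - int (Suc n)))"
    by (subst has_sum_reindex) (use norm_summable_imp_has_sum[OF s(2)] summable_sums[OF summable_norm_cancel[OF s(2)]] in \<open>auto simp: comp_def inj_on_def nat_add_distrib\<close>)
  ultimately have "((\<lambda>h::int. f (nat \<bar>h\<bar>)) has_sum (suminf f + (\<Sum>i. f (Suc i)))) (range int \<union> range (\<lambda>n. - int (Suc n)))"
    by (rule has_sum_Un_disjoint) auto
  moreover have "range int \<union> range (\<lambda>n. - int (Suc n)) = UNIV"
  proof -
    have "h \<in> range int \<union> range (\<lambda>n. - int (Suc n))" for h
      by (cases h rule: int_cases) auto
    then show ?thesis by blast
  qed
  moreover have "suminf f = f 0 + (\<Sum>i. f (Suc i))"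
    using suminf_split_head[OF summable_norm_cancel[OF s(1)]] by simp
  ultimately show ?thesis by (simp add: add.commute)
qed

lemma continuous_cdf_attains:
  assumes "real_distribution N" and cont: "continuous_on UNIV (cdf N)" and y: "0 < y" "y < 1"
  shows "\<exists>v. cdf N v = y"
proof -
  interpret N: real_distribution N by fact
  have "eventually (\<lambda>v. cdf N v < y) at_bot"
    using N.cdf_lim_at_bot y by (intro order_tendstoD(2))
  then obtain a where a: "cdf N a < y" unfolding eventually_at_bot_linorder by blast
  have "eventually (\<lambda>v. y < cdf N v) at_top"
    using N.cdf_lim_at_top_prob y by (intro order_tendstoD(1))
  then obtain b where b: "y < cdf N b" unfolding eventually_at_top_linorder by blast
  have "a \<le> b"
    using N.cdf_nondecreasing[of b a] a b by (cases "a \<le> b") auto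
  then show ?thesis
    using IVT'[of "cdf N" a y b] a b continuous_on_subset[OF cont] by fastforce
qed

lemma cdf_quantile:
  assumes N: "real_distribution N" and cont: "continuous_on UNIV (cdf N)" and y: "0 < y" "y < 1"
  shows "cdf N (quantile (cdf N) y) = y"
proof -
  interpret N: real_distribution N by fact
  let ?S = "{v. cdf N v \<ge> y}"
  obtain v where v: "cdf N v = y" using continuous_cdf_attains[OF assms] by blast
  have "0 < y / 2" "y / 2 < 1" using y by auto
  then obtain a where a: "cdf N a = y / 2" using continuous_cdf_attains[OF N cont] by blast
  have bdd: "bdd_below ?S"
  proof (rule bdd_belowI[of _ a])
    fix w assume "w \<in> ?S"
    then have "cdf N a < cdf N w" using a y by simp
    then show "a \<le> w" using N.cdf_nondecreasing[of w a] by (cases "a \<le> w") auto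
  qed
  have "closed ?S"
    using closed_Collect_le[OF continuous_on_const cont] .
  moreover have "?S \<noteq> {}" using v by auto
  ultimately have "Inf ?S \<in> ?S" using bdd by (intro closed_contains_Inf)
  moreover have "cdf N (Inf ?S) \<le> y"
    using N.cdf_nondecreasing[OF cInf_lower[OF _ bdd, of v]] v by auto
  ultimately show ?thesis by (simp add: quantile_def)
qed

text \<open>Identifies the law of the innovations with the canonical measure, so that statements proved there
transfer to the given probability space.\<close>

lemma law_of_independent_family:
  assumes M: "prob_space M" and "prob_space.indep_vars M (\<lambda>_. E) Z UNIV"
    and ident: "\<And>i. distr M E (Z i) = \<nu>"
  shows "(\<lambda>\<omega> i. Z i \<omega>) \<in> M \<rightarrow>\<^sub>M iid \<nu>" "distr M (iid \<nu>) (\<lambda>\<omega> i. Z i \<omega>) = iid \<nu>"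
proof -
  interpret prob_space M by fact
  have Z: "Z i \<in> M \<rightarrow>\<^sub>M E" for i
    using assms(2) by (auto simp: indep_vars_def)
  have "sets \<nu> = sets E" using ident[symmetric] by (metis sets_distr)
  then have sets: "sets (iid \<nu>) = sets (iid E)" by (intro sets_PiM_cong) auto
  have "(\<lambda>\<omega> i. Z i \<omega>) \<in> M \<rightarrow>\<^sub>M iid E"
    by (rule measurable_PiM_single') (use Z measurable_space[OF Z] in \<open>auto simp: space_PiM PiE_iff\<close>)
  then show "(\<lambda>\<omega> i. Z i \<omega>) \<in> M \<rightarrow>\<^sub>M iid \<nu>"
    unfolding measurable_cong_sets[OF refl sets] .
  have "distr M (iid \<nu>) (\<lambda>\<omega> i. Z i \<omega>) = distr M (iid E) (\<lambda>\<omega>. \<lambda>i\<in>UNIV. Z i \<omega>)"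
    by (rule distr_cong) (simp_all add: sets restrict_UNIV)
  also have "\<dots> = iid \<nu>"
    using indep_vars_iff_distr_eq_PiM'[of UNIV Z "\<lambda>_. E"] assms(2) Z by (simp add: ident)
  finally show "distr M (iid \<nu>) (\<lambda>\<omega> i. Z i \<omega>) = iid \<nu>" .
qed

text \<open>The innovations together with the spare copy \<open>\<epsilon>'\<close> form an independent family indexed by an option
type, in which \<open>V'\<close> is computed from the family resampled at time \<open>0\<close>. Hence \<open>threshold_dependence\<close> is
a supremum of influences, and the scores are a threshold process on the canonical space.\<close>

theorem theorem3:
  fixes M :: "'a measure" and E :: "'e measure"
    and \<epsilon> :: "int \<Rightarrow> 'a \<Rightarrow> 'e" and \<epsilon>' :: "'a \<Rightarrow> 'e"
    and G :: "(nat \<Rightarrow> 'e) \<Rightarrow> (real ^ 'd) \<times> real" and H :: "(nat \<Rightarrow> 'e) \<Rightarrow> real"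
    and \<mu> :: "real ^ 'd \<Rightarrow> real"
    and X :: "int \<Rightarrow> 'a \<Rightarrow> real ^ 'd" and Y V V' :: "int \<Rightarrow> 'a \<Rightarrow> real"
    and F f :: "real \<Rightarrow> real" and \<alpha> q e c C :: real
  assumes "prob_space M"
    and "prob_space.indep_vars M (\<lambda>_. E)
           (\<lambda>i. case i of None \<Rightarrow> \<epsilon>' | Some t \<Rightarrow> \<epsilon> t) (UNIV :: int option set)"
    and "\<And>t. distr M E (\<epsilon> t) = distr M E (\<epsilon> 0)"
    and "distr M E \<epsilon>' = distr M E (\<epsilon> 0)"
    and "G \<in> (\<Pi>\<^sub>M j\<in>UNIV. E) \<rightarrow>\<^sub>M borel"
    and "H \<in> (\<Pi>\<^sub>M j\<in>UNIV. E) \<rightarrow>\<^sub>M borel"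
    and "\<mu> \<in> borel_measurable borel"
    and "\<And>t \<omega>. \<omega> \<in> space M \<Longrightarrow> (X t \<omega>, Y t \<omega>) = G (\<lambda>j. \<epsilon> (t - int j) \<omega>)"
    and "\<And>t \<omega>. \<omega> \<in> space M \<Longrightarrow> V t \<omega> = \<bar>Y t \<omega> - \<mu> (X t \<omega>)\<bar>"
    and "\<And>t \<omega>. \<omega> \<in> space M \<Longrightarrow> V t \<omega> = H (\<lambda>j. \<epsilon> (t - int j) \<omega>)"
    and "\<And>t \<omega>. \<omega> \<in> space M \<Longrightarrow> V' t \<omega> = H (\<lambda>j. (\<epsilon>(0 := \<epsilon>')) (t - int j) \<omega>)"
    and "F = cdf (distr M borel (V 0))"
    and "0 < \<alpha>" "\<alpha> < 1"
    and "q = quantile F (1 - \<alpha>)"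
    and "continuous_on UNIV F"
    and "summable (threshold_dependence M V V')"
    and "e > 0" "0 < c" "c \<le> C"
    and "density_of_cdf_on F f (q - e) (q + e)"
    and "\<And>v. \<bar>v - q\<bar> \<le> e \<Longrightarrow> c \<le> f v \<and> f v \<le> C"
    and "isCont f q"
    and "\<And>s t. s \<noteq> t \<Longrightarrow> measure M {\<omega> \<in> space M. V s \<omega> = V t \<omega>} = 0"
  shows "(\<lambda>h. \<bar>coverage_autocov M V q h\<bar>) summable_on UNIV \<and>
         0 \<le> infsum (coverage_autocov M V q) UNIV \<and>
         weak_conv_along
           (\<lambda>(n, m). distr M borel (\<lambda>\<omega>. sqrt (real n * real m / (real n + real m)) *
              (realized_coverage \<alpha> \<mu> X Y V n m \<omega> - (1 - \<alpha>))))
           (normal_law 0 (infsum (coverage_autocov M V q) UNIV))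
           (sequentially \<times>\<^sub>F sequentially)"
proof -
  interpret M: prob_space M by fact
  define \<nu> where "\<nu> = distr M E (\<epsilon> 0)"
  define Z where "Z = (\<lambda>i. case i of None \<Rightarrow> \<epsilon>' | Some t \<Rightarrow> \<epsilon> t)"
  have indep: "M.indep_vars (\<lambda>_. E) Z UNIV" using assms(2) by (simp add: Z_def)
  have \<epsilon>_meas: "\<epsilon> t \<in> M \<rightarrow>\<^sub>M E" for t
  proof -
    have "Z (Some t) \<in> M \<rightarrow>\<^sub>M E" using indep unfolding M.indep_vars_def by blast
    then show ?thesis by (simp add: Z_def)
  qed
  have \<nu>: "prob_space \<nu>" unfolding \<nu>_def by (rule M.prob_space_distr[OF \<epsilon>_meas])
  have ident: "distr M E (Z i) = \<nu>" for i
    using assms(3,4) by (cases i) (auto simp: Z_def \<nu>_def)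
  define W where "W = (\<lambda>\<omega> i. Z i \<omega>)"
  note W_law = law_of_independent_family[OF assms(1) indep ident, folded W_def]
  define path where "path \<omega> = (\<lambda>t. W \<omega> (Some t))" for \<omega>
  have path: "path \<omega> t = \<epsilon> t \<omega>" for \<omega> t by (simp add: path_def W_def Z_def)
  have path_meas[measurable]: "path \<in> M \<rightarrow>\<^sub>M iid \<nu>"
    unfolding path_def[abs_def] by (rule measurable_compose[OF W_law(1) measurable_reindex])
  have path_law: "distr M (iid \<nu>) path = iid \<nu>"
  proof -
    have "distr (distr M (iid \<nu>) W) (iid \<nu>) (\<lambda>w t. w (Some t)) = distr M (iid \<nu>) ((\<lambda>w t. w (Some t)) \<circ> W)"
      by (rule distr_distr[OF measurable_reindex W_law(1)])
    moreover have "(\<lambda>w t. w (Some t)) \<circ> W = path" by (auto simp: path_def fun_eq_iff)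
    ultimately show ?thesis using distr_iid_reindex[OF \<nu>, of "Some :: int \<Rightarrow> int option"] by (simp add: W_law(2))
  qed
  have sets: "sets (iid \<nu>) = sets (\<Pi>\<^sub>M j\<in>UNIV. E)" by (intro sets_PiM_cong) (auto simp: \<nu>_def)
  have H[measurable]: "H \<in> borel_measurable (iid \<nu>)"
    using assms(6) by (simp add: measurable_cong_sets[OF sets refl])
  have V: "V t \<omega> = H (past t (path \<omega>))" if "\<omega> \<in> space M" for t \<omega>
    using assms(10)[OF that] by (simp add: past_def path)
  have V': "V' t \<omega> = H (past t (resample 0 (W \<omega>)))" if "\<omega> \<in> space M" for t \<omega>
  proof -
    have "(\<lambda>j. (\<epsilon>(0 := \<epsilon>')) (t - int j) \<omega>) = past t (resample 0 (W \<omega>))"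
      by (auto simp: past_def resample_def W_def Z_def fun_eq_iff)
    then show ?thesis using assms(11)[OF that] by simp
  qed
  have infl: "norm_L2 M (\<lambda>\<omega>. indicator {..v} (V (int k) \<omega>) - indicator {..v} (V' (int k) \<omega>)) =
      influence \<nu> (\<lambda>x. indicator {..v} (H (past (int k) x)) :: real) 0" for v k
  proof -
    let ?f = "\<lambda>x. indicator {..v} (H (past (int k) x)) :: real"
    have f: "?f \<in> borel_measurable (iid \<nu>)"
      using measurable_compose[OF measurable_past H] by measurable
    note [measurable] = measurable_compose[OF measurable_reindex f] measurable_compose[OF measurable_resample f]
    have "influence \<nu> ?f 0 = sqrt (\<integral>\<omega>. \<bar>norm (?f (\<lambda>i. W \<omega> (Some i)) - ?f (resample 0 (W \<omega>)))\<bar>\<^sup>2 \<partial>M)"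
      unfolding influence_def norm_L2_def
      by (subst W_law(2)[symmetric], subst integral_distr[OF W_law(1)]) auto
    also have "(\<integral>\<omega>. \<bar>norm (?f (\<lambda>i. W \<omega> (Some i)) - ?f (resample 0 (W \<omega>)))\<bar>\<^sup>2 \<partial>M) =
        (\<integral>\<omega>. \<bar>indicator {..v} (V (int k) \<omega>) - indicator {..v} (V' (int k) \<omega>)\<bar>\<^sup>2 \<partial>M)"
      by (intro Bochner_Integration.integral_cong) (auto simp: V V' path_def)
    finally show ?thesis by (simp add: norm_L2_def)
  qed
  interpret T: threshold_process \<nu> H "threshold_dependence M V V'"
  proof (intro threshold_process.intro \<nu> H assms(17))
    fix v k
    have "norm_L2 M (\<lambda>\<omega>. indicator {..v} (V (int k) \<omega>) - indicator {..v} (V' (int k) \<omega>)) \<le> 1" for v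
    proof -
      have "(\<integral>\<omega>. \<bar>indicator {..v} (V (int k) \<omega>) - indicator {..v} (V' (int k) \<omega>)\<bar>\<^sup>2 \<partial>M) \<le> (\<integral>\<omega>. 1 \<partial>M :: real)"
        by (rule integral_mono') (auto simp: indicator_def)
      then have "(\<integral>\<omega>. \<bar>indicator {..v} (V (int k) \<omega>) - indicator {..v} (V' (int k) \<omega>)\<bar>\<^sup>2 \<partial>M) \<le> (1::real)"
        by (simp add: M.prob_space)
      then show ?thesis by (simp add: norm_L2_def)
    qed
    then have "bdd_above (range (\<lambda>v. norm_L2 M (\<lambda>\<omega>. indicator {..v} (V (int k) \<omega>) - indicator {..v} (V' (int k) \<omega>))))"
      by (intro bdd_aboveI[of _ 1]) auto
    then show "influence \<nu> (\<lambda>x. indicator {..v} (H (past (int k) x)) :: real) 0 \<le> threshold_dependence M V V' k"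
      unfolding infl[symmetric] threshold_dependence_def by (intro cSUP_upper) auto
  qed
  have VU: "V t \<omega> = T.U t (path \<omega>)" if "\<omega> \<in> space M" for t \<omega>
    using V[OF that] by (simp add: T.U_def)
  have V_meas[measurable]: "V t \<in> borel_measurable M" for t
    using measurable_compose[OF path_meas T.U_measurable] by (subst measurable_cong[OF VU])
  have integral_path: "(\<integral>\<omega>. f (path \<omega>) \<partial>M) = (\<integral>x. f x \<partial>iid \<nu>)" if "f \<in> borel_measurable (iid \<nu>)" for f :: "_ \<Rightarrow> real"
    using integral_distr[OF path_meas that] by (simp add: path_law)
  have V0: "real_distribution (distr M borel (V 0))"
    by (rule M.real_distribution_distr) simp
  have F: "T.F v = F v" for v
  proof -
    have "T.F v = (\<integral>\<omega>. indicator {..v} (V 0 \<omega>) \<partial>M)"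
      unfolding T.F_def by (subst integral_path[symmetric]) (auto simp: VU intro!: Bochner_Integration.integral_cong)
    also have "\<dots> = (\<integral>\<omega>. indicator {\<omega> \<in> space M. V 0 \<omega> \<le> v} \<omega> \<partial>M)"
      by (intro Bochner_Integration.integral_cong) (auto simp: indicator_def)
    also have "\<dots> = F v"
      by (simp add: assms(12) cdf_def measure_distr vimage_def Int_def conj_commute)
    finally show ?thesis .
  qed
  have y: "0 < 1 - \<alpha>" "1 - \<alpha> < 1" using assms(13,14) by auto
  have Fq: "T.F q = 1 - \<alpha>"
    unfolding F using cdf_quantile[OF V0 _ y] assms(12,15,16) by simp
  have onto: "\<exists>v. T.F v = y" if "0 < y" "y < 1" for y
    unfolding F using continuous_cdf_attains[OF V0 _ that] assms(12,16) by simp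
  interpret C: centered_causal_functional \<nu> "\<lambda>y. indicator {..q} (H y) - T.F q" "threshold_dependence M V V'"
    by (rule T.centered_indicator_functional)
  have \<xi>: "C.\<xi> t x = indicator {..q} (T.U t x) - T.F q" for t x
    by (simp add: C.\<xi>_def T.U_def)
  have mean: "(\<integral>\<omega>. indicator {..q} (V t \<omega>) \<partial>M) = T.F q" for t
  proof -
    have "(\<integral>\<omega>. indicator {..q} (V t \<omega>) \<partial>M) = (\<integral>\<omega>. indicator {..q} (T.U t (path \<omega>)) \<partial>M)"
      by (intro Bochner_Integration.integral_cong) (auto simp: VU)
    also have "\<dots> = T.F q" by (subst integral_path) (auto simp: T.integral_indicator_U)
    finally show ?thesis .
  qed
  have autocov: "coverage_autocov M V q h = C.autocov (nat \<bar>h\<bar>)" for h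
  proof -
    have "coverage_autocov M V q h = (\<integral>\<omega>. C.\<xi> 0 (path \<omega>) * C.\<xi> h (path \<omega>) \<partial>M)"
      unfolding coverage_autocov_def covariance_def mean
      by (intro Bochner_Integration.integral_cong) (auto simp: VU \<xi>)
    also have "\<dots> = (\<integral>x. C.\<xi> 0 x * C.\<xi> h x \<partial>iid \<nu>)"
      by (rule integral_path) measurable
    also have "\<dots> = C.autocov (nat \<bar>h\<bar>)"
    proof (cases "0 \<le> h")
      case True
      then show ?thesis using C.integral_\<xi>_prod[of 0 "nat \<bar>h\<bar>"] by simp
    next
      case False
      then show ?thesis using C.integral_\<xi>_prod[of h "nat \<bar>h\<bar>"] by (simp add: mult.commute)
    qed
    finally show ?thesis .
  qed
  have summ: "(\<lambda>h. \<bar>coverage_autocov M V q h\<bar>) summable_on UNIV"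
    unfolding autocov using has_sum_symmetric_int[of "\<lambda>n. \<bar>C.autocov n\<bar>"] C.summable_autocov
    by (auto simp: has_sum_imp_summable)
  have \<sigma>: "infsum (coverage_autocov M V q) UNIV = C.long_run_variance"
    unfolding autocov[abs_def] C.long_run_variance_def
    by (rule infsumI[OF has_sum_symmetric_int[OF C.summable_autocov]])
  let ?T = "\<lambda>n m \<omega>. sqrt (real n * real m / (real n + real m)) * (realized_coverage \<alpha> \<mu> X Y V n m \<omega> - (1 - \<alpha>))"
  let ?T' = "\<lambda>n m x. sqrt (real n * real m / (real n + real m)) * (T.coverage \<alpha> n m x - (1 - \<alpha>))"
  note [measurable] = T.coverage_measurable[OF assms(13,14)]
  have law: "distr M borel (?T n m) = distr (iid \<nu>) borel (?T' n m)" for n m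
  proof -
    have "realized_coverage \<alpha> \<mu> X Y V n m \<omega> = T.coverage \<alpha> n m (path \<omega>)" if \<omega>: "\<omega> \<in> space M" for \<omega>
      using realized_coverage_eq[of V \<omega> Y \<mu> X \<alpha> n m] assms(9)[OF \<omega>]
      by (simp add: T.coverage_def count_le_def order_stat_def VU[OF \<omega>])
    then have "distr M borel (?T n m) = distr M borel (\<lambda>\<omega>. ?T' n m (path \<omega>))"
      by (intro distr_cong) auto
    also have "\<dots> = distr (distr M (iid \<nu>) path) borel (?T' n m)"
      by (subst distr_distr) (auto simp: comp_def)
    finally show ?thesis by (simp add: path_law)
  qed
  have conv: "weak_conv_along (\<lambda>(n, m). distr (iid \<nu>) borel (?T' n m)) (normal_law 0 C.long_run_variance)
      (sequentially \<times>\<^sub>F sequentially)"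
  proof (rule weak_conv_along_prod_sequentiallyI)
    show "real_distribution (distr (iid \<nu>) borel (?T' n m))" for n m
      by (rule T.P.real_distribution_distr) measurable
    show "real_distribution (normal_law 0 C.long_run_variance)"
      by (rule real_distribution_normal_law[OF C.long_run_variance_nonneg])
    show "((\<lambda>(n, m). char (distr (iid \<nu>) borel (?T' n m)) t) \<longlongrightarrow> char (normal_law 0 C.long_run_variance) t)
        (sequentially \<times>\<^sub>F sequentially)" for t
      unfolding char_normal_law[OF C.long_run_variance_nonneg]
      by (rule T.char_coverage_tendsto[OF assms(13,14) Fq onto])
  qed
  show ?thesis
    using summ conv C.long_run_variance_nonneg unfolding \<sigma> law by blast
qed

end
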